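(* Let $\alpha\in(0,2)$ and let $W_t=(X_t,Y_t,Z_t)$, where $X,Y,Z$ are independent one-dimensional symmetric stable processes of index $\alpha$ (i.e. the case $d=3$, $A\equiv I$ of the system $dX_t=A(X_{t-})\,dZ_t$). Let $B=B(0,1)\subset\mathbb{R}^3$, $\tau=\inf\{t\ge 0:W_t\notin B\}$, $w_0=(0,\tfrac12,0)$, and for $\varepsilon\in(0,1)$ let $E_\varepsilon=(2,4)\times(-\varepsilon,\varepsilon)^2\subset\mathbb{R}^3$ and $h_\varepsilon(w)=\mathbb{P}^w(W_\tau\in E_\varepsilon)$, $w\in\mathbb{R}^3$. Then $$\frac{h_\varepsilon(0)}{h_\varepsilon(w_0)}\to\infty\qquad\text{as }\varepsilon\to 0.$$ Consequently the Harnack inequality fails for $W$: there is no constant $c<\infty$ such that $h(0)\le c\,h(w_0)$ for all functions $h$ that are non-negative and bounded on $\mathbb{R}^3$ and harmonic in $B$ with respect to $W$.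
   Context: $B(x,r)$ is the open ball of radius $r$ centered at $x$. A one-dimensional symmetric stable process of index $\alpha\in(0,2)$ is the real-valued Lévy process with no drift, no Gaussian part, and Lévy measure $\kappa|h|^{-1-\alpha}\,dh$, where $\kappa>0$ is a fixed constant. $\mathbb{P}^w$ denotes the law of $W$ started at $W_0=w$. A function $h$ bounded on $\mathbb{R}^3$ is harmonic in a domain $D$ with respect to $W$ if $h(W_{t\wedge\tau_D})$, $t\ge0$, is a martingale with respect to $\mathbb{P}^w$ for every $w\in D$, where $\tau_D=\inf\{t\ge0:W_t\notin D\}$. *)

theory Defs
  imports "HOL-Probability.Probability"
begin

section \<open>Symmetric stable processes\<close>

definition cadlag :: "(real \<Rightarrow> real) \<Rightarrow> bool" where
  "cadlag f \<longleftrightarrow>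
     (\<forall>t\<ge>0. continuous (at_right t) f) \<and> (\<forall>t>0. \<exists>l. (f \<longlongrightarrow> l) (at_left t))"

text \<open>Time is \<open>[0, \<infinity>)\<close>; values of a process at negative times are never used.\<close>

locale levy_process = prob_space M for M :: "'w measure" +
  fixes X :: "real \<Rightarrow> 'w \<Rightarrow> real"
  assumes measurable_X: "\<And>t. 0 \<le> t \<Longrightarrow> X t \<in> borel_measurable M"
    and start_X: "AE \<omega> in M. X 0 \<omega> = 0"
    and indep_increments: "\<And>(s :: nat \<Rightarrow> real) n. 0 \<le> s 0 \<Longrightarrow> (\<forall>k<n. s k \<le> s (Suc k)) \<Longrightarrow>
          indep_vars (\<lambda>_. borel) (\<lambda>k \<omega>. X (s (Suc k)) \<omega> - X (s k) \<omega>) {..<n}"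
    and stationary_increments: "\<And>s t. 0 \<le> s \<Longrightarrow> 0 \<le> t \<Longrightarrow>
          distr M borel (\<lambda>\<omega>. X (s + t) \<omega> - X s \<omega>) = distr M borel (X t)"
    and cadlag_paths: "AE \<omega> in M. cadlag (\<lambda>t. X t \<omega>)"

definition levy_measure :: "real measure \<Rightarrow> bool" where
  "levy_measure \<nu> \<longleftrightarrow> sets \<nu> = sets borel \<and> emeasure \<nu> {0} = 0 \<and>
     (\<integral>\<^sup>+ x. ennreal (min 1 (x\<^sup>2)) \<partial>\<nu>) < \<infinity>"

text \<open>The Levy-Khintchine exponent with drift \<open>b\<close>, Gaussian variance \<open>s\<close> and Levy measure \<open>\<nu>\<close>.
  For symmetric \<open>\<nu>\<close> the choice of the truncation does not influence the drift.\<close>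

definition levy_exponent :: "real \<Rightarrow> real \<Rightarrow> real measure \<Rightarrow> real \<Rightarrow> complex" where
  "levy_exponent b s \<nu> u =
     \<i> * complex_of_real (b * u) - complex_of_real (s * u\<^sup>2 / 2) +
     (CLINT x|\<nu>. iexp (u * x) - 1 - \<i> * complex_of_real (u * x * indicator {-1..1} x))"

definition (in levy_process) has_levy_triplet :: "real \<Rightarrow> real \<Rightarrow> real measure \<Rightarrow> bool" where
  "has_levy_triplet b s \<nu> \<longleftrightarrow> 0 \<le> s \<and> levy_measure \<nu> \<and>
     (\<forall>t\<ge>0. \<forall>u. char (distr M borel (X t)) u = exp (complex_of_real t * levy_exponent b s \<nu> u))"

definition stable_levy_measure :: "real \<Rightarrow> real \<Rightarrow> real measure" where
  "stable_levy_measure \<alpha> \<kappa> = density lborel (\<lambda>x. ennreal (\<kappa> * \<bar>x\<bar> powr (- 1 - \<alpha>)))"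

definition symmetric_stable_process ::
    "real \<Rightarrow> real \<Rightarrow> 'w measure \<Rightarrow> (real \<Rightarrow> 'w \<Rightarrow> real) \<Rightarrow> bool" where
  "symmetric_stable_process \<alpha> \<kappa> M X \<longleftrightarrow>
     levy_process M X \<and> levy_process.has_levy_triplet M X 0 0 (stable_levy_measure \<alpha> \<kappa>)"

text \<open>\<open>P w\<close> is the probability under which \<open>W\<close> starts at \<open>w\<close>: the components of \<open>W - w\<close> are
  symmetric stable processes, and the component processes (as random paths) are independent.\<close>

definition indep_stable_family ::
    "real \<Rightarrow> real \<Rightarrow> (real^'n \<Rightarrow> 'w measure) \<Rightarrow> (real \<Rightarrow> 'w \<Rightarrow> real^'n) \<Rightarrow> bool" where
  "indep_stable_family \<alpha> \<kappa> P W \<longleftrightarrow>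
     (\<forall>w. (\<forall>i. symmetric_stable_process \<alpha> \<kappa> (P w) (\<lambda>t \<omega>. W t \<omega> $ i - w $ i)) \<and>
          prob_space.indep_vars (P w) (\<lambda>_. PiM {0..} (\<lambda>_. borel))
            (\<lambda>i \<omega>. \<lambda>t\<in>{0..}. W t \<omega> $ i) UNIV)"

section \<open>Exit times and harmonic functions\<close>

definition exit_time :: "(real \<Rightarrow> 'w \<Rightarrow> 'a) \<Rightarrow> 'a set \<Rightarrow> 'w \<Rightarrow> ereal" where
  "exit_time W D \<omega> = (INF t\<in>{t. 0 \<le> t \<and> W t \<omega> \<notin> D}. ereal t)"

text \<open>The first exit time of a cadlag process from an open set need not be measurable for the
  uncompleted \<open>\<sigma>\<close>-algebra. As usual, probabilities are therefore taken with respect to the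
  completed measure, and the natural filtration is augmented by the null sets.\<close>

definition exit_prob ::
    "('a \<Rightarrow> 'w measure) \<Rightarrow> (real \<Rightarrow> 'w \<Rightarrow> 'a) \<Rightarrow> 'a set \<Rightarrow> 'a set \<Rightarrow> 'a \<Rightarrow> real" where
  "exit_prob P W D E w = measure (completion (P w))
     {\<omega> \<in> space (P w). exit_time W D \<omega> < \<infinity> \<and> W (real_of_ereal (exit_time W D \<omega>)) \<omega> \<in> E}"

definition augmented_filtration ::
    "'w measure \<Rightarrow> (real \<Rightarrow> 'w \<Rightarrow> 'a::topological_space) \<Rightarrow> real \<Rightarrow> 'w measure" where
  "augmented_filtration M W t = sigma (space M)
     ({W s -` A \<inter> space M | s A. 0 \<le> s \<and> s \<le> t \<and> A \<in> sets borel} \<union> null_sets (completion M))"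

definition martingale ::
    "'w measure \<Rightarrow> (real \<Rightarrow> 'w measure) \<Rightarrow> (real \<Rightarrow> 'w \<Rightarrow> real) \<Rightarrow> bool" where
  "martingale M F Y \<longleftrightarrow> filtration (space M) F \<and>
     (\<forall>t\<ge>0. subalgebra M (F t) \<and> Y t \<in> borel_measurable (F t) \<and> integrable M (Y t)) \<and>
     (\<forall>s t. 0 \<le> s \<and> s \<le> t \<longrightarrow> (AE \<omega> in M. real_cond_exp M (F s) (Y t) \<omega> = Y s \<omega>))"

definition harmonic ::
    "('a::topological_space \<Rightarrow> 'w measure) \<Rightarrow> (real \<Rightarrow> 'w \<Rightarrow> 'a) \<Rightarrow> 'a set \<Rightarrow> ('a \<Rightarrow> real) \<Rightarrow> bool" where
  "harmonic P W D h \<longleftrightarrow>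
     (\<forall>w\<in>D. martingale (completion (P w)) (augmented_filtration (P w) W)
        (\<lambda>t \<omega>. h (W (real_of_ereal (min (ereal t) (exit_time W D \<omega>))) \<omega>)))"

definition E_box :: "real \<Rightarrow> (real^3) set" where
  "E_box \<epsilon> = {w. w $ 1 \<in> {2<..<4} \<and> w $ 2 \<in> {-\<epsilon><..<\<epsilon>} \<and> w $ 3 \<in> {-\<epsilon><..<\<epsilon>}}"

end

theory Submission
  imports Defs
begin

text \<open>
  An exit from the ball into the box \<open>E\<close> of width \<open>\<epsilon>\<close> is a jump of the first coordinate by more than 1, which has
  rate of order 1, at a time \<open>t\<close> when the other two coordinates lie in \<open>(- \<epsilon>, \<epsilon>)\<close>. Started at 0, these
  coordinates stay within \<open>\<epsilon>\<close> up to a time of order \<open>\<epsilon> powr \<alpha>\<close>, so the exit probability is at least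
  of order \<open>\<epsilon> powr \<alpha>\<close>. Started at \<open>(0, 1/2, 0)\<close>, the second coordinate must
  first move by about 1/2; splitting \<open>[0, t]\<close> into two halves shows that it is then within \<open>\<epsilon>\<close> of 0 with
  probability at most of order \<open>min 1 t * m\<close>, where \<open>m = min 1 (\<epsilon> * t powr (- 1 / \<alpha>))\<close> bounds the
  probability that a coordinate is in a given interval of length \<open>2 \<epsilon>\<close>. The exit probability is thus at most of order
  \<open>\<integral> min 1 t * m\<^sup>2 dt\<close>, and interpolating \<open>m\<^sup>2 \<le> m powr (\<alpha> + \<gamma>)\<close>
  makes it \<open>O(\<epsilon> powr (\<alpha> + \<gamma>))\<close> for some \<open>\<gamma> > 0\<close>.

  Exits are observed on time grids of vanishing mesh. This is legitimate because almost no path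
  has its norm approach 1 without exceeding it: given all other
  increments, the increment of one coordinate has no atoms and only two of its values are exceptional.
\<close>

text \<open>The factor \<open>min 1 t\<close> is what separates the two starting points. The
  integral of \<open>m\<^sup>2\<close> alone is of order \<open>\<epsilon> powr \<alpha>\<close>,
  the same as the lower bound, with its mass at times of order
  \<open>\<epsilon> powr \<alpha>\<close>, where \<open>min 1 t\<close> is small. For large
  \<open>t\<close> the square decays like \<open>t powr (- 2 / \<alpha>)\<close>, which is
  integrable because \<alpha> < 2; so the upper bound needs survival only at the last grid time
  before the exit. This uses both small coordinates.

  The hypotheses shape the rest. The measures \<open>P w\<close> are tied to each other only through
  the laws of the coordinates, and there are no shift operators, so the Markov property is derived:
  the Levy triplet fixes the law of the increment path, the same from every point and every time,
  and past and future increments are independent. Exit events are handled in the completion and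
  compared, inside the ball, with events on countably many times. Finally, \<open>x / 0 = 0\<close>
  in HOL, so divergence of the ratio also needs positivity of the denominator.\<close>

section \<open>Path laws of Levy processes\<close>

text \<open>\<open>indep_increments\<close> speaks of nondecreasing sequences of times only, so a
  finite set of times has to be listed as one. The last inclusion bounds the final time of the list,
  which keeps a list of past times below the present.\<close>

lemma finite_times_chain:
  fixes J :: "real set"
  assumes "finite J" "J \<subseteq> {0..}"
  shows "\<exists>(s::nat\<Rightarrow>real) n. s 0 = 0 \<and> (\<forall>k<n. s k \<le> s (Suc k)) \<and> J \<subseteq> s ` {..n} \<and>
    s ` {..n} \<subseteq> insert 0 J"
  using assms
proof (induction rule: finite_linorder_max_induct)
  case empty
  show ?case by (intro exI[of _ "\<lambda>_. 0"] exI[of _ 0]) auto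
next
  case (insert b A)
  then obtain s :: "nat \<Rightarrow> real" and n where
    s: "s 0 = 0" "\<forall>k<n. s k \<le> s (Suc k)" "A \<subseteq> s ` {..n}" "s ` {..n} \<subseteq> insert 0 A"
    by auto
  have "s n \<le> b"
    using s(4) insert by (auto simp: less_imp_le dest!: subsetD[of _ _ "s n"])
  moreover have "(s(Suc n := b)) ` {..Suc n} = insert b (s ` {..n})"
    by (auto simp: atMost_Suc image_iff)
  ultimately show ?case using s
    by (intro exI[of _ "s(Suc n := b)"] exI[of _ "Suc n"]) (auto simp: less_Suc_eq)
qed

lemma chain_index:
  assumes "J \<subseteq> s ` {..n::nat}"
  shows "\<exists>k. \<forall>j\<in>J. k j \<le> n \<and> s (k j) = j"
  using assms by (intro bchoice) auto

lemma measurable_path: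
  assumes "\<And>s. s \<in> I \<Longrightarrow> Y s \<in> borel_measurable M"
  shows "(\<lambda>\<omega>. \<lambda>s\<in>I. Y s \<omega>) \<in> measurable M (PiM I (\<lambda>_. borel))"
  using assms by (rule measurable_restrict)

lemma (in prob_space) indep_var_prob_Int:
  assumes "indep_var S X T Y" "A \<in> sets S" "B \<in> sets T"
  shows "prob ((X -` A \<inter> space M) \<inter> (Y -` B \<inter> space M)) =
    prob (X -` A \<inter> space M) * prob (Y -` B \<inter> space M)"
proof -
  have "(X -` A \<inter> space M) \<inter> (Y -` B \<inter> space M) = (\<lambda>x. (X x, Y x)) -` (A \<times> B) \<inter> space M" by auto
  with indep_varD[OF assms] show ?thesis by simp
qed

text \<open>Cylinder sets form an intersection-stable generator of the product sigma-algebra, so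
  independence of whole paths reduces to finitely many times.\<close>

lemma (in prob_space) indep_var_pathI:
  fixes X Y :: "real \<Rightarrow> 'a \<Rightarrow> real"
  assumes X: "\<And>s. s \<in> I \<Longrightarrow> X s \<in> borel_measurable M"
    and Y: "\<And>s. s \<in> I' \<Longrightarrow> Y s \<in> borel_measurable M"
    and eq: "\<And>J J' A B. finite J \<Longrightarrow> J \<subseteq> I \<Longrightarrow> finite J' \<Longrightarrow> J' \<subseteq> I' \<Longrightarrow>
      (\<And>j. A j \<in> sets borel) \<Longrightarrow> (\<And>j. B j \<in> sets borel) \<Longrightarrow>
      \<P>(\<omega> in M. (\<forall>j\<in>J. X j \<omega> \<in> A j) \<and> (\<forall>j\<in>J'. Y j \<omega> \<in> B j)) =
      \<P>(\<omega> in M. \<forall>j\<in>J. X j \<omega> \<in> A j) * \<P>(\<omega> in M. \<forall>j\<in>J'. Y j \<omega> \<in> B j)"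
  shows "indep_var (PiM I (\<lambda>_. borel)) (\<lambda>\<omega>. \<lambda>s\<in>I. X s \<omega>) (PiM I' (\<lambda>_. borel)) (\<lambda>\<omega>. \<lambda>s\<in>I'. Y s \<omega>)"
proof -
  have gen: "\<exists>J A. finite J \<and> J \<subseteq> K \<and> (\<forall>j. A j \<in> sets borel) \<and>
        (\<lambda>\<omega>. \<lambda>s\<in>K. Z s \<omega>) -` a \<inter> space M = {\<omega>\<in>space M. \<forall>j\<in>J. Z j \<omega> \<in> A j}"
    if "a \<in> prod_algebra K (\<lambda>_. borel)" for K :: "real set" and Z :: "real \<Rightarrow> 'a \<Rightarrow> real" and a
  proof -
    from that obtain J E where J: "a = prod_emb K (\<lambda>_. borel) J (Pi\<^sub>E J E)" "finite J" "J \<subseteq> K"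
      "\<And>i. i \<in> J \<Longrightarrow> E i \<in> sets (borel::real measure)"
      by (rule prod_algebraE) auto
    show ?thesis
      using J by (intro exI[of _ J] exI[of _ "\<lambda>j. if j \<in> J then E j else {}"])
        (auto simp: prod_emb_def PiE_iff subset_eq)
  qed
  have sig: "sigma_sets (space M) {(\<lambda>\<omega>. \<lambda>s\<in>K. Z s \<omega>) -` A \<inter> space M | A. A \<in> sets (PiM K (\<lambda>_. borel))} =
        sigma_sets (space M) {(\<lambda>\<omega>. \<lambda>s\<in>K. Z s \<omega>) -` A \<inter> space M | A. A \<in> prod_algebra K (\<lambda>_. borel)}"
    for K :: "real set" and Z :: "real \<Rightarrow> 'a \<Rightarrow> real"
    unfolding sets_PiM
  proof (subst sigma_sets_vimage_commute[of _ "space M" "\<Pi>\<^sub>E i\<in>K. space borel"])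
    show "(\<lambda>\<omega>. \<lambda>s\<in>K. Z s \<omega>) \<in> space M \<rightarrow> (\<Pi>\<^sub>E i\<in>K. space borel)" by auto
  qed (rule sigma_sets_sigma_sets_eq, blast)
  have stab: "Int_stable {(\<lambda>\<omega>. \<lambda>s\<in>K. Z s \<omega>) -` A \<inter> space M | A. A \<in> prod_algebra K (\<lambda>_. borel)}"
    for K :: "real set" and Z :: "real \<Rightarrow> 'a \<Rightarrow> real"
  proof (rule Int_stableI, clarsimp)
    fix a b assume "a \<in> prod_algebra K (\<lambda>_. borel :: real measure)" "b \<in> prod_algebra K (\<lambda>_. borel :: real measure)"
    then have "a \<inter> b \<in> prod_algebra K (\<lambda>_. borel)"
      by (rule Int_stableD[OF Int_stable_prod_algebra])
    then show "\<exists>A. (\<lambda>\<omega>. \<lambda>s\<in>K. Z s \<omega>) -` a \<inter> space M \<inter> ((\<lambda>\<omega>. \<lambda>s\<in>K. Z s \<omega>) -` b \<inter> space M) =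
        (\<lambda>\<omega>. \<lambda>s\<in>K. Z s \<omega>) -` A \<inter> space M \<and> A \<in> prod_algebra K (\<lambda>_. borel)"
      by (intro exI[of _ "a \<inter> b"]) auto
  qed
  have ev: "(\<lambda>\<omega>. \<lambda>s\<in>K. Z s \<omega>) -` a \<inter> space M \<in> events"
    if "a \<in> prod_algebra K (\<lambda>_. borel)" "\<And>s. s \<in> K \<Longrightarrow> Z s \<in> borel_measurable M"
    for K :: "real set" and Z :: "real \<Rightarrow> 'a \<Rightarrow> real" and a
    using that by (intro measurable_sets[OF measurable_path]) (auto simp: sets_PiM)
  show ?thesis
    unfolding indep_var_eq sig
  proof (intro conjI measurable_path X Y)
    show "indep_set
      (sigma_sets (space M) {(\<lambda>\<omega>. \<lambda>s\<in>I. X s \<omega>) -` A \<inter> space M |A. A \<in> prod_algebra I (\<lambda>_. borel)})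
      (sigma_sets (space M) {(\<lambda>\<omega>. \<lambda>s\<in>I'. Y s \<omega>) -` A \<inter> space M |A. A \<in> prod_algebra I' (\<lambda>_. borel)})"
    proof (intro indep_set_sigma_sets stab, unfold indep_sets2_eq, intro conjI ballI)
      fix a b
      assume "a \<in> {(\<lambda>\<omega>. \<lambda>s\<in>I. X s \<omega>) -` A \<inter> space M |A. A \<in> prod_algebra I (\<lambda>_. borel)}"
        "b \<in> {(\<lambda>\<omega>. \<lambda>s\<in>I'. Y s \<omega>) -` A \<inter> space M |A. A \<in> prod_algebra I' (\<lambda>_. borel)}"
      then obtain a' b' where ab: "a = (\<lambda>\<omega>. \<lambda>s\<in>I. X s \<omega>) -` a' \<inter> space M" "a' \<in> prod_algebra I (\<lambda>_. borel)"
        "b = (\<lambda>\<omega>. \<lambda>s\<in>I'. Y s \<omega>) -` b' \<inter> space M" "b' \<in> prod_algebra I' (\<lambda>_. borel)"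
        by (elim CollectE exE conjE)
      from gen[OF ab(2), of X, folded ab(1)] obtain J A where A: "finite J" "J \<subseteq> I"
        "\<forall>j. A j \<in> sets borel" "a = {\<omega>\<in>space M. \<forall>j\<in>J. X j \<omega> \<in> A j}"
        by (elim exE conjE) (rule that)
      from gen[OF ab(4), of Y, folded ab(3)] obtain J' B where B: "finite J'" "J' \<subseteq> I'"
        "\<forall>j. B j \<in> sets borel" "b = {\<omega>\<in>space M. \<forall>j\<in>J'. Y j \<omega> \<in> B j}"
        by (elim exE conjE) (rule that)
      have "a \<inter> b = {\<omega>\<in>space M. (\<forall>j\<in>J. X j \<omega> \<in> A j) \<and> (\<forall>j\<in>J'. Y j \<omega> \<in> B j)}"
        unfolding A(4) B(4) by blast
      moreover have "\<P>(\<omega> in M. (\<forall>j\<in>J. X j \<omega> \<in> A j) \<and> (\<forall>j\<in>J'. Y j \<omega> \<in> B j)) =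
          \<P>(\<omega> in M. \<forall>j\<in>J. X j \<omega> \<in> A j) * \<P>(\<omega> in M. \<forall>j\<in>J'. Y j \<omega> \<in> B j)"
        by (rule eq[OF A(1,2) B(1,2)]) (use A(3) B(3) in auto)
      ultimately show "prob (a \<inter> b) = prob a * prob b" unfolding A(4) B(4) by (simp only:)
    next
      show "{(\<lambda>\<omega>. \<lambda>s\<in>I. X s \<omega>) -` A \<inter> space M |A. A \<in> prod_algebra I (\<lambda>_. borel)} \<subseteq> events"
        using ev[of _ I X] X by blast
      show "{(\<lambda>\<omega>. \<lambda>s\<in>I'. Y s \<omega>) -` A \<inter> space M |A. A \<in> prod_algebra I' (\<lambda>_. borel)} \<subseteq> events"
        using ev[of _ I' Y] Y by blast
    qed
  qed
qed

context levy_process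
begin

lemma increment_measurable [measurable]:
  "0 \<le> s \<Longrightarrow> 0 \<le> t \<Longrightarrow> (\<lambda>\<omega>. X s \<omega> - X t \<omega>) \<in> borel_measurable M"
  by (intro borel_measurable_diff measurable_X)

lemma chain_nonneg:
  fixes s :: "nat \<Rightarrow> real"
  assumes "s 0 = 0" "\<forall>k<n. s k \<le> s (Suc k)" "k \<le> n"
  shows "0 \<le> s k"
  using assms(3) by (induction k) (use assms in \<open>auto intro: order_trans\<close>)

text \<open>Since \<open>t\<close> is absent on the right, the joint law of increments is the same
  from any starting time and depends only on the marginals of \<open>X\<close>. The product
  characterisation of independence is applied to a nonempty index set, hence
  \<open>0 < n\<close>.\<close>

lemma fdd_eq_PiM:
  assumes t: "0 \<le> t" and s: "s 0 = 0" "\<forall>k<n. s k \<le> s (Suc k)" and "0 < n"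
  shows "distr M (PiM {..<n} (\<lambda>_. borel)) (\<lambda>\<omega>. \<lambda>k\<in>{..<n}. X (t + s (Suc k)) \<omega> - X (t + s k) \<omega>) =
    PiM {..<n} (\<lambda>k. distr M borel (X (s (Suc k) - s k)))"
proof -
  have nn: "0 \<le> s k" if "k \<le> n" for k using chain_nonneg[OF s that] .
  have "indep_vars (\<lambda>_. borel) (\<lambda>k \<omega>. X (t + s (Suc k)) \<omega> - X (t + s k) \<omega>) {..<n}"
    using indep_increments[of "\<lambda>k. t + s k" n] t s by auto
  then have "distr M (PiM {..<n} (\<lambda>_. borel)) (\<lambda>\<omega>. \<lambda>k\<in>{..<n}. X (t + s (Suc k)) \<omega> - X (t + s k) \<omega>) =
    PiM {..<n} (\<lambda>k. distr M borel (\<lambda>\<omega>. X (t + s (Suc k)) \<omega> - X (t + s k) \<omega>))"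
    by (subst (asm) indep_vars_iff_distr_eq_PiM') (use nn t \<open>0<n\<close> in \<open>auto intro!: increment_measurable\<close>)
  also have "\<dots> = PiM {..<n} (\<lambda>k. distr M borel (X (s (Suc k) - s k)))"
  proof (intro PiM_cong refl)
    fix k assume k: "k \<in> {..<n}"
    show "distr M borel (\<lambda>\<omega>. X (t + s (Suc k)) \<omega> - X (t + s k) \<omega>) = distr M borel (X (s (Suc k) - s k))"
      using stationary_increments[of "t + s k" "s (Suc k) - s k"] k nn[of k] s t
      by (simp add: algebra_simps)
  qed
  finally show ?thesis .
qed

text \<open>Both paths are functions of disjoint blocks of increments along a common chain of times.
  The past is recorded relative to \<open>X 0\<close>, which vanishes only almost
  everywhere.\<close>

lemma past_future_indep:
  assumes t: "0 \<le> t"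
  shows "indep_var (PiM {0..t} (\<lambda>_. borel)) (\<lambda>\<omega>. \<lambda>s\<in>{0..t}. X s \<omega> - X 0 \<omega>)
                   (PiM {0..} (\<lambda>_. borel)) (\<lambda>\<omega>. \<lambda>s\<in>{0..}. X (t + s) \<omega> - X t \<omega>)"
proof (rule indep_var_pathI)
  fix J J' :: "real set" and A B :: "real \<Rightarrow> real set"
  assume J: "finite J" "J \<subseteq> {0..t}" "finite J'" "J' \<subseteq> {0..}" and
    AB[measurable]: "\<And>j. A j \<in> sets borel" "\<And>j. B j \<in> sets borel"
  have J0: "J \<subseteq> {0..}" using J by auto
  obtain s1 :: "nat \<Rightarrow> real" and n1 where s1: "s1 0 = 0" "\<forall>k<n1. s1 k \<le> s1 (Suc k)" "J \<subseteq> s1 ` {..n1}"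
    "s1 ` {..n1} \<subseteq> insert 0 J"
    using finite_times_chain[OF J(1) J0] by blast
  obtain s2 :: "nat \<Rightarrow> real" and n2 where s2: "s2 0 = 0" "\<forall>k<n2. s2 k \<le> s2 (Suc k)" "J' \<subseteq> s2 ` {..n2}"
    using finite_times_chain[OF J(3,4)] by blast
  \<comment> \<open>One chain for both blocks: the past times, then \<open>t\<close> itself at index
    \<open>Suc n1\<close>, then the future times. The increment with index \<open>n1\<close> bridges
    the gap from the last past time to \<open>t\<close>; it is put into the past block, where no
    partial sum reaches it.\<close>
  define s where "s k = (if k \<le> n1 then s1 k else t + s2 (k - Suc n1))" for k
  define D where "D = (\<lambda>k \<omega>. X (s (Suc k)) \<omega> - X (s k) \<omega>)"
  let ?N = "Suc n1 + n2"
  have "s1 n1 \<le> t" using s1(4) J t by (auto dest!: subsetD[of _ _ "s1 n1"])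
  then have mono: "\<forall>k<?N. s k \<le> s (Suc k)"
  proof (intro allI impI)
    fix k assume k: "k < ?N"
    consider "k < n1" | "k = n1" | "n1 < k" by linarith
    then show "s k \<le> s (Suc k)"
    proof cases
      case 3
      then have "Suc k - Suc n1 = Suc (k - Suc n1)" "k - Suc n1 < n2" using k by auto
      with 3 s2(2) show ?thesis by (simp add: s_def)
    qed (use \<open>s1 n1 \<le> t\<close> s1(2) s2(1) in \<open>auto simp: s_def\<close>)
  qed
  have "indep_vars (\<lambda>_. borel) D {..<?N}"
    unfolding D_def by (rule indep_increments[OF _ mono]) (simp add: s_def s1)
  then have ind: "indep_var (PiM {..<Suc n1} (\<lambda>_. borel)) (\<lambda>\<omega>. \<lambda>i\<in>{..<Suc n1}. D i \<omega>)
    (PiM {Suc n1..<?N} (\<lambda>_. borel)) (\<lambda>\<omega>. \<lambda>i\<in>{Suc n1..<?N}. D i \<omega>)"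
    by (rule indep_var_restrict) auto
  from chain_index[OF s1(3)] obtain k1 where "\<forall>j\<in>J. k1 j \<le> n1 \<and> s1 (k1 j) = j" ..
  note k1 = this[rule_format]
  from chain_index[OF s2(3)] obtain k2 where "\<forall>j\<in>J'. k2 j \<le> n2 \<and> s2 (k2 j) = j" ..
  note k2 = this[rule_format]
  have sum1: "X j \<omega> - X 0 \<omega> = (\<Sum>i<k1 j. D i \<omega>)" if "j \<in> J" for j \<omega>
    using sum_lessThan_telescope[of "\<lambda>i. X (s i) \<omega>" "k1 j"] k1[OF that] s1(1)
    by (simp add: D_def s_def)
  have D2: "D (Suc n1 + i) \<omega> = X (t + s2 (Suc i)) \<omega> - X (t + s2 i) \<omega>" for i \<omega>
    by (simp add: D_def s_def)
  have sum2: "X (t + j) \<omega> - X t \<omega> = (\<Sum>i<k2 j. D (Suc n1 + i) \<omega>)" if "j \<in> J'" for j \<omega>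
    unfolding D2 using sum_lessThan_telescope[of "\<lambda>i. X (t + s2 i) \<omega>" "k2 j"] k2[OF that] s2(1) by simp
  let ?C1 = "{f\<in>space (PiM {..<Suc n1} (\<lambda>_. borel)). \<forall>j\<in>J. (\<Sum>i<k1 j. f i) \<in> A j}"
  let ?C2 = "{f\<in>space (PiM {Suc n1..<?N} (\<lambda>_. borel)). \<forall>j\<in>J'. (\<Sum>i<k2 j. f (Suc n1 + i)) \<in> B j}"
  have comp1: "(\<lambda>f. \<Sum>i<k1 j. f i) \<in> borel_measurable (PiM {..<Suc n1} (\<lambda>_. borel::real measure))" if "j \<in> J" for j
    using k1[OF that] by (intro borel_measurable_sum measurable_component_singleton) auto
  have comp2: "(\<lambda>f. \<Sum>i<k2 j. f (Suc n1 + i)) \<in> borel_measurable (PiM {Suc n1..<?N} (\<lambda>_. borel::real measure))" if "j \<in> J'" for j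
    using k2[OF that] by (intro borel_measurable_sum measurable_component_singleton) auto
  have C1: "?C1 \<in> sets (PiM {..<Suc n1} (\<lambda>_. borel))"
    using J(1) by (intro sets.sets_Collect_finite_All) (auto intro!: measurable_sets_Collect[OF comp1] AB)
  have C2: "?C2 \<in> sets (PiM {Suc n1..<?N} (\<lambda>_. borel))"
    using measurable_sets[OF comp2 AB(2)]
    by (intro sets.sets_Collect_finite_All[OF _ J(3)]) (simp add: vimage_def Int_def conj_commute)
  have e1: "((\<lambda>\<omega>. \<lambda>i\<in>{..<Suc n1}. D i \<omega>) -` ?C1 \<inter> space M) = {\<omega>\<in>space M. \<forall>j\<in>J. X j \<omega> - X 0 \<omega> \<in> A j}"
  proof -
    have "(\<Sum>i<k1 j. (\<lambda>i\<in>{..<Suc n1}. D i \<omega>) i) = (\<Sum>i<k1 j. D i \<omega>)" if "j \<in> J" for j \<omega>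
      using k1[OF that] by (intro sum.cong) auto
    then show ?thesis by (auto simp: space_PiM sum1)
  qed
  have e2: "((\<lambda>\<omega>. \<lambda>i\<in>{Suc n1..<?N}. D i \<omega>) -` ?C2 \<inter> space M) = {\<omega>\<in>space M. \<forall>j\<in>J'. X (t + j) \<omega> - X t \<omega> \<in> B j}"
  proof -
    have "(\<Sum>i<k2 j. (\<lambda>i\<in>{Suc n1..<?N}. D i \<omega>) (Suc n1 + i)) = (\<Sum>i<k2 j. D (Suc n1 + i) \<omega>)" if "j \<in> J'" for j \<omega>
      using k2[OF that] by (intro sum.cong) auto
    then show ?thesis by (auto simp: space_PiM sum2)
  qed
  have "{\<omega>\<in>space M. (\<forall>j\<in>J. X j \<omega> - X 0 \<omega> \<in> A j) \<and> (\<forall>j\<in>J'. X (t + j) \<omega> - X t \<omega> \<in> B j)} =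
    {\<omega>\<in>space M. \<forall>j\<in>J. X j \<omega> - X 0 \<omega> \<in> A j} \<inter> {\<omega>\<in>space M. \<forall>j\<in>J'. X (t + j) \<omega> - X t \<omega> \<in> B j}"
    by blast
  with indep_var_prob_Int[OF ind C1 C2, unfolded e1 e2]
  show "\<P>(\<omega> in M. (\<forall>j\<in>J. X j \<omega> - X 0 \<omega> \<in> A j) \<and> (\<forall>j\<in>J'. X (t + j) \<omega> - X t \<omega> \<in> B j)) =
      \<P>(\<omega> in M. \<forall>j\<in>J. X j \<omega> - X 0 \<omega> \<in> A j) * \<P>(\<omega> in M. \<forall>j\<in>J'. X (t + j) \<omega> - X t \<omega> \<in> B j)"
    by (simp only:)
qed (use t in \<open>auto intro!: increment_measurable\<close>)

end

text \<open>Finite-dimensional laws of increments are products of marginals, and they determine the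
  path law. Allowing two processes and two starting times gives uniqueness in law and stationarity
  of the whole future in one statement.\<close>

lemma levy_path_law_unique:
  assumes "levy_process M X" "levy_process N Y"
    and marg: "\<And>u. 0 \<le> u \<Longrightarrow> distr M borel (X u) = distr N borel (Y u)"
    and t: "0 \<le> t" "0 \<le> t'"
  shows "distr M (PiM {0..} (\<lambda>_. borel)) (\<lambda>\<omega>. \<lambda>s\<in>{0..}. X (t + s) \<omega> - X t \<omega>) =
    distr N (PiM {0..} (\<lambda>_. borel)) (\<lambda>\<omega>. \<lambda>s\<in>{0..}. Y (t' + s) \<omega> - Y t' \<omega>)"
proof -
  interpret X: levy_process M X by fact
  interpret Y: levy_process N Y by fact
  let ?px = "\<lambda>\<omega>. \<lambda>s\<in>{0..}. X (t + s) \<omega> - X t \<omega>" and ?py = "\<lambda>\<omega>. \<lambda>s\<in>{0..}. Y (t' + s) \<omega> - Y t' \<omega>"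
  have px[measurable]: "?px \<in> measurable M (PiM {0..} (\<lambda>_. borel))"
    using t by (intro measurable_path X.increment_measurable) auto
  have py[measurable]: "?py \<in> measurable N (PiM {0..} (\<lambda>_. borel))"
    using t by (intro measurable_path Y.increment_measurable) auto
  show ?thesis
  proof (rule measure_eqI_PiM_infinite)
    fix A :: "real \<Rightarrow> real set" and J :: "real set"
    assume J: "finite J" "J \<subseteq> {0..}" and A: "\<And>i. i \<in> J \<Longrightarrow> A i \<in> sets borel"
    obtain s n where s: "s 0 = 0" "\<forall>k<n. s k \<le> s (Suc k)" "J \<subseteq> s ` {..n}"
      using finite_times_chain[OF J] by blast
    \<comment> \<open>Repeating the last time adds an increment of length 0 and makes the number of
      increments positive, as \<open>fdd_eq_PiM\<close> requires, even when the chain consists of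
      the time 0 alone.\<close>
    define s' where "s' = s(Suc n := s n)"
    have s': "s' 0 = 0" "\<forall>k<Suc n. s' k \<le> s' (Suc k)" "J \<subseteq> s' ` {..Suc n}"
      using s by (auto simp: s'_def less_Suc_eq atMost_Suc)
    from chain_index[OF s'(3)] obtain k where "\<forall>j\<in>J. k j \<le> Suc n \<and> s' (k j) = j" ..
    note k = this[rule_format]
    have s'_nn: "0 \<le> s' k" if "k \<le> Suc n" for k using X.chain_nonneg[OF s'(1,2) that] .
    let ?C = "{f\<in>space (PiM {..<Suc n} (\<lambda>_. borel)). \<forall>j\<in>J. (\<Sum>i<k j. f i) \<in> A j}"
    have comp: "(\<lambda>f. \<Sum>i<k j. f i) \<in> borel_measurable (PiM {..<Suc n} (\<lambda>_. borel::real measure))" if "j \<in> J" for j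
      using k[OF that] by (intro borel_measurable_sum measurable_component_singleton) auto
    have C: "?C \<in> sets (PiM {..<Suc n} (\<lambda>_. borel))"
      using J(1) by (intro sets.sets_Collect_finite_All) (auto intro!: measurable_sets_Collect[OF comp] A)
    have emb: "prod_emb {0..} (\<lambda>_. borel) J (Pi\<^sub>E J A) \<in> sets (PiM {0..} (\<lambda>_. borel))"
      using J A by (intro sets_PiM_I) auto
    have key: "emeasure (distr M' (PiM {0..} (\<lambda>_. borel)) (\<lambda>\<omega>. \<lambda>s\<in>{0..}. Z (r + s) \<omega> - Z r \<omega>))
        (prod_emb {0..} (\<lambda>_. borel) J (Pi\<^sub>E J A)) =
        emeasure (PiM {..<Suc n} (\<lambda>k. distr M' borel (Z (s' (Suc k) - s' k)))) ?C"
      if "levy_process M' Z" and r: "0 \<le> r" for M' and Z :: "real \<Rightarrow> _ \<Rightarrow> real" and r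
    proof -
      interpret Z: levy_process M' Z by fact
      have m1: "(\<lambda>\<omega>. \<lambda>s\<in>{0..}. Z (r + s) \<omega> - Z r \<omega>) \<in> measurable M' (PiM {0..} (\<lambda>_. borel))"
        using r by (intro measurable_path Z.increment_measurable) auto
      have m2: "(\<lambda>\<omega>. \<lambda>k\<in>{..<Suc n}. Z (r + s' (Suc k)) \<omega> - Z (r + s' k) \<omega>) \<in> measurable M' (PiM {..<Suc n} (\<lambda>_. borel))"
        using r s'_nn by (intro measurable_restrict Z.increment_measurable) auto
      have sum: "(\<Sum>i<k j. Z (r + s' (Suc i)) \<omega> - Z (r + s' i) \<omega>) = Z (r + j) \<omega> - Z r \<omega>" if "j \<in> J" for j \<omega>
        using sum_lessThan_telescope[of "\<lambda>i. Z (r + s' i) \<omega>" "k j"] k[OF that] s'(1) by simp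
      have sum': "(\<Sum>i<k j. (\<lambda>k\<in>{..<Suc n}. Z (r + s' (Suc k)) \<omega> - Z (r + s' k) \<omega>) i) = Z (r + j) \<omega> - Z r \<omega>" if "j \<in> J" for j \<omega>
        unfolding sum[OF that, symmetric] using k[OF that] by (intro sum.cong) auto
      have "(\<lambda>\<omega>. \<lambda>s\<in>{0..}. Z (r + s) \<omega> - Z r \<omega>) -` prod_emb {0..} (\<lambda>_. borel) J (Pi\<^sub>E J A) \<inter> space M' =
        (\<lambda>\<omega>. \<lambda>k\<in>{..<Suc n}. Z (r + s' (Suc k)) \<omega> - Z (r + s' k) \<omega>) -` ?C \<inter> space M'"
      proof -
        have "(\<lambda>\<omega>. \<lambda>k\<in>{..<Suc n}. Z (r + s' (Suc k)) \<omega> - Z (r + s' k) \<omega>) -` ?C \<inter> space M' =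
           {\<omega>\<in>space M'. \<forall>j\<in>J. Z (r + j) \<omega> - Z r \<omega> \<in> A j}"
          using sum' by (auto simp: space_PiM)
        moreover have "(\<lambda>\<omega>. \<lambda>s\<in>{0..}. Z (r + s) \<omega> - Z r \<omega>) -` prod_emb {0..} (\<lambda>_. borel) J (Pi\<^sub>E J A) \<inter> space M' =
           {\<omega>\<in>space M'. \<forall>j\<in>J. Z (r + j) \<omega> - Z r \<omega> \<in> A j}"
          using J by (auto simp: prod_emb_def PiE_iff subset_eq)
        ultimately show ?thesis by simp
      qed
      then show ?thesis
        unfolding Z.fdd_eq_PiM[OF r s'(1,2) zero_less_Suc, symmetric]
        by (simp add: emeasure_distr[OF m1 emb] emeasure_distr[OF m2 C])
    qed
    have "PiM {..<Suc n} (\<lambda>k. distr M borel (X (s' (Suc k) - s' k))) =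
      PiM {..<Suc n} (\<lambda>k. distr N borel (Y (s' (Suc k) - s' k)))"
      using s'(2) by (intro PiM_cong refl marg) auto
    then show "emeasure (distr M (PiM {0..} (\<lambda>_. borel)) ?px) (prod_emb {0..} (\<lambda>_. borel) J (Pi\<^sub>E J A)) =
      emeasure (distr N (PiM {0..} (\<lambda>_. borel)) ?py) (prod_emb {0..} (\<lambda>_. borel) J (Pi\<^sub>E J A))"
      by (simp only: key[OF assms(1) t(1)] key[OF assms(2) t(2)])
  next
    show "finite_measure (distr M (PiM {0..} (\<lambda>_. borel)) ?px)"
      using X.prob_space_distr[OF px] by (simp add: prob_space.finite_measure)
  qed (simp_all only: sets_distr)
qed

section \<open>Symmetric stable laws\<close>

definition levy_integrand :: "real \<Rightarrow> real \<Rightarrow> complex" where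
  "levy_integrand u x = iexp (u * x) - 1 - \<i> * complex_of_real (u * x * indicator {-1..1} x)"

lemma levy_integrand_measurable [measurable]: "levy_integrand u \<in> borel_measurable borel"
  unfolding levy_integrand_def[abs_def] by measurable

lemma cmod_levy_integrand_le: "cmod (levy_integrand u x) \<le> (2 + u\<^sup>2) * min 1 (x\<^sup>2)"
proof (cases "x \<in> {-1..1}")
  case True
  have "cmod (levy_integrand u x) \<le> (u * x)\<^sup>2 / 2"
    using iexp_approx1[of "u * x" 1] True by (simp add: levy_integrand_def algebra_simps power2_eq_square)
  also have "\<dots> \<le> (2 + u\<^sup>2) * x\<^sup>2" by (simp add: power_mult_distrib algebra_simps)
  also have "x\<^sup>2 = min 1 (x\<^sup>2)" using True abs_square_le_1[of x] by (auto simp: abs_le_iff)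
  finally show ?thesis .
next
  case False
  then have "1 \<le> x\<^sup>2" using one_le_power[of "\<bar>x\<bar>" 2] by (auto simp: abs_le_iff)
  have "cmod (levy_integrand u x) \<le> cmod (iexp (u * x)) + cmod 1"
    unfolding levy_integrand_def using False by (auto intro: order_trans[OF norm_triangle_ineq4])
  also have "\<dots> \<le> 2 + u\<^sup>2" by simp
  finally show ?thesis using \<open>1 \<le> x\<^sup>2\<close> by (simp add: min_def)
qed

lemma levy_integrand_add_uminus:
  "levy_integrand u x + levy_integrand u (-x) = complex_of_real (- 2 * (1 - cos (u * x)))"
  by (auto simp: levy_integrand_def complex_eq_iff Re_exp Im_exp indicator_def)

text \<open>Multiplying by \<open>1 - cos x\<close> is minus half a second difference in the
  frequency \<open>u\<close>. The weights 1, -1/2, -1/2 annihilate functions affine in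
  \<open>u\<close>, so the constant and the compensator cancel. Hence the transform of the tilted
  Levy measure is expressed by the exponent alone.\<close>

lemma levy_integrand_combine:
  "iexp (u * x) * complex_of_real (1 - cos x) =
    levy_integrand u x - levy_integrand (u + 1) x / 2 - levy_integrand (u - 1) x / 2"
  by (auto simp: levy_integrand_def complex_eq_iff Re_exp Im_exp indicator_def algebra_simps
      cos_add sin_add cos_diff sin_diff field_simps)

text \<open>That the stable measure is a Levy measure is part of the triplet of a given process and
  is taken from there; it supplies the integrability of \<open>min 1 (x\<^sup>2)\<close>.\<close>

locale stable_levy =
  fixes \<alpha> \<kappa> :: real
  assumes \<alpha>: "0 < \<alpha>" "\<alpha> < 2" and \<kappa>: "0 < \<kappa>"
    and levy_measure_stable: "levy_measure (stable_levy_measure \<alpha> \<kappa>)"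
begin

abbreviation \<nu> :: "real measure" where "\<nu> \<equiv> stable_levy_measure \<alpha> \<kappa>"

text \<open>Minus the exponent at frequency 1. Its positivity is all that matters; it is never
  evaluated.\<close>

definition stable_const :: real where "stable_const = (LINT x|\<nu>. 1 - cos x)"

lemma sets_\<nu> [simp, measurable_cong]: "sets \<nu> = sets borel"
  by (simp add: stable_levy_measure_def)

lemma integrable_min_\<nu>: "integrable \<nu> (\<lambda>x. min 1 (x\<^sup>2))"
  using levy_measure_stable by (intro integrableI_nonneg) (auto simp: levy_measure_def)

lemma integrable_levy_integrand: "integrable \<nu> (levy_integrand u)"
proof (rule Bochner_Integration.integrable_bound)
  show "integrable \<nu> (\<lambda>x. (2 + u\<^sup>2) * min 1 (x\<^sup>2))" by (intro integrable_mult_right integrable_min_\<nu>)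
  show "AE x in \<nu>. norm (levy_integrand u x) \<le> norm ((2 + u\<^sup>2) * min 1 (x\<^sup>2))"
    using cmod_levy_integrand_le[of u] by (auto intro!: AE_I2 order_trans[OF _ abs_ge_self])
qed measurable

lemma Re_levy_integrand: "Re (levy_integrand u x) = - (1 - cos (u * x))"
  by (simp add: levy_integrand_def Re_exp)

lemma integrable_one_minus_cos: "integrable \<nu> (\<lambda>x. 1 - cos (u * x))"
  using integrable_minus[OF integrable_Re[OF integrable_levy_integrand[of u]]]
  by (simp add: Re_levy_integrand)

lemma integral_\<nu>:
  fixes g :: "real \<Rightarrow> 'b::{banach, second_countable_topology}"
  assumes "g \<in> borel_measurable borel"
  shows "integral\<^sup>L \<nu> g = (LINT x|lborel. (\<kappa> * \<bar>x\<bar> powr (- 1 - \<alpha>)) *\<^sub>R g x)"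
  using assms \<kappa> unfolding stable_levy_measure_def by (intro integral_density) auto

lemma integral_\<nu>_uminus:
  fixes g :: "real \<Rightarrow> 'b::{banach, second_countable_topology}"
  assumes "g \<in> borel_measurable borel"
  shows "(LINT x|\<nu>. g (- x)) = integral\<^sup>L \<nu> g"
proof -
  have "integral\<^sup>L \<nu> g = (LINT x|lborel. (\<kappa> * \<bar>x\<bar> powr (- 1 - \<alpha>)) *\<^sub>R g x)" using assms by (rule integral_\<nu>)
  also have "\<dots> = (LINT x|lborel. (\<kappa> * \<bar>x\<bar> powr (- 1 - \<alpha>)) *\<^sub>R g (- x))"
    by (subst lborel_integral_real_affine[where c="-1" and t=0]) auto
  also have "\<dots> = (LINT x|\<nu>. g (- x))" using assms by (intro integral_\<nu>[symmetric]) auto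
  finally show ?thesis by simp
qed

text \<open>Substituting \<open>x / u\<close> for \<open>x\<close>: the density contributes
  \<open>\<bar>u\<bar> powr (1 + \<alpha>)\<close> and the Jacobian
  \<open>1 / \<bar>u\<bar>\<close>.\<close>

lemma integral_one_minus_cos: "(LINT x|\<nu>. 1 - cos (u * x)) = stable_const * \<bar>u\<bar> powr \<alpha>"
proof (cases "u = 0")
  case False
  have "(LINT x|\<nu>. 1 - cos (u * x)) = (LINT x|lborel. (\<kappa> * \<bar>x\<bar> powr (- 1 - \<alpha>)) * (1 - cos (u * x)))"
    by (subst integral_\<nu>) auto
  also have "\<dots> = \<bar>1/u\<bar> * (LINT x|lborel. (\<kappa> * \<bar>x / u\<bar> powr (- 1 - \<alpha>)) * (1 - cos x))"
    using False by (subst lborel_integral_real_affine[where c="1/u" and t=0]) auto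
  also have "(\<lambda>x. (\<kappa> * \<bar>x / u\<bar> powr (- 1 - \<alpha>)) * (1 - cos x)) =
     (\<lambda>x. \<bar>u\<bar> powr (1 + \<alpha>) * ((\<kappa> * \<bar>x\<bar> powr (- 1 - \<alpha>)) * (1 - cos x)))"
  proof
    fix x
    have "\<bar>x / u\<bar> powr (- 1 - \<alpha>) = \<bar>u\<bar> powr (1 + \<alpha>) * \<bar>x\<bar> powr (- 1 - \<alpha>)"
      using powr_minus_divide[of "\<bar>u\<bar>" "1 + \<alpha>"] False by (simp add: powr_divide powr_minus field_simps)
    then show "(\<kappa> * \<bar>x / u\<bar> powr (- 1 - \<alpha>)) * (1 - cos x) = \<bar>u\<bar> powr (1 + \<alpha>) * ((\<kappa> * \<bar>x\<bar> powr (- 1 - \<alpha>)) * (1 - cos x))"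
      by simp
  qed
  also have "\<bar>1/u\<bar> * (LINT x|lborel. \<bar>u\<bar> powr (1 + \<alpha>) * ((\<kappa> * \<bar>x\<bar> powr (- 1 - \<alpha>)) * (1 - cos x))) =
     \<bar>u\<bar> powr \<alpha> * (LINT x|lborel. (\<kappa> * \<bar>x\<bar> powr (- 1 - \<alpha>)) * (1 - cos x))"
    using False by (simp add: powr_add)
  also have "(LINT x|lborel. (\<kappa> * \<bar>x\<bar> powr (- 1 - \<alpha>)) * (1 - cos x)) = stable_const"
    unfolding stable_const_def by (subst integral_\<nu>) auto
  finally show ?thesis by simp
qed simp

text \<open>\<nu> is invariant under reflection, so twice the integral equals the integral of the
  symmetrised integrand, in which the odd part and the compensator disappear.\<close>

lemma levy_exponent_stable:
  "levy_exponent 0 0 \<nu> u = - complex_of_real (stable_const * \<bar>u\<bar> powr \<alpha>)"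
proof -
  let ?L = "CLINT x|\<nu>. levy_integrand u x"
  have i: "integrable \<nu> (\<lambda>x. levy_integrand u (-x))"
  proof (rule Bochner_Integration.integrable_bound)
    show "integrable \<nu> (\<lambda>x. (2 + u\<^sup>2) * min 1 (x\<^sup>2))" by (intro integrable_mult_right integrable_min_\<nu>)
    show "AE x in \<nu>. norm (levy_integrand u (-x)) \<le> norm ((2 + u\<^sup>2) * min 1 (x\<^sup>2))"
      using cmod_levy_integrand_le[of u "-x" for x] by (auto intro!: AE_I2 order_trans[OF _ abs_ge_self])
  qed measurable
  have "?L + ?L = (CLINT x|\<nu>. levy_integrand u x) + (CLINT x|\<nu>. levy_integrand u (-x))"
    by (simp add: integral_\<nu>_uminus)
  also have "\<dots> = (CLINT x|\<nu>. complex_of_real (- 2 * (1 - cos (u * x))))"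
    by (subst Bochner_Integration.integral_add[symmetric]) (simp_all only: levy_integrand_add_uminus integrable_levy_integrand i)
  also have "\<dots> = - 2 * complex_of_real (stable_const * \<bar>u\<bar> powr \<alpha>)"
    by (simp only: integral_complex_of_real integral_mult_right_zero integral_one_minus_cos) simp
  finally have "?L = - complex_of_real (stable_const * \<bar>u\<bar> powr \<alpha>)" by simp
  then show ?thesis by (simp add: levy_exponent_def levy_integrand_def[abs_def])
qed

text \<open>Both the density and \<open>1 - cos x\<close> are positive off a countable set, so a
  zero integral would make an interval of positive length null.\<close>

lemma \<nu>_pos:
  assumes "p < q"
  shows "0 < (LINT x|\<nu>. indicator {p<..q} x * (1 - cos x))"
proof -
  let ?g = "\<lambda>x. indicator {p<..q} x * (1 - cos x)"
  have int: "integrable \<nu> ?g"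
    using integrable_real_mult_indicator[OF _ integrable_one_minus_cos[of 1], of "{p<..q}"] by (simp add: mult.commute)
  have nn: "0 \<le> integral\<^sup>L \<nu> ?g" by (intro integral_nonneg_AE AE_I2) auto
  have "integral\<^sup>L \<nu> ?g \<noteq> 0"
  proof
    assume "integral\<^sup>L \<nu> ?g = 0"
    then have "AE x in \<nu>. ?g x = 0"
      using integral_nonneg_eq_0_iff_AE[OF int] by auto
    then have "AE x in lborel. 0 < \<kappa> * \<bar>x\<bar> powr (- 1 - \<alpha>) \<longrightarrow> ?g x = 0"
      unfolding stable_levy_measure_def by (subst (asm) AE_density) auto
    moreover have "AE x in lborel. x \<noteq> (0::real)" by (rule AE_lborel_singleton)
    moreover have "AE x in lborel. cos x \<noteq> (1::real)"
    proof (rule AE_I')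
      show "range (\<lambda>n::int. real_of_int n * 2 * pi) \<in> null_sets lborel"
        by (rule countable_imp_null_set_lborel) simp
      show "{x \<in> space lborel. \<not> cos x \<noteq> 1} \<subseteq> range (\<lambda>n::int. real_of_int n * 2 * pi)"
        by (auto simp: cos_one_2pi_int)
    qed
    ultimately have "AE x in lborel. x \<notin> {p<..q}"
      by eventually_elim (use \<kappa> in \<open>auto simp: indicator_def split: if_splits\<close>)
    then have "{p<..q} \<in> null_sets lborel" by (subst AE_iff_null_sets) auto
    then have "emeasure lborel {p<..q} = 0" by auto
    then show False using assms by simp
  qed
  with nn show ?thesis by (metis order_less_le)
qed

lemma stable_const_pos: "0 < stable_const"
proof -
  have "(LINT x|\<nu>. indicator {0<..1} x * (1 - cos x)) \<le> stable_const"
    unfolding stable_const_def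
  proof (rule integral_mono)
    show "integrable \<nu> (\<lambda>x. indicator {0<..1} x * (1 - cos x))"
      using integrable_real_mult_indicator[OF _ integrable_one_minus_cos[of 1], of "{0<..1}"] by (simp add: mult.commute)
    show "integrable \<nu> (\<lambda>x. 1 - cos x)" using integrable_one_minus_cos[of 1] by simp
  qed (auto simp: indicator_def)
  with \<nu>_pos[of 0 1] show ?thesis by simp
qed

end

lemma symmetric_stable_process_stable_levy:
  assumes "0 < \<alpha>" "\<alpha> < 2" "0 < \<kappa>" "symmetric_stable_process \<alpha> \<kappa> M X"
  shows "stable_levy \<alpha> \<kappa>"
  using assms unfolding symmetric_stable_process_def stable_levy_def
  by (auto simp: levy_process.has_levy_triplet_def)

lemma (in stable_levy) char_stable_process:
  assumes "symmetric_stable_process \<alpha> \<kappa> M X" "0 \<le> t"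
  shows "char (distr M borel (X t)) u = complex_of_real (exp (- (t * stable_const * \<bar>u\<bar> powr \<alpha>)))"
proof -
  have "char (distr M borel (X t)) u = exp (complex_of_real t * levy_exponent 0 0 \<nu> u)"
    using assms unfolding symmetric_stable_process_def by (auto simp: levy_process.has_levy_triplet_def)
  also have "\<dots> = exp (complex_of_real (- (t * stable_const * \<bar>u\<bar> powr \<alpha>)))"
    by (simp add: levy_exponent_stable mult.assoc)
  finally show ?thesis by (simp only: exp_of_real)
qed

section \<open>Gaussian smoothing and tilted measures\<close>

text \<open>Parseval for a Gaussian bump: the bump is a characteristic function itself, and Fubini
  moves the transform to \<open>M\<close>. It turns information on \<open>char M\<close> into bounds
  on interval and tail probabilities without inverting the transform.\<close>

lemma (in real_distribution) gaussian_transform: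
  "complex_of_real (LINT x|M. exp (- (((x - a) * s)\<^sup>2) / 2)) =
    (CLINT v|std_normal_distribution. iexp (- (a * s * v)) * char M (s * v))"
proof -
  interpret N: real_distribution std_normal_distribution by (rule real_dist_normal_dist)
  interpret P: pair_prob_space M std_normal_distribution ..
  have [measurable_cong]: "sets std_normal_distribution = sets borel" by simp
  have "complex_of_real (LINT x|M. exp (- (((x - a) * s)\<^sup>2) / 2)) =
      (CLINT x|M. complex_of_real (exp (- (((x - a) * s)\<^sup>2) / 2)))" by simp
  also have "\<dots> = (CLINT x|M. char std_normal_distribution ((x - a) * s))"
    by (simp only: char_std_normal_distribution)
  also have "\<dots> = (CLINT x|M. CLINT v|std_normal_distribution. iexp (((x - a) * s) * v))"
    by (simp only: char_def)
  also have "\<dots> = (CLINT v|std_normal_distribution. CLINT x|M. iexp (((x - a) * s) * v))"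
  proof (rule P.Fubini_integral[symmetric])
    show "integrable (M \<Otimes>\<^sub>M std_normal_distribution) (\<lambda>(x, v). iexp (((x - a) * s) * v))"
      by (intro P.P.integrable_const_bound[where B=1]) (auto simp del: of_real_mult)
  qed
  also have "\<dots> = (CLINT v|std_normal_distribution. iexp (- (a * s * v)) * char M (s * v))"
  proof (rule Bochner_Integration.integral_cong[OF refl])
    fix v
    have "iexp (((x - a) * s) * v) = iexp (- (a * s * v)) * iexp ((s * v) * x)" for x
      by (simp add: exp_add[symmetric] algebra_simps)
    then show "(CLINT x|M. iexp (((x - a) * s) * v)) = iexp (- (a * s * v)) * char M (s * v)"
      by (simp only: char_def integral_mult_right_zero)
  qed
  finally show ?thesis .
qed

lemma std_normal_density_le_1: "std_normal_density x \<le> 1"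
proof -
  have "1 \<le> sqrt (2 * pi)" using pi_gt3 by simp
  moreover have "exp (- x\<^sup>2 / 2) \<le> 1" by simp
  ultimately have "exp (- x\<^sup>2 / 2) / sqrt (2 * pi) \<le> 1 / 1" by (intro frac_le) auto
  then show ?thesis by (simp add: std_normal_density_def)
qed

lemma power_div_fact_le_exp: "0 \<le> x \<Longrightarrow> x ^ n / fact n \<le> exp (x::real)"
proof -
  assume x: "0 \<le> x"
  have "(\<Sum>k\<in>{n}. x ^ k / fact k) \<le> (\<Sum>k. x ^ k / fact k)"
    using x summable_exp[of x] by (intro sum_le_suminf) (auto simp: field_simps)
  then show ?thesis by (simp add: exp_def scaleR_conv_of_real field_simps)
qed

text \<open>Domination by a multiple of \<open>1 / (1 + v\<^sup>2)\<close>: since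
  \<open>exp y\<close> is at least \<open>y ^ k / fact k\<close>, any \<open>k\<close> with
  \<open>2 \<le> \<alpha> * k\<close> beats \<open>v\<^sup>2\<close>.\<close>

lemma integrable_exp_minus_powr:
  fixes c \<alpha> :: real
  assumes "0 < c" "0 < \<alpha>"
  shows "integrable lborel (\<lambda>v. exp (- (c * \<bar>v\<bar> powr \<alpha>)))"
proof -
  obtain k :: nat where k: "2 / \<alpha> \<le> real k" using real_arch_simple by blast
  define C where "C = max 1 (fact k / c ^ k)"
  have C: "1 \<le> C" "fact k / c ^ k \<le> C" by (auto simp: C_def)
  have int: "integrable lborel (\<lambda>x. 2 * C * inverse (1 + x\<^sup>2 :: real))"
    using integrable_inverse_1_plus_square by (intro integrable_mult_right) (simp add: set_integrable_def)
  show ?thesis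
  proof (rule Bochner_Integration.integrable_bound[OF int])
    have "exp (- (c * \<bar>v\<bar> powr \<alpha>)) \<le> 2 * C * inverse (1 + v\<^sup>2)" for v
    proof (cases "\<bar>v\<bar> \<le> 1")
      case True
      then have "v\<^sup>2 \<le> 1" by (simp add: abs_square_le_1)
      then have "1 + v\<^sup>2 \<le> 2 * C" using C by linarith
      moreover have "0 < 1 + v\<^sup>2" by (rule add_pos_nonneg) auto
      ultimately have "1 \<le> 2 * C * inverse (1 + v\<^sup>2)"
        by (simp only: divide_inverse[symmetric] pos_le_divide_eq mult_1_left)
      moreover have "exp (- (c * \<bar>v\<bar> powr \<alpha>)) \<le> 1" using assms by simp
      ultimately show ?thesis by linarith
    next
      case False
      have "v\<^sup>2 = \<bar>v\<bar> powr 2" using False by (simp add: powr_numeral)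
      also have "\<dots> \<le> \<bar>v\<bar> powr (\<alpha> * real k)"
        using False k assms by (intro powr_mono) (auto simp: field_simps)
      also have "\<dots> = (\<bar>v\<bar> powr \<alpha>) powr real k" by (simp only: powr_powr)
      also have "\<dots> = (\<bar>v\<bar> powr \<alpha>) ^ k" using False by (intro powr_realpow) auto
      finally have "c ^ k * v\<^sup>2 / fact k \<le> (c * \<bar>v\<bar> powr \<alpha>) ^ k / fact k"
        using assms by (intro divide_right_mono) (auto simp: power_mult_distrib)
      also have "\<dots> \<le> exp (c * \<bar>v\<bar> powr \<alpha>)" using assms by (intro power_div_fact_le_exp) auto
      finally have 1: "c ^ k * v\<^sup>2 / fact k \<le> exp (c * \<bar>v\<bar> powr \<alpha>)" .
      have v: "1 < v\<^sup>2" using False by (metis abs_square_le_1 not_le)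
      then have pos: "0 < c ^ k * v\<^sup>2 / fact k" using assms by (intro divide_pos_pos mult_pos_pos) auto
      have "exp (- (c * \<bar>v\<bar> powr \<alpha>)) = 1 / exp (c * \<bar>v\<bar> powr \<alpha>)" by (simp add: exp_minus inverse_eq_divide)
      also have "\<dots> \<le> 1 / (c ^ k * v\<^sup>2 / fact k)" using 1 pos by (intro divide_left_mono mult_pos_pos) auto
      also have "\<dots> = fact k / c ^ k * (1 / v\<^sup>2)" by simp
      also have "\<dots> \<le> C * (2 * inverse (1 + v\<^sup>2))"
      proof (rule mult_mono)
        have "2 / (2 * v\<^sup>2) \<le> 2 / (1 + v\<^sup>2)" using v by (intro divide_left_mono mult_pos_pos) auto
        then show "1 / v\<^sup>2 \<le> 2 * inverse (1 + v\<^sup>2)" by (simp add: inverse_eq_divide)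
      qed (use C in auto)
      finally show ?thesis by simp
    qed
    moreover have "0 \<le> 2 * C * inverse (1 + v\<^sup>2)" for v using C by simp
    ultimately show "AE v in lborel. norm (exp (- (c * \<bar>v\<bar> powr \<alpha>))) \<le> norm (2 * C * inverse (1 + v\<^sup>2))"
      by (intro AE_I2) (simp only: real_norm_def abs_exp_cancel abs_of_nonneg)
  qed measurable
qed

text \<open>A finite substitute for the Levy measure: if \<open>N\<^sub>t\<close> is the law at time \<open>t\<close>, then \<open>cos_tilt N\<^sub>t\<close>
  tends weakly to \<open>cos_tilt \<nu>\<close> as \<open>t\<close> tends to 0, by Levy continuity.\<close>

definition cos_tilt :: "real measure \<Rightarrow> real measure" where
  "cos_tilt N = density N (\<lambda>x. ennreal ((1 - cos x) / (LINT x|N. 1 - cos x)))"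

lemma
  assumes sN [measurable_cong]: "sets N = sets borel" and int: "integrable N (\<lambda>x. 1 - cos x)"
    and pos: "0 < (LINT x|N. 1 - cos x)"
  shows real_distribution_cos_tilt: "real_distribution (cos_tilt N)"
    and char_cos_tilt: "char (cos_tilt N) u =
      (CLINT x|N. iexp (u * x) * complex_of_real (1 - cos x)) / complex_of_real (LINT x|N. 1 - cos x)"
    and measure_cos_tilt: "A \<in> sets borel \<Longrightarrow> measure (cos_tilt N) A =
      (LINT x|N. indicator A x * (1 - cos x)) / (LINT x|N. 1 - cos x)"
proof -
  let ?Z = "LINT x|N. 1 - cos x"
  have "emeasure (cos_tilt N) (space (cos_tilt N)) = (\<integral>\<^sup>+ x. ennreal ((1 - cos x) / ?Z) \<partial>N)"
    unfolding cos_tilt_def by (subst emeasure_density) (auto intro!: nn_integral_cong)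
  also have "\<dots> = ennreal (LINT x|N. (1 - cos x) / ?Z)"
    using int pos by (intro nn_integral_eq_integral) auto
  also have "\<dots> = 1" using pos by simp
  finally have "prob_space (cos_tilt N)" by (rule prob_spaceI)
  then show rd: "real_distribution (cos_tilt N)"
    using sN by (auto simp: real_distribution_def real_distribution_axioms_def cos_tilt_def)
  then interpret T: real_distribution "cos_tilt N" .
  have "char (cos_tilt N) u = (CLINT x|N. ((1 - cos x) / ?Z) *\<^sub>R iexp (u * x))"
    unfolding char_def cos_tilt_def using pos by (subst integral_density) auto
  also have "\<dots> = (CLINT x|N. iexp (u * x) * complex_of_real (1 - cos x) / complex_of_real ?Z)"
    by (intro Bochner_Integration.integral_cong refl) (simp add: scaleR_conv_of_real)
  finally show "char (cos_tilt N) u =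
      (CLINT x|N. iexp (u * x) * complex_of_real (1 - cos x)) / complex_of_real ?Z"
    by simp
  assume A: "A \<in> sets borel"
  then have "measure (cos_tilt N) A = (LINT x|cos_tilt N. indicator A x)" by (simp add: T.emeasure_eq_measure)
  also have "\<dots> = (LINT x|N. ((1 - cos x) / ?Z) *\<^sub>R indicator A x)"
    unfolding cos_tilt_def using pos A by (subst integral_density) auto
  also have "\<dots> = (LINT x|N. indicator A x * (1 - cos x) / ?Z)"
    by (intro Bochner_Integration.integral_cong refl) simp
  finally show "measure (cos_tilt N) A = (LINT x|N. indicator A x * (1 - cos x)) / ?Z" by simp
qed

lemma iexp_times_one_minus_cos:
  "iexp (u * x) * complex_of_real (1 - cos x) = iexp (u * x) - iexp ((u + 1) * x) / 2 - iexp ((u - 1) * x) / 2"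
  by (auto simp: complex_eq_iff Re_exp Im_exp algebra_simps cos_add sin_add cos_diff sin_diff field_simps)

lemma integral_diff_halves:
  fixes f g h :: "'a \<Rightarrow> complex"
  assumes "integrable M f" "integrable M g" "integrable M h"
  shows "(\<integral>x. f x - g x / 2 - h x / 2 \<partial>M) = integral\<^sup>L M f - integral\<^sup>L M g / 2 - integral\<^sup>L M h / 2"
  using assms by simp

lemma tendsto_one_minus_exp_div: "((\<lambda>T. (1 - exp (- (T * k))) / T) \<longlongrightarrow> k) (at (0::real))"
proof -
  have "((\<lambda>T. 1 - exp (- (T * k))) has_field_derivative k) (at 0)"
    by (auto intro!: derivative_eq_intros)
  then show ?thesis by (simp add: DERIV_def)
qed

section \<open>Concentration, tails and small-time asymptotics of stable laws\<close>

context stable_levy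
begin

definition stable_law :: "real \<Rightarrow> real measure \<Rightarrow> bool" where
  "stable_law t N \<longleftrightarrow> real_distribution N \<and>
     (\<forall>u. char N u = complex_of_real (exp (- (t * stable_const * \<bar>u\<bar> powr \<alpha>))))"

lemma stable_law_stable_process:
  assumes "symmetric_stable_process \<alpha> \<kappa> M X" "0 \<le> t"
  shows "stable_law t (distr M borel (X t))"
proof -
  interpret levy_process M X using assms(1) by (simp add: symmetric_stable_process_def)
  show ?thesis
    using char_stable_process[OF assms] measurable_X[OF assms(2)] by (auto simp: stable_law_def)
qed

lemma stable_law_unique: "stable_law t N \<Longrightarrow> stable_law t N' \<Longrightarrow> N = N'"
  unfolding stable_law_def by (intro Levy_uniqueness) auto

text \<open>\<open>exp (1/2)\<close> compensates the least value of a Gaussian bump on its interval;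
  the integral is that of the characteristic function at time 1.\<close>

definition conc_const :: real where
  "conc_const = exp (1/2) * (LINT v|lborel. exp (- (stable_const * \<bar>v\<bar> powr \<alpha>)))"

lemma conc_const_nonneg: "0 \<le> conc_const"
  unfolding conc_const_def by (intro mult_nonneg_nonneg integral_nonneg_AE AE_I2) auto

text \<open>A Gaussian bump of width \<epsilon> around \<open>a\<close> dominates
  \<open>exp (- 1/2)\<close> times the indicator of the interval. Its mean is at most the integral
  of the modulus of the rescaled characteristic function, because the normal density is at most
  1.\<close>

lemma stable_law_concentration:
  assumes N: "stable_law t N" and t: "0 < t" and \<epsilon>: "0 < \<epsilon>"
  shows "measure N {a - \<epsilon>..a + \<epsilon>} \<le> conc_const * \<epsilon> * t powr (- 1 / \<alpha>)"
proof -
  interpret N: real_distribution N using N by (simp add: stable_law_def)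
  interpret G: real_distribution std_normal_distribution by (rule real_dist_normal_dist)
  have ch: "char N u = complex_of_real (exp (- (t * stable_const * \<bar>u\<bar> powr \<alpha>)))" for u
    using N by (simp add: stable_law_def)
  let ?I = "LINT x|N. exp (- (((x - a) * (1/\<epsilon>))\<^sup>2) / 2)"
  let ?e = "\<lambda>v. exp (- (t * stable_const * \<bar>1/\<epsilon> * v\<bar> powr \<alpha>))"
  \<comment> \<open>\<open>q\<close> is \<epsilon> in units of the natural length
    \<open>t powr (1 / \<alpha>)\<close> of the process; substituting \<open>q * v\<close> reduces
    time \<open>t\<close> and width \<epsilon> to time 1 and width 1.\<close>
  define q where "q = \<epsilon> * t powr (- 1 / \<alpha>)"
  have q: "0 < q" using t \<epsilon> by (simp add: q_def)
  have resc: "t * stable_const * \<bar>1/\<epsilon> * (q * v)\<bar> powr \<alpha> = stable_const * \<bar>v\<bar> powr \<alpha>" for v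
  proof -
    have "\<bar>1/\<epsilon> * (q * v)\<bar> powr \<alpha> = (t powr (- 1 / \<alpha>) * \<bar>v\<bar>) powr \<alpha>"
      using t \<epsilon> by (simp add: q_def abs_mult)
    also have "\<dots> = t powr (-1) * \<bar>v\<bar> powr \<alpha>" using t \<alpha> by (simp add: powr_mult powr_powr)
    also have "\<dots> = \<bar>v\<bar> powr \<alpha> / t" using t by (simp add: powr_minus_divide)
    finally show ?thesis using t by simp
  qed
  have int0: "integrable lborel (\<lambda>v. exp (- (stable_const * \<bar>v\<bar> powr \<alpha>)))"
    using stable_const_pos \<alpha> by (intro integrable_exp_minus_powr)
  have int1: "integrable lborel ?e"
  proof (rule lborel_integrable_real_affine_iff[of q ?e 0, THEN iffD1])
    show "integrable lborel (\<lambda>v. ?e (0 + q * v))" using int0 by (simp only: add_0 resc)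
  qed (use q in simp)
  have "\<bar>?I\<bar> = cmod (complex_of_real ?I)" by simp
  also have "\<dots> = cmod (CLINT v|std_normal_distribution. iexp (- (a * (1/\<epsilon>) * v)) * char N (1/\<epsilon> * v))"
    by (subst N.gaussian_transform) simp
  also have "\<dots> \<le> (LINT v|std_normal_distribution. cmod (iexp (- (a * (1/\<epsilon>) * v)) * char N (1/\<epsilon> * v)))"
    by (rule integral_norm_bound)
  also have "\<dots> = (LINT v|std_normal_distribution. ?e v)"
    by (intro Bochner_Integration.integral_cong refl) (simp add: norm_mult ch del: of_real_mult)
  also have "\<dots> = (LINT v|lborel. std_normal_density v * ?e v)"
    by (subst integral_density) auto
  also have "\<dots> \<le> (LINT v|lborel. ?e v)"
  proof (rule integral_mono_AE)
    show "integrable lborel (\<lambda>v. std_normal_density v * ?e v)"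
      using std_normal_density_le_1
      by (intro Bochner_Integration.integrable_bound[OF int1]) (auto intro!: AE_I2 mult_left_le_one_le simp: abs_mult)
    show "AE v in lborel. std_normal_density v * ?e v \<le> ?e v"
      using std_normal_density_le_1 by (auto intro!: AE_I2 mult_left_le_one_le)
  qed fact
  also have "\<dots> = q * (LINT v|lborel. exp (- (stable_const * \<bar>v\<bar> powr \<alpha>)))"
    using q lborel_integral_real_affine[of q ?e 0] by (simp only: add_0 resc) simp
  finally have I: "?I \<le> q * (LINT v|lborel. exp (- (stable_const * \<bar>v\<bar> powr \<alpha>)))" by simp
  have "measure N {a - \<epsilon>..a + \<epsilon>} = (LINT x|N. indicator {a - \<epsilon>..a + \<epsilon>} x)" by simp
  also have "\<dots> \<le> (LINT x|N. exp (1/2) * exp (- (((x - a) * (1/\<epsilon>))\<^sup>2) / 2))"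
  proof (rule integral_mono)
    show "integrable N (\<lambda>x. exp (1/2) * exp (- (((x - a) * (1/\<epsilon>))\<^sup>2) / 2))"
      by (intro integrable_mult_right N.integrable_const_bound[where B=1]) auto
    fix x
    show "indicator {a - \<epsilon>..a + \<epsilon>} x \<le> exp (1/2) * exp (- (((x - a) * (1/\<epsilon>))\<^sup>2) / 2)"
    proof (cases "x \<in> {a - \<epsilon>..a + \<epsilon>}")
      case True
      then have "\<bar>(x - a) * (1/\<epsilon>)\<bar> \<le> 1" using \<epsilon> by (auto simp: abs_le_iff field_simps)
      then have "((x - a) * (1/\<epsilon>))\<^sup>2 \<le> 1" by (simp only: abs_square_le_1)
      then have "0 \<le> 1/2 + - (((x - a) * (1/\<epsilon>))\<^sup>2) / 2" by simp
      then have "1 \<le> exp (1/2 + - (((x - a) * (1/\<epsilon>))\<^sup>2) / 2)" by (simp only: one_le_exp_iff)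
      then show ?thesis using True unfolding exp_add by (simp only: indicator_simps)
    qed simp
    show "integrable N (indicat_real {a - \<epsilon>..a + \<epsilon>})" by (intro N.integrable_const_bound[where B=1]) auto
  qed
  also have "\<dots> = exp (1/2) * ?I" by simp
  also have "\<dots> \<le> exp (1/2) * (q * (LINT v|lborel. exp (- (stable_const * \<bar>v\<bar> powr \<alpha>))))"
    using I by (intro mult_left_mono) auto
  finally show ?thesis by (simp add: q_def conc_const_def mult_ac)
qed

text \<open>2 is the mean of \<open>1 + v\<^sup>2\<close> under the standard normal law, and
  \<open>1 - exp (- 1 / 2)\<close> is the least value of an inverted Gaussian bump of width
  \<open>a\<close> on the set \<open>a \<le> \<bar>x\<bar>\<close>.\<close>

definition tail_const :: real where
  "tail_const = 2 * stable_const / (1 - exp (- 1 / 2))"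

lemma tail_const_pos: "0 < tail_const"
  using stable_const_pos by (simp add: tail_const_def)

text \<open>The inverted Gaussian bump dominates a multiple of the tail indicator. Its mean is a
  Gaussian average of one minus the characteristic function, and
  \<open>1 - exp (- y) \<le> y\<close> makes this linear in \<open>t\<close>.\<close>

lemma stable_law_tail:
  assumes N: "stable_law t N" and t: "0 \<le> t" and a: "0 < a"
  shows "measure N {x. a \<le> \<bar>x\<bar>} \<le> tail_const * t * a powr (- \<alpha>)"
proof -
  interpret N: real_distribution N using N by (simp add: stable_law_def)
  interpret G: real_distribution std_normal_distribution by (rule real_dist_normal_dist)
  have ch: "char N u = complex_of_real (exp (- (t * stable_const * \<bar>u\<bar> powr \<alpha>)))" for u
    using N by (simp add: stable_law_def)
  let ?I = "LINT x|N. exp (- (((x - 0) * (1/a))\<^sup>2) / 2)"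
  let ?e = "\<lambda>v. exp (- (t * stable_const * \<bar>1/a * v\<bar> powr \<alpha>))"
  have "complex_of_real ?I = (CLINT v|std_normal_distribution. complex_of_real (?e v))"
    by (subst N.gaussian_transform) (simp add: ch)
  then have I: "?I = (LINT v|std_normal_distribution. ?e v)"
    by (simp only: integral_complex_of_real of_real_eq_iff)
  have inte: "integrable std_normal_distribution ?e"
    using t stable_const_pos by (intro G.integrable_const_bound[where B=1]) auto
  have "(1 - exp (- 1/2)) * measure N {x. a \<le> \<bar>x\<bar>} = (LINT x|N. (1 - exp (- 1/2)) * indicator {x. a \<le> \<bar>x\<bar>} x)"
    by simp
  also have "\<dots> \<le> (LINT x|N. 1 - exp (- (((x - 0) * (1/a))\<^sup>2) / 2))"
  proof (rule integral_mono)
    show "integrable N (\<lambda>x. 1 - exp (- (((x - 0) * (1/a))\<^sup>2) / 2))"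
      by (intro N.integrable_const_bound[where B=1]) auto
    fix x
    show "(1 - exp (- 1/2)) * indicator {x. a \<le> \<bar>x\<bar>} x \<le> 1 - exp (- (((x - 0) * (1/a))\<^sup>2) / 2)"
    proof (cases "a \<le> \<bar>x\<bar>")
      case True
      then have "1 \<le> \<bar>(x - 0) * (1/a)\<bar>" using a by (auto simp: field_simps abs_mult)
      then have "1 \<le> ((x - 0) * (1/a))\<^sup>2" using one_le_power[of _ 2] by (metis power2_abs)
      then show ?thesis using True by simp
    qed simp
  qed (auto simp: less_top[symmetric])
  also have "\<dots> = 1 - ?I"
    by (subst Bochner_Integration.integral_diff) (auto intro!: N.integrable_const_bound[where B=1] simp: N.prob_space[simplified])
  also have "\<dots> = (LINT v|std_normal_distribution. 1 - ?e v)"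
    unfolding I using inte G.prob_space by (subst Bochner_Integration.integral_diff) auto
  also have "\<dots> \<le> (LINT v|std_normal_distribution. t * stable_const * a powr (- \<alpha>) * (1 + v\<^sup>2))"
  proof (rule integral_mono)
    show "integrable std_normal_distribution (\<lambda>v. t * stable_const * a powr (- \<alpha>) * (1 + v\<^sup>2))"
      by (intro integrable_mult_right Bochner_Integration.integrable_add integrable_std_normal_distribution_moment) auto
    show "integrable std_normal_distribution (\<lambda>v. 1 - ?e v)" using inte by simp
    fix v
    have "1 - ?e v \<le> t * stable_const * \<bar>1/a * v\<bar> powr \<alpha>"
      using exp_ge_add_one_self[of "- (t * stable_const * \<bar>1/a * v\<bar> powr \<alpha>)"] by linarith
    also have "\<dots> = t * stable_const * (a powr (- \<alpha>) * \<bar>v\<bar> powr \<alpha>)"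
      using a by (simp add: abs_mult powr_divide powr_minus_divide)
    also have "\<dots> \<le> t * stable_const * (a powr (- \<alpha>) * (1 + v\<^sup>2))"
    proof (intro mult_left_mono)
      \<comment> \<open>Here \<alpha> < 2 enters: the second Gaussian moment suffices.\<close>
      show "\<bar>v\<bar> powr \<alpha> \<le> 1 + v\<^sup>2"
      proof (cases "\<bar>v\<bar> \<le> 1")
        case True
        then have "\<bar>v\<bar> powr \<alpha> \<le> 1" using \<alpha> by (intro powr_le1) auto
        then show ?thesis by (simp add: add_increasing2)
      next
        case False
        then have "\<bar>v\<bar> powr \<alpha> \<le> \<bar>v\<bar> powr 2" using \<alpha> by (intro powr_mono) auto
        then show ?thesis using False by (simp add: powr_numeral)
      qed
    qed (use t stable_const_pos in auto)
    finally show "1 - ?e v \<le> t * stable_const * a powr (- \<alpha>) * (1 + v\<^sup>2)" by (simp only: mult.assoc)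
  qed
  also have "\<dots> = t * stable_const * a powr (- \<alpha>) * 2"
    using std_normal_distribution_even_moments(1)[of 1] G.prob_space
      integrable_std_normal_distribution_moment[of 2]
    by (simp add: Bochner_Integration.integral_add)
  finally have "(1 - exp (- 1/2)) * measure N {x. a \<le> \<bar>x\<bar>} \<le> t * stable_const * a powr (- \<alpha>) * 2" .
  moreover have "0 < 1 - exp (- 1/2 :: real)" by simp
  ultimately have "measure N {x. a \<le> \<bar>x\<bar>} \<le> t * stable_const * a powr (- \<alpha>) * 2 / (1 - exp (- 1/2))"
    by (simp only: pos_le_divide_eq) (simp add: mult.commute)
  then show ?thesis by (simp add: tail_const_def mult_ac)
qed

lemma stable_law_integral_one_minus_cos:
  assumes "stable_law t N"
  shows "(LINT x|N. 1 - cos x) = 1 - exp (- (t * stable_const))"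
proof -
  interpret real_distribution N using assms by (simp add: stable_law_def)
  have int: "integrable N (\<lambda>x. iexp (1 * x))"
    by (intro integrable_const_bound[where B=1]) (auto simp del: of_real_mult)
  have "(LINT x|N. cos x) = (LINT x|N. Re (iexp (1 * x)))" by (simp add: Re_exp)
  also have "\<dots> = Re (char N 1)" unfolding char_def using int by (rule integral_Re)
  also have "\<dots> = exp (- (t * stable_const))" using assms by (simp add: stable_law_def)
  finally show ?thesis
    by (subst Bochner_Integration.integral_diff) (auto intro!: integrable_const_bound[where B=1] simp: prob_space[simplified])
qed

text \<open>Cancelling \<open>t\<close> gives the formula of \<open>levy_char_cos_tilt\<close> with
  the exponent replaced by a difference quotient in time, so that the limit as \<open>t\<close>
  tends to 0 can be taken term by term.\<close>

lemma stable_law_char_cos_tilt: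
  assumes N: "stable_law t N" and t: "0 < t"
  defines "E \<equiv> \<lambda>w. (1 - exp (- (t * (stable_const * \<bar>w\<bar> powr \<alpha>)))) / t"
  shows "char (cos_tilt N) u = complex_of_real ((- E u + E (u + 1) / 2 + E (u - 1) / 2) / E 1)"
proof -
  interpret real_distribution N using N by (simp add: stable_law_def)
  have ch: "char N u = complex_of_real (exp (- (t * (stable_const * \<bar>u\<bar> powr \<alpha>))))" for u
    using N by (simp add: stable_law_def mult.assoc)
  have int: "integrable N (\<lambda>x. iexp (v * x))" for v
    by (intro integrable_const_bound[where B=1]) (auto simp del: of_real_mult)
  have Z: "(LINT x|N. 1 - cos x) = t * E 1" "0 < (LINT x|N. 1 - cos x)"
    using stable_law_integral_one_minus_cos[OF N] t stable_const_pos by (auto simp: E_def)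
  have "(CLINT x|N. iexp (u * x) * complex_of_real (1 - cos x)) = char N u - char N (u + 1) / 2 - char N (u - 1) / 2"
    unfolding iexp_times_one_minus_cos char_def by (rule integral_diff_halves) (rule int)+
  also have "\<dots> = complex_of_real (t * (- E u + E (u + 1) / 2 + E (u - 1) / 2))"
    using t by (simp add: ch E_def field_simps)
  finally have *: "(CLINT x|N. iexp (u * x) * complex_of_real (1 - cos x)) =
    complex_of_real (t * (- E u + E (u + 1) / 2 + E (u - 1) / 2))" .
  have "integrable N (\<lambda>x. 1 - cos x)"
    by (intro integrable_const_bound[where B=2]) (auto intro!: order_trans[OF abs_triangle_ineq4])
  from char_cos_tilt[OF events_eq_borel this Z(2), of u]
  have "char (cos_tilt N) u = complex_of_real (t * (- E u + E (u + 1) / 2 + E (u - 1) / 2)) / complex_of_real (t * E 1)"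
    by (simp only: * Z(1))
  also have "\<dots> = complex_of_real (t * (- E u + E (u + 1) / 2 + E (u - 1) / 2) / (t * E 1))"
    by (simp only: of_real_divide)
  also have "t * (- E u + E (u + 1) / 2 + E (u - 1) / 2) / (t * E 1) = (- E u + E (u + 1) / 2 + E (u - 1) / 2) / E 1"
    using t by simp
  finally show ?thesis .
qed

lemma levy_char_cos_tilt:
  defines "E \<equiv> \<lambda>w. stable_const * \<bar>w\<bar> powr \<alpha>"
  shows "char (cos_tilt \<nu>) u = complex_of_real ((- E u + E (u + 1) / 2 + E (u - 1) / 2) / E 1)"
proof -
  have I: "(CLINT x|\<nu>. levy_integrand u x) = - complex_of_real (E u)" for u
    using levy_exponent_stable[of u] by (simp add: levy_exponent_def levy_integrand_def[abs_def] E_def)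
  have "(CLINT x|\<nu>. iexp (u * x) * complex_of_real (1 - cos x)) =
    (CLINT x|\<nu>. levy_integrand u x) - (CLINT x|\<nu>. levy_integrand (u + 1) x) / 2 - (CLINT x|\<nu>. levy_integrand (u - 1) x) / 2"
    unfolding levy_integrand_combine by (rule integral_diff_halves) (rule integrable_levy_integrand)+
  then have *: "(CLINT x|\<nu>. iexp (u * x) * complex_of_real (1 - cos x)) =
    complex_of_real (- E u + E (u + 1) / 2 + E (u - 1) / 2)" by (simp add: I)
  have "integrable \<nu> (\<lambda>x. 1 - cos x)" "0 < (LINT x|\<nu>. 1 - cos x)"
    using stable_const_pos integrable_one_minus_cos[of 1] by (auto simp: stable_const_def)
  from char_cos_tilt[OF sets_\<nu> this, of u] show ?thesis
    by (simp only: * of_real_divide) (simp add: E_def stable_const_def)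
qed

text \<open>The rate of jumping into an interval is positive. The laws collapse to the point 0 as
  \<open>t\<close> tends to 0, but their tilts converge to the tilt of \<nu>, which charges the
  interval. As \<open>1 - cos x \<le> 2\<close> and the normaliser is about
  \<open>stable_const * t\<close>, the untilted mass is at least of order \<open>t\<close>. Levy
  continuity is about sequences, hence the argument by a sequence of counterexamples.\<close>

lemma stable_law_interval_lower_bound:
  assumes "p < q"
  shows "\<exists>b>0. \<exists>\<delta>>0. \<forall>t N. 0 < t \<longrightarrow> t < \<delta> \<longrightarrow> stable_law t N \<longrightarrow> b * t \<le> measure N {p<..q}"
proof (rule ccontr)
  have int: "integrable \<nu> (\<lambda>x. 1 - cos x)" using integrable_one_minus_cos[of 1] by simp
  have pos: "0 < (LINT x|\<nu>. 1 - cos x)" using stable_const_pos by (simp add: stable_const_def)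
  interpret R: real_distribution "cos_tilt \<nu>"
    by (rule real_distribution_cos_tilt[OF sets_\<nu> int pos])
  define r where "r = measure (cos_tilt \<nu>) {p<..q}"
  have r: "0 < r"
    unfolding r_def using \<nu>_pos[OF assms] pos by (subst measure_cos_tilt[OF sets_\<nu> int]) auto
  \<comment> \<open>With this \<open>b\<close> the limit along the counterexamples gives
    \<open>r \<le> 2 * b / stable_const = r / 4\<close>.\<close>
  define b where "b = stable_const * r / 8"
  have b: "0 < b" using r stable_const_pos by (simp add: b_def)
  assume "\<not> ?thesis"
  then have neg: "\<not> (\<forall>t N. 0 < t \<longrightarrow> t < \<delta> \<longrightarrow> stable_law t N \<longrightarrow> b * t \<le> measure N {p<..q})" if "0 < \<delta>" for \<delta>
    using b that by blast
  have "\<forall>n. \<exists>tN. 0 < fst tN \<and> fst tN < 1 / Suc n \<and> stable_law (fst tN) (snd tN) \<and>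
      measure (snd tN) {p<..q} < b * fst tN"
    using neg[of "1 / Suc n" for n] by (auto simp: not_le)
  from choice[OF this] obtain TN where TN: "\<forall>n. 0 < fst (TN n) \<and> fst (TN n) < 1 / Suc n \<and>
      stable_law (fst (TN n)) (snd (TN n)) \<and> measure (snd (TN n)) {p<..q} < b * fst (TN n)" ..
  define T where "T n = fst (TN n)" for n
  define N where "N n = snd (TN n)" for n
  have T: "0 < T n" "T n < 1 / Suc n" and N: "stable_law (T n) (N n)"
    and less: "measure (N n) {p<..q} < b * T n" for n
    using TN by (auto simp: T_def N_def)
  have "T \<longlonglongrightarrow> 0"
    by (rule tendsto_sandwich[OF _ _ tendsto_const LIMSEQ_inverse_real_of_nat])
       (use T in \<open>auto simp: less_imp_le divide_inverse intro!: always_eventually\<close>)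
  then have T0: "filterlim T (at 0) sequentially"
    using T(1) by (auto simp: filterlim_at less_imp_neq[THEN not_sym] intro!: always_eventually)
  define E where "E = (\<lambda>n w. (1 - exp (- (T n * (stable_const * \<bar>w\<bar> powr \<alpha>)))) / T n)"
  have E: "(\<lambda>n. E n w) \<longlonglongrightarrow> stable_const * \<bar>w\<bar> powr \<alpha>" for w
    unfolding E_def by (rule filterlim_compose[OF tendsto_one_minus_exp_div T0])
  interpret N: real_distribution "N n" for n using N by (simp add: stable_law_def)
  have intN: "integrable (N n) (\<lambda>x. 1 - cos x)" for n
    by (intro N.integrable_const_bound[where B=2]) (auto intro!: order_trans[OF abs_triangle_ineq4])
  have Z: "(LINT x|N n. 1 - cos x) = T n * E n 1" "0 < (LINT x|N n. 1 - cos x)" for n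
    using stable_law_integral_one_minus_cos[OF N] T(1)[of n] stable_const_pos by (auto simp: E_def)
  have "weak_conv_m (\<lambda>n. cos_tilt (N n)) (cos_tilt \<nu>)"
  proof (rule levy_continuity)
    show "real_distribution (cos_tilt (N n))" for n
      using intN Z by (intro real_distribution_cos_tilt) auto
    show "(\<lambda>n. char (cos_tilt (N n)) u) \<longlonglongrightarrow> char (cos_tilt \<nu>) u" for u
    proof -
      have "char (cos_tilt (N n)) u = complex_of_real ((- E n u + E n (u + 1) / 2 + E n (u - 1) / 2) / E n 1)" for n
        using stable_law_char_cos_tilt[OF N T(1)] by (simp only: E_def)
      then show ?thesis
        unfolding levy_char_cos_tilt using stable_const_pos by (simp only:) (intro tendsto_intros E, simp_all)
    qed
  qed (rule R.real_distribution_axioms)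
  then have "(\<lambda>n. cdf (cos_tilt (N n)) x) \<longlonglongrightarrow> cdf (cos_tilt \<nu>) x" for x
  proof -
    \<comment> \<open>The limit has no atoms, so the distribution functions converge at every point,
      in particular at \<open>p\<close> and \<open>q\<close>.\<close>
    have "measure (cos_tilt \<nu>) {x} = (LINT y|\<nu>. indicator {x} y * (1 - cos y)) / (LINT y|\<nu>. 1 - cos y)"
      by (rule measure_cos_tilt[OF sets_\<nu> int pos]) simp
    also have "(LINT y|\<nu>. indicator {x} y * (1 - cos y)) = (LINT y|lborel. (\<kappa> * \<bar>y\<bar> powr (- 1 - \<alpha>)) *\<^sub>R (indicator {x} y * (1 - cos y)))"
      by (rule integral_\<nu>) simp
    also have "\<dots> = 0"
    proof (rule integral_eq_zero_AE)
      show "AE y in lborel. (\<kappa> * \<bar>y\<bar> powr (- 1 - \<alpha>)) *\<^sub>R (indicator {x} y * (1 - cos y)) = 0"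
        using AE_lborel_singleton[of x] by eventually_elim (simp add: indicator_def)
    qed
    finally have "isCont (cdf (cos_tilt \<nu>)) x" by (simp add: R.isCont_cdf)
    with \<open>weak_conv_m _ _\<close> show ?thesis by (auto simp: weak_conv_m_def weak_conv_def)
  qed
  then have "(\<lambda>n. cdf (cos_tilt (N n)) q - cdf (cos_tilt (N n)) p) \<longlonglongrightarrow> cdf (cos_tilt \<nu>) q - cdf (cos_tilt \<nu>) p"
    by (intro tendsto_diff)
  moreover have "cdf (cos_tilt (N n)) q - cdf (cos_tilt (N n)) p = measure (cos_tilt (N n)) {p<..q}" for n
    using intN Z assms by (intro finite_borel_measure.cdf_diff_eq real_distribution.finite_borel_measure_M real_distribution_cos_tilt) auto
  moreover have "cdf (cos_tilt \<nu>) q - cdf (cos_tilt \<nu>) p = r"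
    unfolding r_def using assms by (rule R.cdf_diff_eq)
  ultimately have lim: "(\<lambda>n. measure (cos_tilt (N n)) {p<..q}) \<longlonglongrightarrow> r" by simp
  have le: "measure (cos_tilt (N n)) {p<..q} \<le> 2 * b / E n 1" for n
  proof -
    have "(LINT x|N n. indicator {p<..q} x * (1 - cos x)) \<le> (LINT x|N n. 2 * indicat_real {p<..q} x)"
    proof (rule integral_mono)
      show "integrable (N n) (\<lambda>x. indicator {p<..q} x * (1 - cos x))"
        using integrable_real_mult_indicator[OF _ intN[of n], of "{p<..q}"] by (simp add: mult.commute)
      show "integrable (N n) (\<lambda>x. 2 * indicat_real {p<..q} x)"
        by (intro integrable_mult_right N.integrable_const_bound[where B=1]) auto
      fix x show "indicator {p<..q} x * (1 - cos x) \<le> 2 * indicat_real {p<..q} x"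
        using cos_ge_minus_one[of x] by (auto simp: indicator_def)
    qed
    also have "\<dots> = 2 * measure (N n) {p<..q}" by simp
    also have "\<dots> \<le> 2 * (b * T n)" using less[of n] by simp
    finally have *: "(LINT x|N n. indicator {p<..q} x * (1 - cos x)) \<le> 2 * (b * T n)" .
    have "measure (cos_tilt (N n)) {p<..q} = (LINT x|N n. indicator {p<..q} x * (1 - cos x)) / (T n * E n 1)"
      unfolding Z(1)[symmetric] using intN Z(2) by (intro measure_cos_tilt) auto
    also have "\<dots> \<le> 2 * (b * T n) / (T n * E n 1)"
      using * Z[of n] by (intro divide_right_mono) auto
    also have "\<dots> = 2 * b / E n 1" using T(1)[of n] by simp
    finally show ?thesis .
  qed
  have "(\<lambda>n. 2 * b / E n 1) \<longlonglongrightarrow> 2 * b / (stable_const * \<bar>1\<bar> powr \<alpha>)"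
    using stable_const_pos by (intro tendsto_intros E) auto
  then have "r \<le> 2 * b / (stable_const * \<bar>1\<bar> powr \<alpha>)"
    by (rule LIMSEQ_le[OF lim]) (use le in auto)
  also have "\<dots> = r / 4" using stable_const_pos by (simp add: b_def)
  finally show False using r by simp
qed

end

section \<open>Stable processes on a time grid\<close>

locale stable_process = stable_levy \<alpha> \<kappa> + levy_process M X
  for \<alpha> \<kappa> :: real and M :: "'w measure" and X :: "real \<Rightarrow> 'w \<Rightarrow> real" +
  assumes stable: "symmetric_stable_process \<alpha> \<kappa> M X"
begin

lemma stable_law_increment:
  assumes "0 \<le> s" "0 \<le> t"
  shows "stable_law t (distr M borel (\<lambda>\<omega>. X (s + t) \<omega> - X s \<omega>))"
  using stable_law_stable_process[OF stable assms(2)] stationary_increments[OF assms] by simp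

lemma prob_increment_eq:
  assumes "0 \<le> s" "0 \<le> t" "A \<in> sets borel"
  shows "\<P>(\<omega> in M. X (s + t) \<omega> - X s \<omega> \<in> A) = measure (distr M borel (\<lambda>\<omega>. X (s + t) \<omega> - X s \<omega>)) A"
  using assms by (subst measure_distr) (auto intro!: increment_measurable arg_cong[where f=prob])

lemma prob_increment_tail:
  assumes "0 \<le> s" "0 \<le> t" "0 < a"
  shows "\<P>(\<omega> in M. a \<le> \<bar>X (s + t) \<omega> - X s \<omega>\<bar>) \<le> tail_const * t * a powr (- \<alpha>)"
  using stable_law_tail[OF stable_law_increment[OF assms(1,2)] assms(2,3)]
    prob_increment_eq[OF assms(1,2), of "{x. a \<le> \<bar>x\<bar>}"] by simp

lemma prob_increment_concentration:
  assumes "0 \<le> s" "0 < t" "0 < \<epsilon>"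
  shows "\<P>(\<omega> in M. \<bar>X (s + t) \<omega> - X s \<omega> - a\<bar> \<le> \<epsilon>) \<le> conc_const * \<epsilon> * t powr (- 1 / \<alpha>)"
proof -
  have "{\<omega>\<in>space M. \<bar>X (s + t) \<omega> - X s \<omega> - a\<bar> \<le> \<epsilon>} = {\<omega>\<in>space M. X (s + t) \<omega> - X s \<omega> \<in> {a - \<epsilon>..a + \<epsilon>}}"
    by (auto simp: abs_le_iff)
  then show ?thesis
    using stable_law_concentration[OF stable_law_increment[of s t] assms(2,3), of a] assms
      prob_increment_eq[of s t "{a - \<epsilon>..a + \<epsilon>}"] by simp
qed

definition walk :: "real \<Rightarrow> real \<Rightarrow> nat \<Rightarrow> 'w \<Rightarrow> real" where
  "walk t d j \<omega> = X (t + real j * d) \<omega> - X t \<omega>"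

lemma walk_0 [simp]: "walk t d 0 \<omega> = 0"
  by (simp add: walk_def)

lemma walk_measurable: "0 \<le> t \<Longrightarrow> 0 \<le> d \<Longrightarrow> walk t d j \<in> borel_measurable M"
  unfolding walk_def[abs_def] by (intro increment_measurable) auto

lemma prob_walk_diff_tail:
  assumes "0 \<le> t" "0 \<le> d" "0 < r" "j \<le> n"
  shows "\<P>(\<omega> in M. r \<le> \<bar>walk t d n \<omega> - walk t d j \<omega>\<bar>) \<le> tail_const * (real n * d) * r powr (- \<alpha>)"
proof -
  have eq: "t + real n * d = (t + real j * d) + real (n - j) * d"
    using assms(4) by (simp add: of_nat_diff algebra_simps)
  have "\<P>(\<omega> in M. r \<le> \<bar>walk t d n \<omega> - walk t d j \<omega>\<bar>) =
      \<P>(\<omega> in M. r \<le> \<bar>X ((t + real j * d) + real (n - j) * d) \<omega> - X (t + real j * d) \<omega>\<bar>)"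
    by (simp only: eq[symmetric] walk_def) simp
  also have "\<dots> \<le> tail_const * (real (n - j) * d) * r powr (- \<alpha>)"
    using assms by (intro prob_increment_tail) auto
  also have "\<dots> \<le> tail_const * (real n * d) * r powr (- \<alpha>)"
    using assms tail_const_pos by (intro mult_right_mono mult_left_mono) auto
  finally show ?thesis .
qed

section \<open>Hitting and maximal inequalities on the grid\<close>

text \<open>Grid version of the strong Markov property: a first hit at step \<open>j\<close> is
  decided by the increments before \<open>j\<close>.\<close>

lemma walk_past_future_indep:
  assumes t: "0 \<le> t" "0 \<le> d" and j: "j \<le> n" and A: "A \<in> sets borel" and B: "B \<in> sets borel"
  shows "\<P>(\<omega> in M. (walk t d j \<omega> \<in> A \<and> (\<forall>i<j. walk t d i \<omega> \<notin> A)) \<and> walk t d n \<omega> - walk t d j \<omega> \<in> B) =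
    \<P>(\<omega> in M. walk t d j \<omega> \<in> A \<and> (\<forall>i<j. walk t d i \<omega> \<notin> A)) * \<P>(\<omega> in M. walk t d n \<omega> - walk t d j \<omega> \<in> B)"
proof -
  define D where "D = (\<lambda>k \<omega>. X (t + real (Suc k) * d) \<omega> - X (t + real k * d) \<omega>)"
  have walk: "walk t d k \<omega> = (\<Sum>i<k. D i \<omega>)" for k \<omega>
    using sum_lessThan_telescope[of "\<lambda>i. X (t + real i * d) \<omega>" k] by (simp add: D_def walk_def)
  have "indep_vars (\<lambda>_. borel) D {..<n}"
    unfolding D_def by (rule indep_increments[of "\<lambda>k. t + real k * d"]) (use t in \<open>auto intro: mult_right_mono\<close>)
  then have ind: "indep_var (PiM {..<j} (\<lambda>_. borel)) (\<lambda>\<omega>. \<lambda>i\<in>{..<j}. D i \<omega>)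
      (PiM {j..<n} (\<lambda>_. borel)) (\<lambda>\<omega>. \<lambda>i\<in>{j..<n}. D i \<omega>)"
    by (rule indep_var_restrict) (use j in auto)
  let ?C1 = "{f\<in>space (PiM {..<j} (\<lambda>_. borel)). (\<Sum>i<j. f i) \<in> A \<and> (\<forall>i<j. (\<Sum>k<i. f k) \<notin> A)}"
  let ?C2 = "{f\<in>space (PiM {j..<n} (\<lambda>_. borel)). (\<Sum>i\<in>{j..<n}. f i) \<in> B}"
  have m1: "(\<lambda>f. \<Sum>k<i. f k) \<in> borel_measurable (PiM {..<j} (\<lambda>_. borel::real measure))" if "i \<le> j" for i
    using that by (intro borel_measurable_sum measurable_component_singleton) auto
  have s1: "{f\<in>space (PiM {..<j} (\<lambda>_. borel)). (\<Sum>k<i. f k) \<in> A} \<in> sets (PiM {..<j} (\<lambda>_. borel::real measure))" if "i \<le> j" for i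
  proof -
    have "{f\<in>space (PiM {..<j} (\<lambda>_. borel)). (\<Sum>k<i. f k) \<in> A} = (\<lambda>f. \<Sum>k<i. f k) -` A \<inter> space (PiM {..<j} (\<lambda>_. borel::real measure))"
      by auto
    then show ?thesis using measurable_sets[OF m1[OF that] A] by (simp only:)
  qed
  have s2: "{f\<in>space (PiM {..<j} (\<lambda>_. borel)). \<forall>i\<in>{..<j}. (\<Sum>k<i. f k) \<notin> A} \<in> sets (PiM {..<j} (\<lambda>_. borel::real measure))"
  proof (rule sets.sets_Collect_finite_All)
    fix i assume "i \<in> {..<j}"
    then show "{f\<in>space (PiM {..<j} (\<lambda>_. borel)). (\<Sum>k<i. f k) \<notin> A} \<in> sets (PiM {..<j} (\<lambda>_. borel::real measure))"
      by (intro sets.sets_Collect_neg s1) simp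
  qed simp
  have C1: "?C1 \<in> sets (PiM {..<j} (\<lambda>_. borel))"
    using sets.sets_Collect_conj[OF s2 s1[OF order_refl]] by (simp only: Ball_def lessThan_iff)
  have m2: "(\<lambda>f. \<Sum>i\<in>{j..<n}. f i) \<in> borel_measurable (PiM {j..<n} (\<lambda>_. borel::real measure))"
    by (intro borel_measurable_sum measurable_component_singleton) auto
  have C2: "?C2 \<in> sets (PiM {j..<n} (\<lambda>_. borel))"
    using measurable_sets[OF m2 B] by (simp add: vimage_def Int_def conj_commute)
  define R1 where "R1 = (\<lambda>\<omega>. \<lambda>i\<in>{..<j}. D i \<omega>)"
  define R2 where "R2 = (\<lambda>\<omega>. \<lambda>i\<in>{j..<n}. D i \<omega>)"
  have sp: "R1 \<omega> \<in> space (PiM {..<j} (\<lambda>_. borel))" "R2 \<omega> \<in> space (PiM {j..<n} (\<lambda>_. borel))" for \<omega>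
    by (simp_all add: R1_def R2_def space_PiM)
  have r1: "(\<Sum>k<i. R1 \<omega> k) = walk t d i \<omega>" if "i \<le> j" for i \<omega>
    unfolding walk R1_def using that by (intro sum.cong) auto
  have r2: "(\<Sum>i\<in>{j..<n}. R2 \<omega> i) = walk t d n \<omega> - walk t d j \<omega>" for \<omega>
  proof -
    have "(\<Sum>i\<in>{..<n}. D i \<omega>) = (\<Sum>i\<in>{..<j}. D i \<omega>) + (\<Sum>i\<in>{j..<n}. D i \<omega>)"
      using j by (subst sum.union_disjoint[symmetric]) (auto intro!: sum.cong)
    then show ?thesis by (simp add: walk R2_def)
  qed
  have e1: "R1 -` ?C1 \<inter> space M = {\<omega>\<in>space M. walk t d j \<omega> \<in> A \<and> (\<forall>i<j. walk t d i \<omega> \<notin> A)}"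
    using sp(1) r1 by (auto simp: less_imp_le)
  have e2: "R2 -` ?C2 \<inter> space M = {\<omega>\<in>space M. walk t d n \<omega> - walk t d j \<omega> \<in> B}"
    using sp(2) r2 by auto
  have "{\<omega>\<in>space M. (walk t d j \<omega> \<in> A \<and> (\<forall>i<j. walk t d i \<omega> \<notin> A)) \<and> walk t d n \<omega> - walk t d j \<omega> \<in> B} =
    {\<omega>\<in>space M. walk t d j \<omega> \<in> A \<and> (\<forall>i<j. walk t d i \<omega> \<notin> A)} \<inter> {\<omega>\<in>space M. walk t d n \<omega> - walk t d j \<omega> \<in> B}"
    by blast
  with indep_var_prob_Int[OF ind[folded R1_def R2_def] C1 C2, unfolded e1 e2] show ?thesis by (simp only:)
qed

text \<open>Sum over the first hitting step: these events are disjoint, and each factorises. The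
  tail bound for the remaining steps is enlarged to the whole horizon \<open>n * d\<close>, so that
  it comes out of the sum.\<close>

lemma walk_first_hit_then_move:
  assumes t: "0 \<le> t" "0 \<le> d" and r: "0 < r" and A[measurable]: "A \<in> sets borel"
  shows "\<P>(\<omega> in M. \<exists>j\<le>n. (walk t d j \<omega> \<in> A \<and> (\<forall>i<j. walk t d i \<omega> \<notin> A)) \<and> r \<le> \<bar>walk t d n \<omega> - walk t d j \<omega>\<bar>) \<le>
    \<P>(\<omega> in M. \<exists>j\<le>n. walk t d j \<omega> \<in> A) * (tail_const * (real n * d) * r powr (- \<alpha>))"
proof -
  note [measurable] = walk_measurable[OF t]
  let ?p = "tail_const * (real n * d) * r powr (- \<alpha>)"
  let ?H = "\<lambda>j. {\<omega>\<in>space M. walk t d j \<omega> \<in> A \<and> (\<forall>i<j. walk t d i \<omega> \<notin> A)}"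
  let ?G = "\<lambda>j. {\<omega>\<in>space M. (walk t d j \<omega> \<in> A \<and> (\<forall>i<j. walk t d i \<omega> \<notin> A)) \<and> walk t d n \<omega> - walk t d j \<omega> \<in> {x. r \<le> \<bar>x\<bar>}}"
  have [measurable]: "?H j \<in> events" "?G j \<in> events" for j by measurable
  have "\<P>(\<omega> in M. \<exists>j\<le>n. (walk t d j \<omega> \<in> A \<and> (\<forall>i<j. walk t d i \<omega> \<notin> A)) \<and> r \<le> \<bar>walk t d n \<omega> - walk t d j \<omega>\<bar>) =
      prob (\<Union>j\<in>{..n}. ?G j)"
    by (auto intro!: arg_cong[where f=prob])
  also have "\<dots> \<le> (\<Sum>j\<in>{..n}. prob (?G j))"
    by (intro finite_measure_subadditive_finite) auto
  also have "\<dots> \<le> (\<Sum>j\<in>{..n}. prob (?H j) * ?p)"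
  proof (intro sum_mono)
    fix j assume "j \<in> {..n}"
    then have j: "j \<le> n" by simp
    have "prob (?G j) = prob (?H j) * \<P>(\<omega> in M. walk t d n \<omega> - walk t d j \<omega> \<in> {x. r \<le> \<bar>x\<bar>})"
      by (rule walk_past_future_indep[OF t j A]) measurable
    also have "\<dots> \<le> prob (?H j) * ?p"
      using prob_walk_diff_tail[OF t r j] by (intro mult_left_mono) auto
    finally show "prob (?G j) \<le> prob (?H j) * ?p" .
  qed
  also have "\<dots> = (\<Sum>j\<in>{..n}. prob (?H j)) * ?p" by (simp only: sum_distrib_right)
  also have "(\<Sum>j\<in>{..n}. prob (?H j)) = prob (\<Union>j\<in>{..n}. ?H j)"
  proof (rule finite_measure_finite_Union[symmetric])
    show "disjoint_family_on ?H {..n}"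
      unfolding disjoint_family_on_def by (auto dest: linorder_neqE_nat)
  qed auto
  also have "\<dots> \<le> \<P>(\<omega> in M. \<exists>j\<le>n. walk t d j \<omega> \<in> A)"
    by (intro finite_measure_mono) auto
  finally show ?thesis using tail_const_pos t by (simp add: mult_right_mono)
qed

lemma ex_first_hit:
  assumes "\<exists>j\<le>n::nat. P j"
  shows "\<exists>j\<le>n. P j \<and> (\<forall>i<j. \<not> P i)"
  using assms by (metis LeastI Least_le not_less_Least order.trans)

text \<open>A walk that has reached \<open>2 * r\<close> but ends below \<open>r\<close> has moved
  back by at least \<open>r\<close> after its first time there. Ending beyond \<open>r\<close> and
  moving back each cost at most the tail bound.\<close>

lemma walk_maximal:
  assumes t: "0 \<le> t" "0 \<le> d" and r: "0 < r"
  shows "\<P>(\<omega> in M. \<exists>j\<le>n. 2 * r \<le> \<bar>walk t d j \<omega>\<bar>) \<le> 2 * (tail_const * (real n * d) * r powr (- \<alpha>))"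
proof -
  note [measurable] = walk_measurable[OF t]
  let ?p = "tail_const * (real n * d) * r powr (- \<alpha>)"
  let ?A = "{x::real. 2 * r \<le> \<bar>x\<bar>}"
  let ?G = "{\<omega>\<in>space M. \<exists>j\<le>n. (walk t d j \<omega> \<in> ?A \<and> (\<forall>i<j. walk t d i \<omega> \<notin> ?A)) \<and> r \<le> \<bar>walk t d n \<omega> - walk t d j \<omega>\<bar>}"
  let ?F = "{\<omega>\<in>space M. r \<le> \<bar>walk t d n \<omega> - walk t d 0 \<omega>\<bar>}"
  have "{\<omega>\<in>space M. \<exists>j\<le>n. 2 * r \<le> \<bar>walk t d j \<omega>\<bar>} \<subseteq> ?F \<union> ?G"
  proof
    fix \<omega> assume "\<omega> \<in> {\<omega>\<in>space M. \<exists>j\<le>n. 2 * r \<le> \<bar>walk t d j \<omega>\<bar>}"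
    then have \<omega>: "\<omega> \<in> space M" "\<exists>j\<le>n. 2 * r \<le> \<bar>walk t d j \<omega>\<bar>" by auto
    from ex_first_hit[OF this(2)] obtain j where
      j: "j \<le> n" "2 * r \<le> \<bar>walk t d j \<omega>\<bar>" "\<forall>i<j. \<not> 2 * r \<le> \<bar>walk t d i \<omega>\<bar>" by blast
    show "\<omega> \<in> ?F \<union> ?G"
    proof (cases "r \<le> \<bar>walk t d n \<omega>\<bar>")
      case False
      then have "r \<le> \<bar>walk t d n \<omega> - walk t d j \<omega>\<bar>" using j(2) by linarith
      then have "\<omega> \<in> ?G" using \<omega>(1) j by auto
      then show ?thesis by blast
    qed (use \<omega>(1) in auto)
  qed
  then have "\<P>(\<omega> in M. \<exists>j\<le>n. 2 * r \<le> \<bar>walk t d j \<omega>\<bar>) \<le> prob (?F \<union> ?G)"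
    by (intro finite_measure_mono) auto
  also have "\<dots> \<le> prob ?F + prob ?G" by (intro measure_Un_le) auto
  also have "prob ?F \<le> ?p" using prob_walk_diff_tail[OF t r, of 0 n] by simp
  also have "prob ?G \<le> 1 * ?p"
    by (rule order_trans[OF walk_first_hit_then_move[OF t r]], measurable, rule mult_right_mono)
       (use tail_const_pos t in auto)
  finally show ?thesis by (simp add: mult_ac)
qed

text \<open>Two successive moves of size \<open>r\<close> have a probability quadratic in the
  horizon. This is the error term when a single big jump is isolated.\<close>

lemma walk_two_moves:
  assumes t: "0 \<le> t" "0 \<le> d" and r: "0 < r" and A[measurable]: "A \<in> sets borel"
    and far: "\<And>x. x \<in> A \<Longrightarrow> 2 * r \<le> \<bar>x\<bar>"
  shows "\<P>(\<omega> in M. \<exists>j\<le>n. (walk t d j \<omega> \<in> A \<and> (\<forall>i<j. walk t d i \<omega> \<notin> A)) \<and> r \<le> \<bar>walk t d n \<omega> - walk t d j \<omega>\<bar>) \<le>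
    2 * (tail_const * (real n * d) * r powr (- \<alpha>))\<^sup>2"
proof -
  note [measurable] = walk_measurable[OF t]
  let ?p = "tail_const * (real n * d) * r powr (- \<alpha>)"
  have "\<P>(\<omega> in M. \<exists>j\<le>n. walk t d j \<omega> \<in> A) \<le> \<P>(\<omega> in M. \<exists>j\<le>n. 2 * r \<le> \<bar>walk t d j \<omega>\<bar>)"
    using far by (intro finite_measure_mono) auto
  also have "\<dots> \<le> 2 * ?p" by (rule walk_maximal[OF t r])
  finally have "\<P>(\<omega> in M. \<exists>j\<le>n. walk t d j \<omega> \<in> A) * ?p \<le> 2 * ?p * ?p"
    using tail_const_pos t by (intro mult_right_mono) auto
  with walk_first_hit_then_move[OF t r A, of n] show ?thesis by (simp add: power2_eq_square mult_ac)
qed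

lemma prob_walk_interval:
  assumes "p < q"
  shows "\<exists>b>0. \<exists>\<delta>>0. \<forall>t d n. 0 \<le> t \<longrightarrow> 0 \<le> d \<longrightarrow> 0 < real n * d \<longrightarrow> real n * d < \<delta> \<longrightarrow>
    b * (real n * d) \<le> \<P>(\<omega> in M. walk t d n \<omega> \<in> {p<..q})"
proof -
  from stable_law_interval_lower_bound[OF assms] obtain b \<delta> where b: "0 < b" "0 < \<delta>"
    and *: "\<And>t N. 0 < t \<Longrightarrow> t < \<delta> \<Longrightarrow> stable_law t N \<Longrightarrow> b * t \<le> measure N {p<..q}" by blast
  have "b * (real n * d) \<le> \<P>(\<omega> in M. walk t d n \<omega> \<in> {p<..q})"
    if "0 \<le> t" "0 \<le> d" "0 < real n * d" "real n * d < \<delta>" for t d n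
    unfolding walk_def using that prob_increment_eq[of t "real n * d" "{p<..q}"]
      *[OF that(3,4) stable_law_increment[of t "real n * d"]] by simp
  with b show ?thesis by blast
qed

text \<open>On short horizons the linear probability of one jump beats the quadratic probability of
  two moves.\<close>

lemma linear_minus_quadratic:
  fixes b \<delta> C :: real
  assumes "0 < b" "0 < \<delta>" "0 \<le> C"
  shows "\<exists>\<delta>'>0. \<delta>' \<le> \<delta> \<and> (\<forall>T. 0 < T \<longrightarrow> T < \<delta>' \<longrightarrow> b / 2 * T \<le> b * T - C * T\<^sup>2)"
proof (intro exI[of _ "min \<delta> (b / (2 * (C + 1)))"] conjI allI impI)
  fix T assume T: "0 < T" "T < min \<delta> (b / (2 * (C + 1)))"
  then have "(C + 1) * T \<le> b / 2" using assms by (simp add: field_simps)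
  then have "C * T \<le> b / 2" using T by (simp add: algebra_simps)
  then have "C * T * T \<le> b / 2 * T" using T by (intro mult_right_mono) auto
  then show "b / 2 * T \<le> b * T - C * T\<^sup>2" by (simp add: power2_eq_square algebra_simps)
qed (use assms in auto)

text \<open>A walk that ends in \<open>{25/10<..35/10}\<close> either jumps there almost directly,
  from within 1/10 of 0 into the slightly larger interval, or moves again by at least 1/20 after
  first leaving the neighbourhood of 0. The margin to \<open>(2, 4)\<close> leaves room for a
  displacement before the walk starts.\<close>

lemma walk_jump_landing:
  "\<exists>b>0. \<exists>\<delta>>0. \<forall>t d n. 0 \<le> t \<longrightarrow> 0 \<le> d \<longrightarrow> 0 < real n * d \<longrightarrow> real n * d < \<delta> \<longrightarrow>
    b * (real n * d) \<le>
      \<P>(\<omega> in M. \<exists>k<n. (\<forall>i\<le>k. \<bar>walk t d i \<omega>\<bar> < 1/10) \<and> 22/10 \<le> walk t d (Suc k) \<omega> \<and> walk t d (Suc k) \<omega> \<le> 38/10)"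
proof -
  obtain b \<delta> where b: "0 < b" "0 < \<delta>" and *: "\<And>t d n. 0 \<le> t \<Longrightarrow> 0 \<le> d \<Longrightarrow> 0 < real n * d \<Longrightarrow> real n * d < \<delta> \<Longrightarrow>
    b * (real n * d) \<le> \<P>(\<omega> in M. walk t d n \<omega> \<in> {25/10<..35/10})"
    using prob_walk_interval[of "25/10" "35/10"] by auto
  \<comment> \<open>1/20 is half of 1/10: \<open>walk_two_moves\<close> needs hits at distance at
    least \<open>2 * r\<close>.\<close>
  define C where "C = 2 * (tail_const * (1/20) powr (- \<alpha>))\<^sup>2"
  obtain \<delta>' where \<delta>': "0 < \<delta>'" "\<delta>' \<le> \<delta>" "\<And>T. 0 < T \<Longrightarrow> T < \<delta>' \<Longrightarrow> b / 2 * T \<le> b * T - C * T\<^sup>2"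
    using linear_minus_quadratic[OF b, of C] by (auto simp: C_def)
  have "b / 2 * (real n * d) \<le>
      \<P>(\<omega> in M. \<exists>k<n. (\<forall>i\<le>k. \<bar>walk t d i \<omega>\<bar> < 1/10) \<and> 22/10 \<le> walk t d (Suc k) \<omega> \<and> walk t d (Suc k) \<omega> \<le> 38/10)"
    (is "_ \<le> prob ?L") if t: "0 \<le> t" "0 \<le> d" and T: "0 < real n * d" "real n * d < \<delta>'" for t d n
  proof -
    note [measurable] = walk_measurable[OF t]
    let ?A = "{x::real. 1/10 \<le> \<bar>x\<bar>}"
    let ?G = "{\<omega>\<in>space M. \<exists>j\<le>n. (walk t d j \<omega> \<in> ?A \<and> (\<forall>i<j. walk t d i \<omega> \<notin> ?A)) \<and> 1/20 \<le> \<bar>walk t d n \<omega> - walk t d j \<omega>\<bar>}"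
    let ?J = "{\<omega>\<in>space M. walk t d n \<omega> \<in> {25/10<..35/10}}"
    have "?J \<subseteq> ?L \<union> ?G"
    proof
      fix \<omega> assume \<omega>: "\<omega> \<in> ?J"
      then have "\<exists>j\<le>n. walk t d j \<omega> \<in> ?A" by (intro exI[of _ n]) auto
      from ex_first_hit[OF this] obtain j where j: "j \<le> n" "walk t d j \<omega> \<in> ?A" "\<forall>i<j. walk t d i \<omega> \<notin> ?A" by blast
      show "\<omega> \<in> ?L \<union> ?G"
      proof (cases "22/10 \<le> walk t d j \<omega> \<and> walk t d j \<omega> \<le> 38/10")
        case True
        have "j \<noteq> 0" using j(2) by (auto intro!: gr0I)
        then obtain k where k: "j = Suc k" by (cases j) auto
        have "\<forall>i\<le>k. \<bar>walk t d i \<omega>\<bar> < 1/10" using j(3) k by (auto simp: not_le)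
        then have "\<exists>k<n. (\<forall>i\<le>k. \<bar>walk t d i \<omega>\<bar> < 1/10) \<and> 22/10 \<le> walk t d (Suc k) \<omega> \<and> walk t d (Suc k) \<omega> \<le> 38/10"
          using True j(1) k by (intro exI[of _ k]) simp
        then have "\<omega> \<in> ?L" using \<omega> by blast
        then show ?thesis by blast
      next
        case False
        then have "1/20 \<le> \<bar>walk t d n \<omega> - walk t d j \<omega>\<bar>" using \<omega> by auto
        then have "\<omega> \<in> ?G" using \<omega> j by blast
        then show ?thesis by blast
      qed
    qed
    then have "prob ?J \<le> prob (?L \<union> ?G)" by (intro finite_measure_mono) auto
    also have "\<dots> \<le> prob ?L + prob ?G" by (intro measure_Un_le) auto
    finally have "prob ?J - prob ?G \<le> prob ?L" by simp
    moreover have "b * (real n * d) \<le> prob ?J" using T \<delta>'(2) by (intro *[OF t]) auto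
    moreover have "prob ?G \<le> C * (real n * d)\<^sup>2"
      using walk_two_moves[OF t, of "1/20" ?A n] by (simp add: C_def power_mult_distrib mult_ac)
    ultimately show ?thesis using \<delta>'(3)[OF T] by linarith
  qed
  with b \<delta>'(1) show ?thesis by (intro exI[of _ "b/2"] conjI exI[of _ \<delta>']) auto
qed

text \<open>Meant for the second coordinate started at 1/2, so \<open>walk + 1/2\<close> is a
  position. A position of modulus 9/10 needs a displacement of at least 2/5 and, as
  \<open>\<eta> \<le> 1/10\<close>, a further move of at least 4/5 to end near 0: two moves of size
  1/5 at least.\<close>

lemma walk_reaches_interval:
  assumes \<eta>: "0 < \<eta>" "\<eta> \<le> 1/10"
  shows "\<exists>b>0. \<exists>\<delta>>0. \<forall>t d n. 0 \<le> t \<longrightarrow> 0 \<le> d \<longrightarrow> 0 < real n * d \<longrightarrow> real n * d < \<delta> \<longrightarrow>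
    b * (real n * d) \<le> \<P>(\<omega> in M. \<bar>walk t d n \<omega> + 1/2\<bar> \<le> \<eta> \<and> (\<forall>i\<le>n. \<bar>walk t d i \<omega> + 1/2\<bar> < 9/10))"
proof -
  obtain b \<delta> where b: "0 < b" "0 < \<delta>" and *: "\<And>t d n. 0 \<le> t \<Longrightarrow> 0 \<le> d \<Longrightarrow> 0 < real n * d \<Longrightarrow> real n * d < \<delta> \<Longrightarrow>
    b * (real n * d) \<le> \<P>(\<omega> in M. walk t d n \<omega> \<in> {- 1/2 - \<eta><..- 1/2 + \<eta>})"
    using prob_walk_interval[of "- 1/2 - \<eta>" "- 1/2 + \<eta>"] \<eta> by auto
  define C where "C = 2 * (tail_const * (1/5) powr (- \<alpha>))\<^sup>2"
  obtain \<delta>' where \<delta>': "0 < \<delta>'" "\<delta>' \<le> \<delta>" "\<And>T. 0 < T \<Longrightarrow> T < \<delta>' \<Longrightarrow> b / 2 * T \<le> b * T - C * T\<^sup>2"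
    using linear_minus_quadratic[OF b, of C] by (auto simp: C_def)
  have "b / 2 * (real n * d) \<le> \<P>(\<omega> in M. \<bar>walk t d n \<omega> + 1/2\<bar> \<le> \<eta> \<and> (\<forall>i\<le>n. \<bar>walk t d i \<omega> + 1/2\<bar> < 9/10))"
    (is "_ \<le> prob ?L") if t: "0 \<le> t" "0 \<le> d" and T: "0 < real n * d" "real n * d < \<delta>'" for t d n
  proof -
    note [measurable] = walk_measurable[OF t]
    let ?A = "{x::real. 9/10 \<le> \<bar>x + 1/2\<bar>}"
    let ?G = "{\<omega>\<in>space M. \<exists>j\<le>n. (walk t d j \<omega> \<in> ?A \<and> (\<forall>i<j. walk t d i \<omega> \<notin> ?A)) \<and> 1/5 \<le> \<bar>walk t d n \<omega> - walk t d j \<omega>\<bar>}"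
    let ?J = "{\<omega>\<in>space M. walk t d n \<omega> \<in> {- 1/2 - \<eta><..- 1/2 + \<eta>}}"
    have "?J \<subseteq> ?L \<union> ?G"
    proof
      fix \<omega> assume \<omega>: "\<omega> \<in> ?J"
      show "\<omega> \<in> ?L \<union> ?G"
      proof (cases "\<exists>j\<le>n. walk t d j \<omega> \<in> ?A")
        case True
        from ex_first_hit[OF this] obtain j where j: "j \<le> n" "walk t d j \<omega> \<in> ?A" "\<forall>i<j. walk t d i \<omega> \<notin> ?A" by blast
        have "9/10 \<le> \<bar>walk t d j \<omega> + 1/2\<bar>" using j(2) by simp
        moreover have "- 1/2 - \<eta> < walk t d n \<omega>" "walk t d n \<omega> \<le> - 1/2 + \<eta>" using \<omega> by auto
        ultimately have "1/5 \<le> \<bar>walk t d n \<omega> - walk t d j \<omega>\<bar>" using \<eta> by linarith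
        then have "\<omega> \<in> ?G" using \<omega> j by blast
        then show ?thesis by blast
      next
        case False
        have "\<forall>i\<le>n. \<bar>walk t d i \<omega> + 1/2\<bar> < 9/10"
        proof (intro allI impI)
          fix i assume "i \<le> n"
          then have "walk t d i \<omega> \<notin> ?A" using False by blast
          then show "\<bar>walk t d i \<omega> + 1/2\<bar> < 9/10" by simp
        qed
        moreover have "\<bar>walk t d n \<omega> + 1/2\<bar> \<le> \<eta>" using \<omega> by (auto simp: abs_le_iff)
        ultimately have "\<omega> \<in> ?L" using \<omega> by blast
        then show ?thesis by blast
      qed
    qed
    then have "prob ?J \<le> prob (?L \<union> ?G)" by (intro finite_measure_mono) auto
    also have "\<dots> \<le> prob ?L + prob ?G" by (intro measure_Un_le) auto
    finally have "prob ?J - prob ?G \<le> prob ?L" by simp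
    moreover have "b * (real n * d) \<le> prob ?J" using T \<delta>'(2) by (intro *[OF t]) auto
    moreover have "prob ?G \<le> C * (real n * d)\<^sup>2"
    proof -
      have "2 * (1/5) \<le> \<bar>x\<bar>" if "x \<in> ?A" for x
      proof -
        have "9/10 \<le> \<bar>x + 1/2\<bar>" using that by simp
        then show ?thesis by linarith
      qed
      from walk_two_moves[of t d "1/5" ?A n, OF t _ _ this] show ?thesis by (simp add: C_def power_mult_distrib mult_ac)
    qed
    ultimately show ?thesis using \<delta>'(3)[OF T] by linarith
  qed
  with b \<delta>'(1) show ?thesis by (intro exI[of _ "b/2"] conjI exI[of _ \<delta>']) auto
qed

end

section \<open>Exit of a path from the unit ball\<close>

text \<open>The supremum of the norm over the rational times in \<open>[0, q]\<close> is exactly 1: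
  the path reaches or approaches the sphere without crossing it. Rational times and the margins
  \<open>1 / Suc m\<close> make this a countable, hence measurable, condition.\<close>

definition touches_sphere :: "real \<Rightarrow> (real \<Rightarrow> 'a::real_normed_vector) \<Rightarrow> bool" where
  "touches_sphere q v \<longleftrightarrow> (\<forall>s\<in>\<rat> \<inter> {0..q}. norm (v s) \<le> 1) \<and>
     (\<forall>m::nat. \<exists>s\<in>\<rat> \<inter> {0..q}. 1 - 1 / real (Suc m) < norm (v s))"

text \<open>Infinitely many meshes: this is an upper limit of events, so a lower bound that holds
  for each mesh survives the passage to the limit.\<close>

definition grid_exits :: "real \<Rightarrow> 'a set \<Rightarrow> (real \<Rightarrow> 'a::real_normed_vector) \<Rightarrow> bool" where
  "grid_exits T K v \<longleftrightarrow> (\<forall>N. \<exists>n\<ge>N. \<exists>k<n. (\<forall>j\<le>k. norm (v (real j * T / real n)) < 1) \<and>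
     v (real (Suc k) * T / real n) \<in> K)"

definition right_continuous :: "(real \<Rightarrow> 'a::topological_space) \<Rightarrow> bool" where
  "right_continuous v \<longleftrightarrow> (\<forall>t\<ge>0. continuous (at_right t) v)"

text \<open>The exit time of the canonical process, so that statements about a single path need no
  probability space.\<close>

definition path_exit_time :: "'a set \<Rightarrow> (real \<Rightarrow> 'a) \<Rightarrow> ereal" where
  "path_exit_time D v = exit_time (\<lambda>t v. v t) D v"

lemma exit_time_eq_path_exit_time: "exit_time W D \<omega> = path_exit_time D (\<lambda>t. W t \<omega>)"
  by (simp add: path_exit_time_def exit_time_def)

lemma right_continuousD:
  assumes "right_continuous v" "0 \<le> t" "open U" "v t \<in> U"
  obtains d where "0 < d" "\<And>s. t \<le> s \<Longrightarrow> s < t + d \<Longrightarrow> v s \<in> U"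
proof -
  have "(v \<longlongrightarrow> v t) (at_right t)"
    using assms by (auto simp: right_continuous_def continuous_within)
  then have "eventually (\<lambda>s. v s \<in> U) (at_right t)" using assms by (rule_tac topological_tendstoD)
  then obtain b where b: "t < b" "\<forall>s>t. s < b \<longrightarrow> v s \<in> U"
    using eventually_at_right[of t "t + 1"] by auto
  then show ?thesis
    by (intro that[of "b - t"]) (use assms(4) in \<open>auto simp: le_less\<close>)
qed

lemma path_exit_time_attained:
  assumes rc: "right_continuous v" and D: "open D" and ex: "0 \<le> t0" "v t0 \<notin> D"
  obtains \<tau> where "0 \<le> \<tau>" "\<tau> \<le> t0" "path_exit_time D v = ereal \<tau>" "v \<tau> \<notin> D"
    "\<And>s. 0 \<le> s \<Longrightarrow> s < \<tau> \<Longrightarrow> v s \<in> D"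
proof -
  define S where "S = {t. 0 \<le> t \<and> v t \<notin> D}"
  have S: "t0 \<in> S" "bdd_below S" using ex by (auto simp: S_def intro!: bdd_belowI[of _ 0])
  define \<tau> where "\<tau> = Inf S"
  have \<tau>0: "0 \<le> \<tau>" unfolding \<tau>_def using S(1) by (intro cInf_greatest) (auto simp: S_def)
  have \<tau>t: "\<tau> \<le> t" if "t \<in> S" for t unfolding \<tau>_def using that S(2) by (rule cInf_lower)
  have v\<tau>: "v \<tau> \<notin> D"
  proof
    assume "v \<tau> \<in> D"
    then obtain d where d: "0 < d" "\<And>s. \<tau> \<le> s \<Longrightarrow> s < \<tau> + d \<Longrightarrow> v s \<in> D"
      using right_continuousD[OF rc \<tau>0 D] by blast
    have "\<tau> + d \<le> Inf S"
    proof (rule cInf_greatest)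
      fix t assume t: "t \<in> S"
      then have "v t \<notin> D" by (simp add: S_def)
      then show "\<tau> + d \<le> t" using d(2)[of t] \<tau>t[OF t] by fastforce
    qed (use S in auto)
    then show False using d(1) by (simp add: \<tau>_def)
  qed
  have "path_exit_time D v = ereal \<tau>"
  proof (rule antisym)
    show "path_exit_time D v \<le> ereal \<tau>"
      unfolding path_exit_time_def exit_time_def using \<tau>0 v\<tau> by (intro INF_lower2[of \<tau>]) auto
    show "ereal \<tau> \<le> path_exit_time D v"
      unfolding path_exit_time_def exit_time_def using \<tau>t by (intro INF_greatest) (auto simp: S_def)
  qed
  moreover have "v s \<in> D" if "0 \<le> s" "s < \<tau>" for s
    using \<tau>t[of s] that by (auto simp: S_def)
  ultimately show ?thesis using that \<tau>0 \<tau>t[OF S(1)] v\<tau> by blast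
qed

lemma path_exit_time_cases:
  assumes rc: "right_continuous v" and D: "open D"
  obtains (never) "path_exit_time D v = \<infinity>" "\<And>t. 0 \<le> t \<Longrightarrow> v t \<in> D"
  | (exits) \<tau> where "0 \<le> \<tau>" "path_exit_time D v = ereal \<tau>" "v \<tau> \<notin> D" "\<And>s. 0 \<le> s \<Longrightarrow> s < \<tau> \<Longrightarrow> v s \<in> D"
proof (cases "\<exists>t0\<ge>0. v t0 \<notin> D")
  case True
  then show ?thesis using path_exit_time_attained[OF rc D] exits by metis
next
  case False
  then have "{t. 0 \<le> t \<and> v t \<notin> D} = {}" by auto
  then have "path_exit_time D v = \<infinity>" unfolding path_exit_time_def exit_time_def
    by (simp only: image_empty Inf_empty top_ereal_def)
  then show ?thesis using False never by blast
qed

lemma norm_le_1_of_rationals: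
  fixes v :: "real \<Rightarrow> 'a::real_normed_vector"
  assumes rc: "right_continuous v" and le: "\<And>s. s \<in> \<rat> \<Longrightarrow> 0 \<le> s \<Longrightarrow> s < u \<Longrightarrow> norm (v s) \<le> 1"
    and s: "0 \<le> s" "s < u"
  shows "norm (v s) \<le> 1"
proof (rule ccontr)
  assume "\<not> norm (v s) \<le> 1"
  then have mem: "v s \<in> {x. 1 < norm x}" by simp
  have op: "open {x::'a. 1 < norm x}" by (intro open_Collect_less continuous_intros)
  obtain d where d: "0 < d" "\<And>r. s \<le> r \<Longrightarrow> r < s + d \<Longrightarrow> v r \<in> {x. 1 < norm x}"
    using right_continuousD[OF rc s(1) op mem] by blast
  obtain r where r: "r \<in> \<rat>" "s < r" "r < min u (s + d)"
    using Rats_dense_in_real[of s "min u (s + d)"] s d by auto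
  then show False using d(2)[of r] le[of r] s by auto
qed

text \<open>Right continuity carries the norm at \<tau> over to nearby rational times, which are all
  that \<open>touches_sphere\<close> inspects.\<close>

lemma touches_sphereI:
  fixes v :: "real \<Rightarrow> 'a::real_normed_vector"
  assumes rc: "right_continuous v" and \<tau>: "0 \<le> \<tau>" "\<tau> < u" "1 \<le> norm (v \<tau>)"
    and le: "\<And>s. 0 \<le> s \<Longrightarrow> s < u \<Longrightarrow> norm (v s) \<le> 1"
  shows "\<exists>q\<in>\<rat>. 0 < q \<and> touches_sphere q v"
proof -
  obtain q where q: "q \<in> \<rat>" "\<tau> < q" "q < u" using Rats_dense_in_real[OF \<tau>(2)] by auto
  have "\<exists>s\<in>\<rat> \<inter> {0..q}. 1 - 1 / real (Suc m) < norm (v s)" for m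
  proof -
    have "0 < 1 / real (Suc m)" by simp
    then have "1 - 1 / real (Suc m) < norm (v \<tau>)" using \<tau>(3) by linarith
    then have mem: "v \<tau> \<in> {x. 1 - 1 / real (Suc m) < norm x}" by (simp only: mem_Collect_eq)
    have op: "open {x::'a. 1 - 1 / real (Suc m) < norm x}" by (intro open_Collect_less continuous_intros)
    obtain d where d: "0 < d" "\<And>r. \<tau> \<le> r \<Longrightarrow> r < \<tau> + d \<Longrightarrow> v r \<in> {x. 1 - 1 / real (Suc m) < norm x}"
      using right_continuousD[OF rc \<tau>(1) op mem] by blast
    obtain r where r: "r \<in> \<rat>" "\<tau> < r" "r < min q (\<tau> + d)"
      using Rats_dense_in_real[of \<tau> "min q (\<tau> + d)"] q d by auto
    then show ?thesis using d(2)[of r] \<tau>(1) by (intro bexI[of _ r]) auto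
  qed
  then have "touches_sphere q v" using q le by (auto simp: touches_sphere_def)
  then show ?thesis using q \<tau> by (intro bexI[of _ q]) auto
qed

lemma grid_point:
  fixes s T :: real
  assumes "0 < T" "0 < n" "0 \<le> s"
  shows "s \<le> real (nat \<lceil>s * real n / T\<rceil>) * T / real n" "real (nat \<lceil>s * real n / T\<rceil>) * T / real n < s + T / real n"
proof -
  have nn: "0 \<le> s * real n / T" using assms by simp
  define c where "c = real (nat \<lceil>s * real n / T\<rceil>)"
  have "c = of_int \<lceil>s * real n / T\<rceil>" using nn by (simp add: c_def)
  then have "s * real n / T \<le> c" "c < s * real n / T + 1" by linarith+
  then have "s * real n \<le> c * T" "c * T < s * real n + T"
    using assms by (simp_all add: field_simps)
  then show "s \<le> real (nat \<lceil>s * real n / T\<rceil>) * T / real n" "real (nat \<lceil>s * real n / T\<rceil>) * T / real n < s + T / real n"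
    unfolding c_def[symmetric] using assms by (simp_all add: field_simps)
qed

lemma eventually_mesh_small:
  fixes d T :: real
  assumes "0 < d"
  shows "\<exists>N>0. \<forall>n\<ge>N. T / real n < d"
proof -
  obtain N :: nat where N: "\<bar>T\<bar> / d < real N" using reals_Archimedean2 by blast
  have "T / real n < d" if "Suc N \<le> n" for n
  proof -
    have "\<bar>T\<bar> / d < real n" using N that by linarith
    then have "\<bar>T\<bar> < d * real n" using assms by (simp add: field_simps)
    then have "T < d * real n" by linarith
    then show ?thesis using that by (simp add: field_simps)
  qed
  then show ?thesis by blast
qed

text \<open>The first grid point at or after \<tau> is less than one mesh away, where right
  continuity keeps the path in \<open>K\<close>; all earlier grid points precede \<tau>.\<close>

lemma grid_exitsI:
  fixes v :: "real \<Rightarrow> 'a::real_normed_vector"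
  assumes rc: "right_continuous v" and v0: "norm (v 0) < 1"
    and \<tau>: "path_exit_time (ball 0 1) v = ereal \<tau>" "\<tau> \<le> T" "v \<tau> \<in> interior K"
  shows "grid_exits T K v"
proof -
  have *: "0 \<le> \<tau> \<and> (\<forall>s. 0 \<le> s \<longrightarrow> s < \<tau> \<longrightarrow> norm (v s) < 1) \<and> v \<tau> \<notin> ball 0 1"
  proof (cases rule: path_exit_time_cases[OF rc open_ball[of 0 1]])
    case 1
    then show ?thesis using \<tau>(1) by simp
  next
    case (2 \<tau>')
    then have "\<tau>' = \<tau>" using \<tau>(1) by simp
    then show ?thesis using 2 by auto
  qed
  then have \<tau>0: "0 \<le> \<tau>" and out: "v \<tau> \<notin> ball 0 1" by auto
  have before: "norm (v s) < 1" if "0 \<le> s" "s < \<tau>" for s using * that by blast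
  have "0 < \<tau>" using out v0 \<tau>0 by (auto simp: less_le)
  then have T: "0 < T" using \<tau>(2) by simp
  obtain d where d: "0 < d" "\<And>s. \<tau> \<le> s \<Longrightarrow> s < \<tau> + d \<Longrightarrow> v s \<in> interior K"
    using right_continuousD[OF rc \<tau>0 open_interior \<tau>(3)] by blast
  obtain N0 where N0: "0 < N0" "\<And>n. N0 \<le> n \<Longrightarrow> T / real n < d" using eventually_mesh_small[OF d(1)] by blast
  show ?thesis unfolding grid_exits_def
  proof
    fix N
    define n where "n = max N N0"
    have n: "N \<le> n" "0 < n" "T / real n < d" using N0 by (auto simp: n_def)
    define c where "c = nat \<lceil>\<tau> * real n / T\<rceil>"
    have c: "\<tau> \<le> real c * T / real n" "real c * T / real n < \<tau> + T / real n"
      using grid_point[OF T n(2) \<tau>0] by (simp_all add: c_def)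
    have "c \<noteq> 0" using c(1) \<open>0 < \<tau>\<close> by (intro notI) simp
    then obtain k where k: "c = Suc k" by (cases c) auto
    have "\<lceil>\<tau> * real n / T\<rceil> \<le> int n" using \<tau>(2) T n(2) by (simp add: ceiling_le_iff field_simps)
    then have "k < n" using k by (simp add: c_def) 
    moreover have "norm (v (real j * T / real n)) < 1" if "j \<le> k" for j
    proof (rule before)
      have "real j * T / real n \<le> real k * T / real n" using that T by (intro divide_right_mono mult_right_mono) auto
      also have "\<dots> = real c * T / real n - T / real n" by (simp add: k distrib_right add_divide_distrib)
      finally show "real j * T / real n < \<tau>" using c(2) by linarith
    qed (use T in auto)
    moreover have "v (real (Suc k) * T / real n) \<in> K"
      using d(2)[of "real c * T / real n"] c n(3) interior_subset by (auto simp: k)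
    ultimately show "\<exists>n\<ge>N. \<exists>k<n. (\<forall>j\<le>k. norm (v (real j * T / real n)) < 1) \<and> v (real (Suc k) * T / real n) \<in> K"
      using n(1) by blast
  qed
qed

text \<open>Suppose the exit position is not in \<open>K\<close>. As \<open>K\<close> is closed, the
  path avoids it for a time \<open>d\<close> after \<tau>. A grid path that lands in
  \<open>K\<close> does so later and has its earlier grid points, including those in
  \<open>[\<tau>, \<tau> + d)\<close>, inside the ball. Refining the grid, the norm is at most 1
  before \<open>\<tau> + d\<close>, so the path touches the sphere, which is excluded.\<close>

lemma grid_exitsD:
  fixes v :: "real \<Rightarrow> 'a::real_normed_vector"
  assumes rc: "right_continuous v" and T: "0 \<le> T" and K: "closed K" "K \<inter> ball 0 1 = {}"
    and nt: "\<And>q. q \<in> \<rat> \<Longrightarrow> 0 < q \<Longrightarrow> \<not> touches_sphere q v" and g: "grid_exits T K v"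
  obtains \<tau> where "0 \<le> \<tau>" "\<tau> \<le> T" "path_exit_time (ball 0 1) v = ereal \<tau>" "v \<tau> \<in> K"
proof -
  have grid: "\<exists>n\<ge>N. \<exists>k<n. (\<forall>j\<le>k. norm (v (real j * T / real n)) < 1) \<and> v (real (Suc k) * T / real n) \<in> K" for N
    using g by (simp add: grid_exits_def)
  have leT: "real (Suc k) * T / real n \<le> T" if "k < n" for k n
    using that T by (simp add: divide_le_eq mult.commute mult_left_mono)
  obtain n k where "k < n" "v (real (Suc k) * T / real n) \<in> K" using grid[of 0] by blast
  moreover from this have "v (real (Suc k) * T / real n) \<notin> ball 0 1" using K(2) by blast
  ultimately obtain \<tau> where \<tau>: "0 \<le> \<tau>" "\<tau> \<le> real (Suc k) * T / real n" "path_exit_time (ball 0 1) v = ereal \<tau>" "v \<tau> \<notin> ball 0 1"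
    and before: "\<And>s. 0 \<le> s \<Longrightarrow> s < \<tau> \<Longrightarrow> v s \<in> ball 0 1"
    using path_exit_time_attained[OF rc open_ball, of "real (Suc k) * T / real n" 0 1] T by (metis divide_nonneg_nonneg mult_nonneg_nonneg of_nat_0_le_iff)
  have "\<tau> \<le> T" using \<tau>(2) leT[OF \<open>k < n\<close>] by linarith
  have "v \<tau> \<in> K"
  proof (rule ccontr)
    assume "v \<tau> \<notin> K"
    then have mem: "v \<tau> \<in> - K" by simp
    obtain d where d: "0 < d" "\<And>s. \<tau> \<le> s \<Longrightarrow> s < \<tau> + d \<Longrightarrow> v s \<in> - K"
      using right_continuousD[OF rc \<tau>(1) open_Compl[OF K(1)] mem] by blast
    have late: "\<tau> + d \<le> r" if "0 \<le> r" "v r \<in> K" for r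
      using that d(2)[of r] before[of r] K(2) by (metis ComplD IntI empty_iff not_le)
    have "norm (v s) \<le> 1" if s: "0 \<le> s" "s < \<tau> + d" for s
    proof (rule ccontr)
      assume "\<not> norm (v s) \<le> 1"
      then have mem: "v s \<in> {x. 1 < norm x}" by simp
      have op: "open {x::'a. 1 < norm x}" by (intro open_Collect_less continuous_intros)
      obtain e where e: "0 < e" "\<And>r. s \<le> r \<Longrightarrow> r < s + e \<Longrightarrow> v r \<in> {x. 1 < norm x}"
        using right_continuousD[OF rc s(1) op mem] by blast
      obtain N where N: "0 < N" "\<And>n. N \<le> n \<Longrightarrow> T / real n < min e (\<tau> + d - s)"
        using eventually_mesh_small[of "min e (\<tau> + d - s)" T] e(1) s(2) by auto
      obtain n k where n: "N \<le> n" and k: "k < n" "\<And>j. j \<le> k \<Longrightarrow> norm (v (real j * T / real n)) < 1"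
        "v (real (Suc k) * T / real n) \<in> K" using grid[of N] by blast
      have "\<tau> + d \<le> real (Suc k) * T / real n" using k(3) T by (intro late) auto
      then have "0 < real (Suc k) * T / real n" using \<tau>(1) d(1) by linarith
      then have T': "0 < T" using T by (cases "T = 0") auto
      define j where "j = nat \<lceil>s * real n / T\<rceil>"
      have n0: "0 < n" using N(1) n by simp
      have j: "s \<le> real j * T / real n" "real j * T / real n < s + T / real n"
        using grid_point[OF T' n0 s(1)] by (simp_all add: j_def)
      have "real j * T / real n < real (Suc k) * T / real n"
        using j(2) N(2)[OF n] \<open>\<tau> + d \<le> real (Suc k) * T / real n\<close> by simp
      then have "real j * T < real (Suc k) * T" using n0 by (simp add: divide_less_cancel)
      then have "real j < real (Suc k)" using T' by (metis mult_less_cancel_right_pos)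
      then have "j \<le> k" by simp
      from k(2)[OF this] e(2)[OF j(1)] j(2) N(2)[OF n] show False by simp
    qed
    then obtain q where "q \<in> \<rat>" "0 < q" "touches_sphere q v"
      using touches_sphereI[OF rc \<tau>(1), of "\<tau> + d"] d(1) \<tau>(4) by auto
    then show False using nt by blast
  qed
  then show ?thesis using that \<tau>(1,3) \<open>\<tau> \<le> T\<close> by blast
qed

text \<open>Survival up to \<open>t\<close> is read off from countably many times, for
  measurability. \<open>t\<close> is listed separately since it may be irrational.\<close>

lemma path_exit_time_gt_iff:
  fixes v :: "real \<Rightarrow> 'a::real_normed_vector"
  assumes rc: "right_continuous v" and t: "0 \<le> t"
    and nt: "\<And>q. q \<in> \<rat> \<Longrightarrow> 0 < q \<Longrightarrow> \<not> touches_sphere q v"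
  shows "ereal t < path_exit_time (ball 0 1) v \<longleftrightarrow> (\<forall>s\<in>\<rat> \<inter> {0..t}. norm (v s) < 1) \<and> norm (v t) < 1"
proof
  assume gt: "ereal t < path_exit_time (ball 0 1) v"
  have "norm (v s) < 1" if "0 \<le> s" "s \<le> t" for s
  proof (rule ccontr)
    assume "\<not> norm (v s) < 1"
    then obtain \<tau> where "\<tau> \<le> s" "path_exit_time (ball 0 1) v = ereal \<tau>"
      using path_exit_time_attained[OF rc open_ball, of s 0 1] \<open>0 \<le> s\<close> by (metis mem_ball_0)
    then show False using gt \<open>s \<le> t\<close> by simp
  qed
  then show "(\<forall>s\<in>\<rat> \<inter> {0..t}. norm (v s) < 1) \<and> norm (v t) < 1" using t by auto
next
  assume in_ball: "(\<forall>s\<in>\<rat> \<inter> {0..t}. norm (v s) < 1) \<and> norm (v t) < 1"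
  show "ereal t < path_exit_time (ball 0 1) v"
  proof (cases rule: path_exit_time_cases[OF rc open_ball[of 0 1]])
    case (2 \<tau>)
    show ?thesis
    proof (rule ccontr)
      assume "\<not> ereal t < path_exit_time (ball 0 1) v"
      then have "\<tau> \<le> t" using 2 by simp
      moreover have "\<tau> \<noteq> t" using 2(3) in_ball by auto
      ultimately have "\<tau> < t" by simp
      moreover have "norm (v s) \<le> 1" if "0 \<le> s" "s < t" for s
        by (rule norm_le_1_of_rationals[OF rc _ that]) (use in_ball in \<open>auto intro: less_imp_le\<close>)
      ultimately obtain q where "q \<in> \<rat>" "0 < q" "touches_sphere q v"
        using touches_sphereI[OF rc 2(1)] 2(3) by auto
      then show False using nt by blast
    qed
  qed simp
qed

text \<open>By strict convexity of the ball, moving a path along a line makes the supremum of its norm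
  equal to 1 for at most two parameters.\<close>

lemma finite_touches_sphere_line:
  fixes g :: "real \<Rightarrow> 'a::real_inner"
  assumes "e \<noteq> 0"
  shows "finite {a. touches_sphere q (\<lambda>s. a *\<^sub>R e + g s)}" (is "finite ?S")
proof -
  have no3: False if abc: "a < b" "b < c" and S: "a \<in> ?S" "b \<in> ?S" "c \<in> ?S" for a b c
  proof -
    define l where "l = (b - a) / (c - a)"
    \<comment> \<open>The defect of convexity of the squared norm at the convex combination
      \<open>b\<close>. The two outer paths differ by \<open>(c - a) *\<^sub>R e\<close> at every
      time, so the defect does not depend on \<open>s\<close>.\<close>
    define k where "k = l * (1 - l) * (c - a)\<^sup>2 * (norm e)\<^sup>2"
    have l: "0 < l" "l < 1" using abc by (auto simp: l_def field_simps)
    have k: "0 < k" using l abc assms by (simp add: k_def)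
    have "l * (c - a) = b - a" using abc by (simp add: l_def)
    then have b: "b = (1 - l) * a + l * c" by (simp add: algebra_simps)
    have bound: "(norm (b *\<^sub>R e + g s))\<^sup>2 \<le> 1 - k" if "s \<in> \<rat> \<inter> {0..q}" for s
    proof -
      have "norm (a *\<^sub>R e + g s) \<le> 1" "norm (c *\<^sub>R e + g s) \<le> 1"
        using S that by (auto simp: touches_sphere_def)
      then have sq: "(norm (a *\<^sub>R e + g s))\<^sup>2 \<le> 1" "(norm (c *\<^sub>R e + g s))\<^sup>2 \<le> 1"
        by (simp_all add: abs_square_le_1)
      have "(norm (b *\<^sub>R e + g s))\<^sup>2 = (1 - l) * (norm (a *\<^sub>R e + g s))\<^sup>2 + l * (norm (c *\<^sub>R e + g s))\<^sup>2 - k"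
        unfolding power2_norm_eq_inner k_def b
        by (simp add: inner_add_left inner_add_right inner_commute[of "g s" e] power2_eq_square algebra_simps)
      also have "\<dots> \<le> (1 - l) * 1 + l * 1 - k"
        using sq l by (intro diff_right_mono add_mono mult_left_mono) auto
      finally show ?thesis by simp
    qed
    \<comment> \<open>The squared norm is at most \<open>1 - k\<close> at all times but comes within
      \<open>2 / Suc m\<close> of 1.\<close>
    obtain m :: nat where m: "2 / k < real m" using reals_Archimedean2 by blast
    have "\<forall>m::nat. \<exists>s\<in>\<rat> \<inter> {0..q}. 1 - 1 / real (Suc m) < norm (b *\<^sub>R e + g s)"
      using S(2) unfolding touches_sphere_def by blast
    then obtain s where s: "s \<in> \<rat> \<inter> {0..q}" "1 - 1 / real (Suc m) < norm (b *\<^sub>R e + g s)" by blast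
    have "2 / k < real (Suc m)" using m by simp
    then have "2 / real (Suc m) < k" using k by (simp add: field_simps)
    moreover have "(1 - 1 / real (Suc m))\<^sup>2 \<le> (norm (b *\<^sub>R e + g s))\<^sup>2"
      using s(2) by (intro power_mono) auto
    moreover have "1 - 2 / real (Suc m) \<le> (1 - 1 / real (Suc m))\<^sup>2"
      by (simp add: power2_diff)
    ultimately show False using bound[OF s(1)] by linarith
  qed
  show ?thesis
  proof (cases "\<exists>a\<in>?S. \<exists>b\<in>?S. a < b")
    case True
    then obtain a b where ab: "a \<in> ?S" "b \<in> ?S" "a < b" by blast
    have "?S \<subseteq> {a, b}"
    proof
      fix x assume x: "x \<in> ?S"
      show "x \<in> {a, b}"
        using no3[of x a b] no3[of a x b] no3[of a b x] ab x by (metis insertCI linorder_neqE_linordered_idom)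
    qed
    then show ?thesis by (rule finite_subset) simp
  next
    case False
    then have "?S \<subseteq> {SOME a. a \<in> ?S}"
      by (metis (mono_tags, lifting) insertCI linorder_neqE_linordered_idom someI_ex subsetI)
    then show ?thesis by (rule finite_subset) simp
  qed
qed

section \<open>Measurability and time shift of path conditions\<close>

lemma pred_ball_countable:
  assumes "countable I" "\<And>i. i \<in> I \<Longrightarrow> Measurable.pred M (P i)"
  shows "Measurable.pred M (\<lambda>x. \<forall>i\<in>I. P i x)"
  using assms unfolding pred_def by (intro sets.sets_Collect_countable_All') auto

lemma pred_bex_countable:
  assumes "countable I" "\<And>i. i \<in> I \<Longrightarrow> Measurable.pred M (P i)"
  shows "Measurable.pred M (\<lambda>x. \<exists>i\<in>I. P i x)"
  using assms unfolding pred_def by (intro sets.sets_Collect_countable_Ex') auto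

lemma countable_Rats_Int: "countable (\<rat> \<inter> (A :: real set))"
  by (simp add: countable_rat countable_Int1)

lemma pred_touches_sphere:
  fixes v :: "'b \<Rightarrow> real \<Rightarrow> 'a::{real_normed_vector, second_countable_topology}"
  assumes "\<And>s. 0 \<le> s \<Longrightarrow> (\<lambda>x. v x s) \<in> borel_measurable M"
  shows "Measurable.pred M (\<lambda>x. touches_sphere q (v x))"
proof -
  have n: "(\<lambda>x. norm (v x s)) \<in> borel_measurable M" if "s \<in> \<rat> \<inter> {0..q}" for s
    using that by (intro measurable_compose[OF assms borel_measurable_norm]) auto
  show ?thesis
    unfolding touches_sphere_def
    by (intro pred_intros_logic pred_ball_countable pred_bex_countable countable_Rats_Int pred_intros_countable)
       (auto intro!: borel_measurable_pred_less borel_measurable_le borel_measurable_less n simp: pred_def)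
qed

lemma pred_grid_exits:
  fixes v :: "'b \<Rightarrow> real \<Rightarrow> 'a::{real_normed_vector, second_countable_topology}"
  assumes v: "\<And>s. 0 \<le> s \<Longrightarrow> (\<lambda>x. v x s) \<in> borel_measurable M" and T: "0 \<le> T" and K: "K \<in> sets borel"
  shows "Measurable.pred M (\<lambda>x. grid_exits T K (v x))"
proof -
  have n: "Measurable.pred M (\<lambda>x. norm (v x (real j * T / real n)) < 1)" for j n
    using T by (intro borel_measurable_pred_less measurable_compose[OF v borel_measurable_norm]) auto
  have k: "Measurable.pred M (\<lambda>x. v x (real j * T / real n) \<in> K)" for j n
    using T by (intro pred_sets2[OF K] v) auto
  show ?thesis
    unfolding grid_exits_def
    by (intro pred_intros_logic pred_intros_countable n k) simp_all
qed

lemma touches_sphere_cong: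
  "(\<And>s. 0 \<le> s \<Longrightarrow> v s = v' s) \<Longrightarrow> touches_sphere q v = touches_sphere q v'"
  unfolding touches_sphere_def by (intro arg_cong2[where f="(\<and>)"] ball_cong all_cong1 bex_cong refl) auto

text \<open>Near time 0 the norm stays below some \<rho> < 1, so the sphere is approached only after
  a positive time. This leaves the increment over a short initial interval free to be randomised.
  The shift is rational to preserve rational times.\<close>

lemma touches_sphere_shift:
  fixes v :: "real \<Rightarrow> 'a::real_normed_vector"
  assumes rc: "right_continuous v" and v0: "norm (v 0) < 1" and q: "0 < q" and t: "touches_sphere q v"
  shows "\<exists>n::nat. touches_sphere (q - 1 / real (Suc n)) (\<lambda>s. v (1 / real (Suc n) + s))"
proof -
  define \<rho> where "\<rho> = (1 + norm (v 0)) / 2"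
  have \<rho>: "norm (v 0) < \<rho>" "\<rho> < 1" using v0 by (auto simp: \<rho>_def)
  have "open {x::'a. norm x < \<rho>}" by (intro open_Collect_less continuous_intros)
  then obtain d where d: "0 < d" "\<And>s. 0 \<le> s \<Longrightarrow> s < 0 + d \<Longrightarrow> v s \<in> {x. norm x < \<rho>}"
    using right_continuousD[OF rc order_refl] \<rho>(1) by blast
  obtain n :: nat where n: "1 / real (Suc n) < min d q"
    using nat_approx_posE[of "min d q"] d(1) q by (metis min_less_iff_conj)
  obtain M :: nat where M: "1 / real (Suc M) < 1 - \<rho>"
    using nat_approx_posE[of "1 - \<rho>"] \<rho>(2) by auto
  define \<delta> where "\<delta> = 1 / real (Suc n)"
  have \<delta>: "0 < \<delta>" "\<delta> < d" "\<delta> < q" "\<delta> \<in> \<rat>" using n by (auto simp: \<delta>_def)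
  have t1: "norm (v s) \<le> 1" if "s \<in> \<rat> \<inter> {0..q}" for s using t that by (auto simp: touches_sphere_def)
  have t2: "\<exists>s\<in>\<rat> \<inter> {0..q}. 1 - 1 / real (Suc m) < norm (v s)" for m
    using t unfolding touches_sphere_def by blast
  have "touches_sphere (q - \<delta>) (\<lambda>s. v (\<delta> + s))"
    unfolding touches_sphere_def
  proof (intro conjI ballI allI)
    fix s assume "s \<in> \<rat> \<inter> {0..q - \<delta>}"
    then show "norm (v (\<delta> + s)) \<le> 1" using \<delta> by (intro t1) auto
  next
    fix m :: nat
    define m' where "m' = max m M"
    obtain s where s: "s \<in> \<rat> \<inter> {0..q}" "1 - 1 / real (Suc m') < norm (v s)" using t2 by blast
    have "1 / real (Suc m') \<le> 1 / real (Suc m)" "1 / real (Suc m') \<le> 1 / real (Suc M)"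
      by (auto simp: m'_def intro!: divide_left_mono)
    then have s': "1 - 1 / real (Suc m) < norm (v s)" "\<rho> < norm (v s)" using s(2) M by linarith+
    have "d \<le> s" using d(2)[of s] s(1) s'(2) by fastforce
    then show "\<exists>s\<in>\<rat> \<inter> {0..q - \<delta>}. 1 - 1 / real (Suc m) < norm (v (\<delta> + s))"
      using s(1) s'(1) \<delta> by (intro bexI[of _ "s - \<delta>"]) auto
  qed
  then show ?thesis unfolding \<delta>_def by blast
qed

section \<open>Independent stable coordinates\<close>

lemma borel_measurable_vec_lambda:
  fixes f :: "'n::finite \<Rightarrow> 'a \<Rightarrow> real"
  assumes "\<And>i. f i \<in> borel_measurable M"
  shows "(\<lambda>x. \<chi> i. f i x) \<in> borel_measurable M"
proof -
  have "(\<lambda>x. \<Sum>i\<in>UNIV. f i x *\<^sub>R axis i (1::real)) \<in> borel_measurable M"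
    using assms by (intro borel_measurable_sum borel_measurable_scaleR) auto
  also have "(\<lambda>x. \<Sum>i\<in>UNIV. f i x *\<^sub>R axis i (1::real)) = (\<lambda>x. \<chi> i. f i x)"
    by (simp add: fun_eq_iff vec_eq_iff axis_def if_distrib cong: if_cong)
  finally show ?thesis .
qed

text \<open>By Fubini it is enough to treat each frozen value of \<open>Y\<close>; used for
  conditioning on everything but one increment.\<close>

lemma (in prob_space) indep_var_AE_notin:
  assumes ind: "indep_var S X T Y" and A: "A \<in> sets (S \<Otimes>\<^sub>M T)"
    and null: "\<And>y. y \<in> space T \<Longrightarrow> AE \<omega> in M. (X \<omega>, y) \<notin> A"
  shows "AE \<omega> in M. (X \<omega>, Y \<omega>) \<notin> A"
proof -
  have X: "X \<in> measurable M S" and Y: "Y \<in> measurable M T"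
    using ind by (auto dest: indep_var_rv1 indep_var_rv2)
  interpret X: prob_space "distr M S X" using X by (rule prob_space_distr)
  interpret Y: prob_space "distr M T Y" using Y by (rule prob_space_distr)
  interpret XY: pair_prob_space "distr M S X" "distr M T Y" ..
  have eq: "distr M S X \<Otimes>\<^sub>M distr M T Y = distr M (S \<Otimes>\<^sub>M T) (\<lambda>x. (X x, Y x))"
    using ind by (simp add: indep_var_distribution_eq)
  have XY: "(\<lambda>x. (X x, Y x)) \<in> measurable M (S \<Otimes>\<^sub>M T)" using X Y by measurable
  have "emeasure (distr M S X \<Otimes>\<^sub>M distr M T Y) A = (\<integral>\<^sup>+y. emeasure (distr M S X) ((\<lambda>x. (x, y)) -` A) \<partial>distr M T Y)"
    using A by (intro XY.emeasure_pair_measure_alt2) simp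
  also have "\<dots> = (\<integral>\<^sup>+y. 0 \<partial>distr M T Y)"
  proof (rule nn_integral_cong)
    fix y assume "y \<in> space (distr M T Y)"
    then have y: "y \<in> space T" by simp
    have sec: "(\<lambda>x. (x, y)) -` A \<in> sets S" using A by (rule sets_Pair2)
    have "X -` (\<lambda>x. (x, y)) -` A \<inter> space M \<in> null_sets M"
      unfolding AE_iff_null_sets[OF measurable_sets[OF X sec]]
      using null[OF y] by eventually_elim auto
    then show "emeasure (distr M S X) ((\<lambda>x. (x, y)) -` A) = 0"
      using X sec by (simp add: emeasure_distr null_setsD1)
  qed
  finally have "emeasure M ((\<lambda>x. (X x, Y x)) -` A \<inter> space M) = 0"
    unfolding eq using A XY by (simp add: emeasure_distr)
  then have "(\<lambda>x. (X x, Y x)) -` A \<inter> space M \<in> null_sets M"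
    using measurable_sets[OF XY A] by auto
  then show ?thesis by (rule AE_I') auto
qed

locale stable_family =
  fixes \<alpha> \<kappa> :: real and P :: "real^'n \<Rightarrow> 'w measure" and W :: "real \<Rightarrow> 'w \<Rightarrow> real^'n"
  assumes \<alpha>': "0 < \<alpha>" "\<alpha> < 2" and \<kappa>': "0 < \<kappa>" and family: "indep_stable_family \<alpha> \<kappa> P W"
begin

lemma coord_stable: "symmetric_stable_process \<alpha> \<kappa> (P w) (\<lambda>t \<omega>. W t \<omega> $ i - w $ i)"
  using family by (simp add: indep_stable_family_def)

lemma coord_stable_process: "stable_process \<alpha> \<kappa> (P w) (\<lambda>t \<omega>. W t \<omega> $ i - w $ i)"
  using coord_stable symmetric_stable_process_stable_levy[OF \<alpha>' \<kappa>' coord_stable]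
  by (simp add: stable_process_def stable_process_axioms_def symmetric_stable_process_def)

lemma coord_levy: "levy_process (P w) (\<lambda>t \<omega>. W t \<omega> $ i - w $ i)"
  using coord_stable by (simp add: symmetric_stable_process_def)

sublocale stable_levy \<alpha> \<kappa>
  by (rule symmetric_stable_process_stable_levy[OF \<alpha>' \<kappa>' coord_stable])

sublocale P: prob_space "P w" for w
  using coord_levy by (rule levy_process.axioms(1))

lemma coord_measurable: "0 \<le> t \<Longrightarrow> (\<lambda>\<omega>. W t \<omega> $ i) \<in> borel_measurable (P w)"
proof -
  assume "0 \<le> t"
  then have "(\<lambda>\<omega>. (W t \<omega> $ i - w $ i) + w $ i) \<in> borel_measurable (P w)"
    by (intro borel_measurable_add borel_measurable_const levy_process.measurable_X[OF coord_levy])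
  then show ?thesis by simp
qed

lemma W_measurable: "0 \<le> t \<Longrightarrow> W t \<in> borel_measurable (P w)"
  using borel_measurable_vec_lambda[of "\<lambda>i \<omega>. W t \<omega> $ i" "P w"] coord_measurable by (simp only: vec_lambda_eta)

definition path_index :: "real \<Rightarrow> 'n \<times> bool \<Rightarrow> (real \<Rightarrow> real) measure" where
  "path_index t j = PiM (if snd j then {0..} else {0..t}) (\<lambda>_. borel)"

text \<open>The flag \<^term>\<open>True\<close> marks the increments after time \<open>t\<close>, \<^term>\<open>False\<close> those before it.\<close>

definition coord_path :: "real \<Rightarrow> 'n \<times> bool \<Rightarrow> 'w \<Rightarrow> real \<Rightarrow> real" where
  "coord_path t j \<omega> = (if snd j then (\<lambda>s\<in>{0..}. W (t + s) \<omega> $ fst j - W t \<omega> $ fst j)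
     else (\<lambda>s\<in>{0..t}. W s \<omega> $ fst j - W 0 \<omega> $ fst j))"

lemma coord_indep:
  "P.indep_vars w (\<lambda>_. PiM {0..} (\<lambda>_. borel)) (\<lambda>i \<omega>. \<lambda>t\<in>{0..}. W t \<omega> $ i) UNIV"
  using family by (simp add: indep_stable_family_def)

lemma coord_past_future_indep:
  assumes "0 \<le> t"
  shows "P.indep_var w (path_index t (i, False)) (coord_path t (i, False)) (path_index t (i, True)) (coord_path t (i, True))"
  using levy_process.past_future_indep[OF coord_levy assms, of w i]
  by (simp add: path_index_def coord_path_def[abs_def])

lemma coord_path_measurable:
  assumes "0 \<le> t"
  shows "coord_path t j \<in> measurable (P w) (path_index t j)"
  using P.indep_var_rv1[OF coord_past_future_indep[OF assms, of w "fst j"]]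
    P.indep_var_rv2[OF coord_past_future_indep[OF assms, of w "fst j"]]
  by (cases j; cases "snd j") auto

text \<open>Coordinates are independent as whole paths, and within each coordinate past and future
  are independent; combining the two factorisations gives joint independence over all pairs.\<close>

lemma indep_coord_paths:
  assumes t: "0 \<le> t"
  shows "P.indep_vars w (path_index t) (coord_path t) UNIV"
  unfolding P.indep_vars_def2
proof (intro conjI ballI coord_path_measurable[OF t])
  let ?F = "\<lambda>j. {coord_path t j -` A \<inter> space (P w) |A. A \<in> sets (path_index t j)}"
  let ?N = "PiM {0..} (\<lambda>_. borel :: real measure)"
  have F: "?F j \<subseteq> sets (P w)" for j using measurable_sets[OF coord_path_measurable[OF t]] by blast
  have sp: "space (P w) \<in> ?F j" for j
    using measurable_space[OF coord_path_measurable[OF t], of _ w j] by (auto intro!: exI[of _ "space (path_index t j)"])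
  have "P.prob w (\<Inter>j\<in>UNIV. A j) = (\<Prod>j\<in>UNIV. P.prob w (A j))" if "A \<in> Pi UNIV ?F" for A
  proof -
    have "\<forall>j. \<exists>B. B \<in> sets (path_index t j) \<and> A j = coord_path t j -` B \<inter> space (P w)"
    proof
      fix j
      have "A j \<in> ?F j" using that by (rule Pi_mem) simp
      then show "\<exists>B. B \<in> sets (path_index t j) \<and> A j = coord_path t j -` B \<inter> space (P w)" by blast
    qed
    from choice[OF this] obtain B where B: "\<And>j. B j \<in> sets (path_index t j)"
      and A: "\<And>j. A j = coord_path t j -` B j \<inter> space (P w)" by blast
    \<comment> \<open>Past and future increments as functionals of the whole coordinate path, so
      that the independence of coordinates applies to events involving both.\<close>
    define past where "past = (\<lambda>f::real \<Rightarrow> real. \<lambda>s\<in>{0..t}. f s - f 0)"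
    define fut where "fut = (\<lambda>f::real \<Rightarrow> real. \<lambda>s\<in>{0..}. f (t + s) - f t)"
    have [measurable]: "past \<in> measurable ?N (PiM {0..t} (\<lambda>_. borel))" "fut \<in> measurable ?N ?N"
      unfolding past_def fut_def using t
      by (auto intro!: measurable_restrict borel_measurable_diff measurable_component_singleton)
    have [measurable]: "B (i, False) \<in> sets (PiM {0..t} (\<lambda>_. borel))" "B (i, True) \<in> sets ?N" for i
      using B[of "(i, False)"] B[of "(i, True)"] by (auto simp: path_index_def)
    define D where "D i = {f \<in> space ?N. past f \<in> B (i, False) \<and> fut f \<in> B (i, True)}" for i
    have D: "D i \<in> sets ?N" for i unfolding D_def by measurable
    have paths: "coord_path t (i, False) \<omega> = past (\<lambda>s\<in>{0..}. W s \<omega> $ i)" "coord_path t (i, True) \<omega> = fut (\<lambda>s\<in>{0..}. W s \<omega> $ i)" for i \<omega>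
      using t by (auto simp: coord_path_def past_def fut_def fun_eq_iff)
    have pre: "(\<lambda>\<omega>. \<lambda>s\<in>{0..}. W s \<omega> $ i) -` D i \<inter> space (P w) = A (i, False) \<inter> A (i, True)" for i
      by (auto simp: D_def A paths space_PiM)
    have "P.prob w (\<Inter>j\<in>UNIV. A j) = P.prob w (\<Inter>i\<in>UNIV. (\<lambda>\<omega>. \<lambda>s\<in>{0..}. W s \<omega> $ i) -` D i \<inter> space (P w))"
      by (rule arg_cong[where f="P.prob w"]) (unfold pre, auto, metis (full_types))
    also have "\<dots> = (\<Prod>i\<in>UNIV. P.prob w ((\<lambda>\<omega>. \<lambda>s\<in>{0..}. W s \<omega> $ i) -` D i \<inter> space (P w)))"
      by (rule P.indep_varsD[OF coord_indep]) (use D in auto)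
    also have "\<dots> = (\<Prod>i\<in>UNIV. P.prob w (A (i, False)) * P.prob w (A (i, True)))"
      unfolding pre unfolding A
      by (intro prod.cong refl P.indep_var_prob_Int[OF coord_past_future_indep[OF t]] B)
    also have "\<dots> = (\<Prod>i\<in>UNIV. \<Prod>b\<in>UNIV. P.prob w (A (i, b)))"
      by (simp add: UNIV_bool)
    also have "\<dots> = (\<Prod>j\<in>UNIV. P.prob w (A j))"
      by (simp add: prod.cartesian_product UNIV_Times_UNIV[symmetric] del: UNIV_Times_UNIV)
    finally show ?thesis .
  qed
  then show "P.indep_sets w ?F UNIV"
    by (subst P.indep_sets_finite) (use F sp in auto)
qed

lemma W_0: "AE \<omega> in P w. W 0 \<omega> = w"
proof -
  have "AE \<omega> in P w. \<forall>i. W 0 \<omega> $ i - w $ i = 0"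
    using levy_process.start_X[OF coord_levy] by (subst AE_all_countable) auto
  then show ?thesis by eventually_elim (simp add: vec_eq_iff)
qed

lemma AE_cadlag: "AE \<omega> in P w. \<forall>i. cadlag (\<lambda>t. W t \<omega> $ i - w $ i)"
  using levy_process.cadlag_paths[OF coord_levy] by (subst AE_all_countable) auto

lemma AE_right_continuous: "AE \<omega> in P w. right_continuous (\<lambda>t. W t \<omega>)"
  using AE_cadlag
proof eventually_elim
  case (elim \<omega>)
  show ?case
    unfolding right_continuous_def continuous_within
  proof (intro allI impI vec_tendstoI)
    fix t i assume "0 \<le> (t::real)"
    then have "((\<lambda>s. W s \<omega> $ i - w $ i) \<longlongrightarrow> W t \<omega> $ i - w $ i) (at_right t)"
      using elim by (auto simp: cadlag_def continuous_within)
    from tendsto_add[OF this tendsto_const[of "w $ i"]]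
    show "((\<lambda>s. W s \<omega> $ i) \<longlongrightarrow> W t \<omega> $ i) (at_right t)" by simp
  qed
qed

section \<open>Almost no path touches the sphere\<close>

lemma increment_no_atom:
  assumes "0 < \<delta>"
  shows "P.prob w {\<omega> \<in> space (P w). W \<delta> \<omega> $ i - W 0 \<omega> $ i = a} = 0"
proof -
  interpret X: stable_process \<alpha> \<kappa> "P w" "\<lambda>t \<omega>. W t \<omega> $ i - w $ i" by (rule coord_stable_process)
  let ?p = "P.prob w {\<omega> \<in> space (P w). W \<delta> \<omega> $ i - W 0 \<omega> $ i = a}"
  have m: "(\<lambda>\<omega>. W \<delta> \<omega> $ i - W 0 \<omega> $ i) \<in> borel_measurable (P w)"
    using assms by (intro borel_measurable_diff coord_measurable) auto
  have le: "?p \<le> conc_const * \<epsilon> * \<delta> powr (- 1 / \<alpha>)" if "0 < \<epsilon>" for \<epsilon>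
  proof -
    have "?p \<le> \<P>(\<omega> in P w. \<bar>(W (0 + \<delta>) \<omega> $ i - w $ i) - (W 0 \<omega> $ i - w $ i) - a\<bar> \<le> \<epsilon>)"
      using that m by (intro P.finite_measure_mono) auto
    also have "\<dots> \<le> conc_const * \<epsilon> * \<delta> powr (- 1 / \<alpha>)"
      using assms that by (intro X.prob_increment_concentration) auto
    finally show ?thesis .
  qed
  have "((\<lambda>\<epsilon>. conc_const * \<epsilon> * \<delta> powr (- 1 / \<alpha>)) \<longlongrightarrow> conc_const * 0 * \<delta> powr (- 1 / \<alpha>)) (at_right 0)"
    by (intro tendsto_intros)
  then have "?p \<le> conc_const * 0 * \<delta> powr (- 1 / \<alpha>)"
    by (rule tendsto_lowerbound) (rule eventually_mono[OF eventually_at_right_less], erule le, simp)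
  then show ?thesis by (simp add: measure_le_0_iff)
qed

text \<open>Condition on everything but the increment of coordinate \<open>i0\<close> over
  \<open>[0, \<delta>]\<close>. This increment translates the path after \<delta> along one axis;
  only finitely many translations touch the sphere and, as \<delta> > 0, none of them has positive
  probability.\<close>

lemma AE_shifted_not_touches:
  assumes \<delta>: "0 < \<delta>"
  shows "AE \<omega> in P w. \<not> touches_sphere q (\<lambda>s. w + (W (\<delta> + s) \<omega> - W 0 \<omega>))"
proof -
  have \<delta>0: "0 \<le> \<delta>" using \<delta> by simp
  \<comment> \<open>Any fixed coordinate serves.\<close>
  define i0 :: 'n where "i0 = undefined"
  define B where "B = UNIV - {(i0, False)}"
  define L where "L = PiM {(i0, False)} (path_index \<delta>)"
  define U where "U = (\<lambda>\<omega>. \<lambda>j\<in>{(i0, False)}. coord_path \<delta> j \<omega>)"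
  define Y where "Y = (\<lambda>\<omega>. \<lambda>j\<in>B. coord_path \<delta> j \<omega>)"
  define N where "N = PiM B (path_index \<delta>)"
  define c where "c = (\<lambda>f :: 'n \<times> bool \<Rightarrow> real \<Rightarrow> real. \<lambda>s i. w $ i + (if i = i0 then 0 else f (i, False) \<delta>) + f (i, True) s)"
  define g where "g = (\<lambda>f s. (\<chi> i. c f s i) :: real^'n)"
  have ind: "P.indep_var w L U N Y"
    unfolding N_def Y_def L_def U_def by (rule P.indep_var_restrict[OF indep_coord_paths[OF \<delta>0]]) (auto simp: B_def)
  have L: "(\<lambda>f. f (i0, False) \<delta>) \<in> borel_measurable L"
  proof -
    have "(\<lambda>f. f (i0, False)) \<in> measurable L (PiM {0..\<delta>} (\<lambda>_. borel))"
      unfolding L_def using measurable_component_singleton[of "(i0, False)" "{(i0, False)}" "path_index \<delta>"]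
      by (simp add: path_index_def)
    then show ?thesis
      by (rule measurable_compose) (use \<delta>0 in \<open>auto intro!: measurable_component_singleton\<close>)
  qed
  have Nc: "(\<lambda>f. f (i, True) s) \<in> borel_measurable N" if "0 \<le> s" for i s
  proof -
    have "(\<lambda>f. f (i, True)) \<in> measurable N (PiM {0..} (\<lambda>_. borel))"
      unfolding N_def using measurable_component_singleton[of "(i, True)" B "path_index \<delta>"]
      by (simp add: path_index_def B_def)
    then show ?thesis
      by (rule measurable_compose) (use that in \<open>auto intro!: measurable_component_singleton\<close>)
  qed
  have Nc': "(\<lambda>f. f (i, False) \<delta>) \<in> borel_measurable N" if "i \<noteq> i0" for i
  proof -
    have "(\<lambda>f. f (i, False)) \<in> measurable N (PiM {0..\<delta>} (\<lambda>_. borel))"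
      unfolding N_def using measurable_component_singleton[of "(i, False)" B "path_index \<delta>"] that
      by (simp add: path_index_def B_def)
    then show ?thesis
      by (rule measurable_compose) (use \<delta>0 in \<open>auto intro!: measurable_component_singleton\<close>)
  qed
  have g: "(\<lambda>f. g f s) \<in> borel_measurable N" if "0 \<le> s" for s
    unfolding g_def
  proof (rule borel_measurable_vec_lambda)
    fix i
    show "(\<lambda>f. c f s i) \<in> borel_measurable N"
      unfolding c_def using Nc[OF that, of i] Nc'[of i] by (cases "i = i0") auto
  qed
  define S where "S = {z \<in> space (L \<Otimes>\<^sub>M N). touches_sphere q (\<lambda>s. fst z (i0, False) \<delta> *\<^sub>R axis i0 1 + g (snd z) s)}"
  have S: "S \<in> sets (L \<Otimes>\<^sub>M N)"
    unfolding S_def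
  proof (rule predE[OF pred_touches_sphere])
    fix s :: real assume "0 \<le> s"
    note [measurable] = g[OF this] measurable_compose[OF measurable_fst L]
    show "(\<lambda>z. fst z (i0, False) \<delta> *\<^sub>R axis i0 1 + g (snd z) s) \<in> borel_measurable (L \<Otimes>\<^sub>M N)" by measurable
  qed
  have U: "U \<omega> (i0, False) \<delta> = W \<delta> \<omega> $ i0 - W 0 \<omega> $ i0" for \<omega>
    using \<delta>0 by (simp add: U_def coord_path_def)
  have "AE \<omega> in P w. (U \<omega>, Y \<omega>) \<notin> S"
  proof (rule P.indep_var_AE_notin[OF ind S])
    fix y assume y: "y \<in> space N"
    let ?F = "{a. touches_sphere q (\<lambda>s. a *\<^sub>R axis i0 1 + g y s)}"
    have fin: "finite ?F" by (rule finite_touches_sphere_line) simp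
    have "AE \<omega> in P w. \<forall>a\<in>?F. W \<delta> \<omega> $ i0 - W 0 \<omega> $ i0 \<noteq> a"
    proof (intro AE_ball_countable[THEN iffD2] ballI countable_finite fin)
      fix a
      have "{\<omega> \<in> space (P w). W \<delta> \<omega> $ i0 - W 0 \<omega> $ i0 = a} \<in> sets (P w)"
      proof -
        have [measurable]: "(\<lambda>\<omega>. W \<delta> \<omega> $ i0 - W 0 \<omega> $ i0) \<in> borel_measurable (P w)"
          using \<delta>0 by (intro borel_measurable_diff coord_measurable) auto
        show ?thesis by measurable
      qed
      then have "{\<omega> \<in> space (P w). W \<delta> \<omega> $ i0 - W 0 \<omega> $ i0 = a} \<in> null_sets (P w)"
        using increment_no_atom[OF \<delta>] by (intro null_setsI) (simp_all add: P.emeasure_eq_measure)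
      then show "AE \<omega> in P w. W \<delta> \<omega> $ i0 - W 0 \<omega> $ i0 \<noteq> a" by (rule AE_I') auto
    qed
    then show "AE \<omega> in P w. (U \<omega>, y) \<notin> S"
      by eventually_elim (auto simp: S_def U)
  qed
  then have "AE \<omega> in P w. \<not> touches_sphere q (\<lambda>s. U \<omega> (i0, False) \<delta> *\<^sub>R axis i0 1 + g (Y \<omega>) s)"
    using AE_space[of "P w"]
  proof eventually_elim
    case (elim \<omega>)
    have "(U \<omega>, Y \<omega>) \<in> space (L \<Otimes>\<^sub>M N)"
      using measurable_space[OF P.indep_var_rv1[OF ind] elim(2)] measurable_space[OF P.indep_var_rv2[OF ind] elim(2)]
      by (simp add: space_pair_measure)
    then show ?case using elim(1) by (simp add: S_def)
  qed
  moreover have "U \<omega> (i0, False) \<delta> *\<^sub>R axis i0 1 + g (Y \<omega>) s = w + (W (\<delta> + s) \<omega> - W 0 \<omega>)" if "0 \<le> s" for \<omega> s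
    using that \<delta>0 by (simp add: vec_eq_iff U g_def c_def Y_def B_def coord_path_def axis_def)
  then have "touches_sphere q (\<lambda>s. U \<omega> (i0, False) \<delta> *\<^sub>R axis i0 1 + g (Y \<omega>) s) =
      touches_sphere q (\<lambda>s. w + (W (\<delta> + s) \<omega> - W 0 \<omega>))" for \<omega>
    by (rule touches_sphere_cong)
  ultimately show ?thesis by (simp only:)
qed

lemma AE_not_touches:
  assumes w: "norm w < 1"
  shows "AE \<omega> in P w. \<forall>q\<in>\<rat>. 0 < q \<longrightarrow> \<not> touches_sphere q (\<lambda>t. W t \<omega>)"
proof -
  have "AE \<omega> in P w. \<forall>q\<in>\<rat>. \<forall>n::nat. \<not> touches_sphere (q - 1 / real (Suc n)) (\<lambda>s. w + (W (1 / real (Suc n) + s) \<omega> - W 0 \<omega>))"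
    by (intro AE_ball_countable[THEN iffD2] ballI countable_rat AE_all_countable[THEN iffD2] allI AE_shifted_not_touches) simp
  with W_0 AE_right_continuous show ?thesis
  proof eventually_elim
    case (elim \<omega>)
    show ?case
    proof (intro ballI impI notI)
      fix q :: real assume q: "q \<in> \<rat>" "0 < q" "touches_sphere q (\<lambda>t. W t \<omega>)"
      from touches_sphere_shift[OF elim(2) _ q(2,3)] w elim(1) elim(3) q(1) show False by auto
    qed
  qed
qed

end

section \<open>Exit events up to null sets\<close>

text \<open>\<open>G\<close> need not be measurable for \<open>M\<close>: events defined by the exit
  time are handled through measurable events on grids that agree with them almost
  everywhere.\<close>

lemma completion_AE_eq:
  assumes A: "A \<in> sets M" and G: "G \<subseteq> space M" and ae: "AE x in M. x \<in> G \<longleftrightarrow> x \<in> A"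
  shows "G \<in> sets (completion M)" "measure (completion M) G = measure M A"
proof -
  from AE_E[OF ae] obtain N where N: "{x\<in>space M. \<not> (x \<in> G \<longleftrightarrow> x \<in> A)} \<subseteq> N" "emeasure M N = 0" "N \<in> sets M" .
  then have N0: "N \<in> null_sets (completion M)" by (intro null_sets_completionI) auto
  have "A - G \<in> null_sets (completion M)" "G - A \<in> null_sets (completion M)"
    using N(1) G sets.sets_into_space[OF A] by (auto intro!: null_sets_completion_subset[OF _ N0])
  then have "(A - (A - G)) \<union> (G - A) \<in> sets (completion M)"
    by (rule sets.Un[OF sets.Diff[OF sets_completionI_sets[OF A] null_setsD2] null_setsD2])
  also have "(A - (A - G)) \<union> (G - A) = G" by auto
  finally show *: "G \<in> sets (completion M)" .
  have "measure (completion M) G = measure (completion M) A"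
    unfolding measure_def
    by (rule arg_cong[where f=enn2real], rule emeasure_eq_AE) (use AE_completion[OF ae] * A in auto)
  then show "measure (completion M) G = measure M A" using A by simp
qed

text \<open>Closed sets exhausting an open \<open>E\<close>. \<open>grid_exitsD\<close> needs a
  closed target, while \<open>grid_exitsI\<close> needs a point in the interior of the
  target.\<close>

definition inner_set :: "'a::metric_space set \<Rightarrow> nat \<Rightarrow> 'a set" where
  "inner_set E m = {x. 1 / real (Suc m) \<le> infdist x (- E)}"

lemma closed_inner_set: "closed (inner_set E m)"
  unfolding inner_set_def by (intro closed_Collect_le continuous_intros)

lemma inner_set_subset: "inner_set E m \<subseteq> E"
proof
  fix x assume "x \<in> inner_set E m"
  then have "infdist x (- E) \<noteq> 0"
    using zero_less_divide_1_iff[of "real (Suc m)"] by (auto simp: inner_set_def simp del: zero_less_divide_1_iff)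
  then show "x \<in> E" using infdist_zero[of x "- E"] by blast
qed

text \<open>\<open>infdist x {} = 0\<close> by convention, so for \<open>E = UNIV\<close> all inner
  sets would be empty.\<close>

lemma in_interior_inner_set:
  assumes "open E" "x \<in> E" "E \<noteq> UNIV"
  shows "\<exists>m. x \<in> interior (inner_set E m)"
proof -
  have "0 < infdist x (- E)"
    using assms by (intro infdist_pos_not_in_closed) (auto simp: closed_Compl)
  then obtain m where m: "1 / real (Suc m) < infdist x (- E)" using nat_approx_posE by blast
  have "{y. 1 / real (Suc m) < infdist y (- E)} \<subseteq> inner_set E m" by (auto simp: inner_set_def)
  moreover have "open {y. 1 / real (Suc m) < infdist y (- E)}"
    by (intro open_Collect_less continuous_intros)
  ultimately have "x \<in> interior (inner_set E m)" using m by (intro interiorI) auto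
  then show ?thesis ..
qed

definition grid_exits_open :: "real \<Rightarrow> 'a set \<Rightarrow> (real \<Rightarrow> 'a::real_normed_vector) \<Rightarrow> bool" where
  "grid_exits_open T E v \<longleftrightarrow> (\<exists>m. grid_exits T (inner_set E m) v)"

definition exits_into :: "'a::real_normed_vector set \<Rightarrow> (real \<Rightarrow> 'a) \<Rightarrow> bool" where
  "exits_into E v \<longleftrightarrow> path_exit_time (ball 0 1) v < \<infinity> \<and> v (real_of_ereal (path_exit_time (ball 0 1) v)) \<in> E"

definition grid_exits_ever :: "'a set \<Rightarrow> (real \<Rightarrow> 'a::real_normed_vector) \<Rightarrow> bool" where
  "grid_exits_ever E v \<longleftrightarrow> (\<exists>T::nat. grid_exits_open (real T) E v)"

definition good_path :: "(real \<Rightarrow> 'a::real_normed_vector) \<Rightarrow> bool" where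
  "good_path v \<longleftrightarrow> right_continuous v \<and> norm (v 0) < 1 \<and> (\<forall>q\<in>\<rat>. 0 < q \<longrightarrow> \<not> touches_sphere q v)"

lemma exit_by_iff_grid_exits_open:
  assumes v: "good_path v" and E: "open E" "E \<inter> ball 0 1 = {}" and T: "0 \<le> T"
  shows "(\<exists>\<tau>. path_exit_time (ball 0 1) v = ereal \<tau> \<and> \<tau> \<le> T \<and> v \<tau> \<in> E) \<longleftrightarrow> grid_exits_open T E v"
proof
  assume "\<exists>\<tau>. path_exit_time (ball 0 1) v = ereal \<tau> \<and> \<tau> \<le> T \<and> v \<tau> \<in> E"
  then obtain \<tau> where \<tau>: "path_exit_time (ball 0 1) v = ereal \<tau>" "\<tau> \<le> T" "v \<tau> \<in> E" by blast
  have "E \<noteq> UNIV" using E(2) centre_in_ball[of 0 1] by auto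
  then obtain m where "v \<tau> \<in> interior (inner_set E m)" using in_interior_inner_set[OF E(1) \<tau>(3)] by blast
  then show "grid_exits_open T E v"
    unfolding grid_exits_open_def using v \<tau> by (intro exI[of _ m] grid_exitsI) (auto simp: good_path_def)
next
  assume "grid_exits_open T E v"
  then obtain m where m: "grid_exits T (inner_set E m) v" by (auto simp: grid_exits_open_def)
  have rc: "right_continuous v" and nt: "\<And>q. q \<in> \<rat> \<Longrightarrow> 0 < q \<Longrightarrow> \<not> touches_sphere q v"
    using v by (auto simp: good_path_def)
  have "inner_set E m \<inter> ball 0 1 = {}" using E(2) inner_set_subset[of E m] by blast
  from grid_exitsD[OF rc T closed_inner_set this nt m] obtain \<tau> where
    "\<tau> \<le> T" "path_exit_time (ball 0 1) v = ereal \<tau>" "v \<tau> \<in> inner_set E m" by metis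
  then show "\<exists>\<tau>. path_exit_time (ball 0 1) v = ereal \<tau> \<and> \<tau> \<le> T \<and> v \<tau> \<in> E"
    using inner_set_subset[of E m] by blast
qed

lemma exits_into_iff_grid_exits_ever:
  assumes v: "good_path v" and E: "open E" "E \<inter> ball 0 1 = {}"
  shows "exits_into E v \<longleftrightarrow> grid_exits_ever E v"
proof -
  have rc: "right_continuous v" using v by (simp add: good_path_def)
  have "exits_into E v \<longleftrightarrow> (\<exists>T::nat. \<exists>\<tau>. path_exit_time (ball 0 1) v = ereal \<tau> \<and> \<tau> \<le> real T \<and> v \<tau> \<in> E)"
  proof (cases rule: path_exit_time_cases[OF rc open_ball[of 0 1]])
    case 1
    then show ?thesis by (simp add: exits_into_def)
  next
    case (2 \<tau>)
    then show ?thesis using real_arch_simple[of \<tau>] by (auto simp: exits_into_def)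
  qed
  then show ?thesis
    unfolding grid_exits_ever_def using exit_by_iff_grid_exits_open[OF v E] by simp
qed

lemma exits_into_shift:
  assumes rc: "right_continuous v" and t: "0 \<le> t" "ereal t < path_exit_time (ball 0 1) v"
  shows "exits_into E v \<longleftrightarrow> exits_into E (\<lambda>s. v (t + s))" and "norm (v t) < 1"
proof -
  let ?v = "\<lambda>s. v (t + s)"
  have before: "v s \<in> ball 0 1" if "0 \<le> s" "s \<le> t" for s
  proof (rule ccontr)
    assume "v s \<notin> ball 0 1"
    then obtain \<tau> where "\<tau> \<le> s" "path_exit_time (ball 0 1) v = ereal \<tau>"
      using path_exit_time_attained[OF rc open_ball, of s 0 1] \<open>0 \<le> s\<close> by metis
    then show False using t(2) \<open>s \<le> t\<close> by simp
  qed
  then show "norm (v t) < 1" using t(1) by force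
  show "exits_into E v \<longleftrightarrow> exits_into E ?v"
  proof (cases rule: path_exit_time_cases[OF rc open_ball[of 0 1]])
    case 1
    then have "{s. 0 \<le> s \<and> ?v s \<notin> ball 0 1} = {}" using t(1) by auto
    then have "path_exit_time (ball 0 1) ?v = \<infinity>"
      unfolding path_exit_time_def exit_time_def by (simp only: image_empty Inf_empty top_ereal_def)
    then show ?thesis using 1 by (simp add: exits_into_def)
  next
    case (2 \<tau>)
    then have "t < \<tau>" using t(2) by simp
    have "path_exit_time (ball 0 1) ?v = ereal (\<tau> - t)"
    proof (rule antisym)
      show "path_exit_time (ball 0 1) ?v \<le> ereal (\<tau> - t)"
        unfolding path_exit_time_def exit_time_def using 2 \<open>t < \<tau>\<close>
        by (intro INF_lower2[of "\<tau> - t"]) auto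
      have "\<tau> - t \<le> s" if "0 \<le> s" "?v s \<notin> ball 0 1" for s
        using 2(4)[of "t + s"] that t(1) by fastforce
      then show "ereal (\<tau> - t) \<le> path_exit_time (ball 0 1) ?v"
        unfolding path_exit_time_def exit_time_def by (intro INF_greatest) auto
    qed
    then show ?thesis using 2 by (simp add: exits_into_def)
  qed
qed

lemma grid_exits_cong:
  assumes "0 \<le> T" "\<And>s. 0 \<le> s \<Longrightarrow> s \<le> T \<Longrightarrow> v s = v' s"
  shows "grid_exits T K v = grid_exits T K v'"
proof -
  have "v (real j * T / real n) = v' (real j * T / real n)" if "j \<le> n" for j n
  proof (rule assms(2))
    show "real j * T / real n \<le> T" using that assms(1) by (cases "n = 0") (auto simp: divide_le_eq mult.commute mult_left_mono)
  qed (use assms(1) in auto)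
  note eq = this
  have "v (real (Suc k) * T / real n) = v' (real (Suc k) * T / real n)"
    "(\<forall>j\<le>k. norm (v (real j * T / real n)) < 1) = (\<forall>j\<le>k. norm (v' (real j * T / real n)) < 1)" if "k < n" for k n
  proof -
    show "v (real (Suc k) * T / real n) = v' (real (Suc k) * T / real n)" by (rule eq) (use that in simp)
    have "v (real j * T / real n) = v' (real j * T / real n)" if "j \<le> k" for j
      by (rule eq) (use that \<open>k < n\<close> in simp)
    then show "(\<forall>j\<le>k. norm (v (real j * T / real n)) < 1) = (\<forall>j\<le>k. norm (v' (real j * T / real n)) < 1)" by auto
  qed
  then have "(\<exists>k<n. (\<forall>j\<le>k. norm (v (real j * T / real n)) < 1) \<and> v (real (Suc k) * T / real n) \<in> K) =
      (\<exists>k<n. (\<forall>j\<le>k. norm (v' (real j * T / real n)) < 1) \<and> v' (real (Suc k) * T / real n) \<in> K)" for n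
    by (rule_tac ex_cong1, rule_tac conj_cong[OF refl], simp only:)
  then show ?thesis unfolding grid_exits_def by (simp only:)
qed

lemma grid_exits_open_cong:
  assumes "0 \<le> T" "\<And>s. 0 \<le> s \<Longrightarrow> s \<le> T \<Longrightarrow> v s = v' s"
  shows "grid_exits_open T E v = grid_exits_open T E v'"
  unfolding grid_exits_open_def by (intro ex_cong1 grid_exits_cong assms)

lemma grid_exits_ever_cong:
  assumes "\<And>s. 0 \<le> s \<Longrightarrow> v s = v' s"
  shows "grid_exits_ever E v = grid_exits_ever E v'"
  unfolding grid_exits_ever_def using assms by (intro ex_cong1 grid_exits_open_cong) auto

lemma pred_grid_exits_open:
  fixes v :: "'b \<Rightarrow> real \<Rightarrow> 'a::{real_normed_vector, second_countable_topology}"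
  assumes v: "\<And>s. 0 \<le> s \<Longrightarrow> s \<le> T \<Longrightarrow> (\<lambda>x. v x s) \<in> borel_measurable M" and T: "0 \<le> T"
  shows "Measurable.pred M (\<lambda>x. grid_exits_open T E (v x))"
proof -
  \<comment> \<open>Freezing the path at \<open>T\<close> makes it measurable at all times although
    only the times up to \<open>T\<close> are available, as for a path of the past.\<close>
  have "grid_exits_open T E (v x) = grid_exits_open T E (\<lambda>s. v x (min s T))" for x
    using T by (intro grid_exits_open_cong) auto
  moreover have "Measurable.pred M (\<lambda>x. grid_exits_open T E (\<lambda>s. v x (min s T)))"
    unfolding grid_exits_open_def using T
    by (intro pred_intros_countable pred_grid_exits v borel_closed closed_inner_set) auto
  ultimately show ?thesis by simp
qed

lemma pred_grid_exits_ever: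
  fixes v :: "'b \<Rightarrow> real \<Rightarrow> 'a::{real_normed_vector, second_countable_topology}"
  assumes v: "\<And>s. 0 \<le> s \<Longrightarrow> (\<lambda>x. v x s) \<in> borel_measurable M"
  shows "Measurable.pred M (\<lambda>x. grid_exits_ever E (v x))"
  unfolding grid_exits_ever_def by (intro pred_intros_countable pred_grid_exits_open v) auto

section \<open>Markov property; the exit probability as a function of the starting point\<close>

context stable_family
begin

definition past_paths :: "real \<Rightarrow> ('n \<Rightarrow> real \<Rightarrow> real) measure" where
  "past_paths t = PiM UNIV (\<lambda>_. PiM {0..t} (\<lambda>_. borel))"

definition future_paths :: "('n \<Rightarrow> real \<Rightarrow> real) measure" where
  "future_paths = PiM UNIV (\<lambda>_. PiM {0..} (\<lambda>_. borel))"

definition past :: "real \<Rightarrow> 'w \<Rightarrow> 'n \<Rightarrow> real \<Rightarrow> real" where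
  "past t \<omega> = (\<lambda>i. coord_path t (i, False) \<omega>)"

definition future :: "real \<Rightarrow> 'w \<Rightarrow> 'n \<Rightarrow> real \<Rightarrow> real" where
  "future t \<omega> = (\<lambda>i. coord_path t (i, True) \<omega>)"

definition vec_path :: "('n \<Rightarrow> real \<Rightarrow> real) \<Rightarrow> real \<Rightarrow> real^'n" where
  "vec_path f s = (\<chi> i. f i s)"

definition path_law :: "('n \<Rightarrow> real \<Rightarrow> real) measure" where
  "path_law = distr (P 0) future_paths (future 0)"

lemma vec_path_past: "0 \<le> s \<Longrightarrow> s \<le> t \<Longrightarrow> vec_path (past t \<omega>) s = W s \<omega> - W 0 \<omega>"
  by (simp add: vec_path_def past_def coord_path_def vec_eq_iff)

lemma vec_path_future: "0 \<le> s \<Longrightarrow> vec_path (future t \<omega>) s = W (t + s) \<omega> - W t \<omega>"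
  by (simp add: vec_path_def future_def coord_path_def vec_eq_iff)

lemma vec_path_measurable_past: "0 \<le> s \<Longrightarrow> s \<le> t \<Longrightarrow> (\<lambda>f. vec_path f s) \<in> borel_measurable (past_paths t)"
  unfolding vec_path_def past_paths_def
  by (intro borel_measurable_vec_lambda, rule measurable_compose[OF measurable_component_singleton])
    (auto intro!: measurable_component_singleton)

lemma vec_path_measurable_future: "0 \<le> s \<Longrightarrow> (\<lambda>f. vec_path f s) \<in> borel_measurable future_paths"
  unfolding vec_path_def future_paths_def
  by (intro borel_measurable_vec_lambda, rule measurable_compose[OF measurable_component_singleton])
    (auto intro!: measurable_component_singleton)

text \<open>Past and future consist of increments, so the independence is unconditional; the
  position at time \<open>t\<close> enters later as a function of the past.\<close>

lemma markov:
  assumes t: "0 \<le> t"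
  shows "P.indep_var w (past_paths t) (past t) future_paths (future t)"
proof -
  let ?R = "\<lambda>b \<omega>. \<lambda>j\<in>UNIV \<times> {b}. coord_path t j \<omega>"
  let ?Y = "\<lambda>b. \<lambda>f :: 'n \<times> bool \<Rightarrow> real \<Rightarrow> real. \<lambda>i\<in>UNIV. f (i, b)"
  have "P.indep_var w (PiM (UNIV \<times> {False}) (path_index t)) (?R False) (PiM (UNIV \<times> {True}) (path_index t)) (?R True)"
    by (rule P.indep_var_restrict[OF indep_coord_paths[OF t]]) auto
  then have "P.indep_var w (past_paths t) (?Y False \<circ> ?R False) future_paths (?Y True \<circ> ?R True)"
  proof (rule P.indep_var_compose)
    have "(\<lambda>f. f (i, b)) \<in> measurable (PiM (UNIV \<times> {b}) (path_index t)) (PiM (if b then {0..} else {0..t}) (\<lambda>_. borel))" for i :: 'n and b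
      using measurable_component_singleton[of "(i, b)" "UNIV \<times> {b}" "path_index t"] by (simp add: path_index_def)
    from this[of _ False] this[of _ True]
    show "?Y False \<in> measurable (PiM (UNIV \<times> {False}) (path_index t)) (past_paths t)"
      "?Y True \<in> measurable (PiM (UNIV \<times> {True}) (path_index t)) future_paths"
      unfolding past_paths_def future_paths_def by (auto intro!: measurable_restrict)
  qed
  moreover have "?Y False \<circ> ?R False = past t" "?Y True \<circ> ?R True = future t"
    by (auto simp: past_def future_def fun_eq_iff)
  ultimately show ?thesis by simp
qed

lemma past_measurable: "0 \<le> t \<Longrightarrow> past t \<in> measurable (P w) (past_paths t)"
  using P.indep_var_rv1[OF markov] .

lemma future_measurable: "0 \<le> t \<Longrightarrow> future t \<in> measurable (P w) future_paths"
  using P.indep_var_rv2[OF markov] .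

text \<open>The triplet determines the marginals, these determine the law of each coordinate path,
  and independence of coordinates the joint law. This is the link between the measures
  \<open>P w\<close> for different \<open>w\<close>.\<close>

lemma distr_future:
  assumes t: "0 \<le> t"
  shows "distr (P w) future_paths (future t) = path_law"
proof -
  define fut where "fut t = (\<lambda>f::real \<Rightarrow> real. \<lambda>s\<in>{0..}. f (t + s) - f t)" for t
  have fut: "fut t \<in> measurable (PiM {0..} (\<lambda>_. borel)) (PiM {0..} (\<lambda>_. borel))" if "0 \<le> t" for t
    unfolding fut_def using that
    by (auto intro!: measurable_restrict borel_measurable_diff measurable_component_singleton)
  have coord: "fut t (\<lambda>s\<in>{0..}. W s \<omega> $ i) = coord_path t (i, True) \<omega>" if "0 \<le> t" for t i \<omega>
    using that by (auto simp: fut_def coord_path_def fun_eq_iff)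
  have eq: "distr (P w) future_paths (future t) = PiM UNIV (\<lambda>i. distr (P w) (PiM {0..} (\<lambda>_. borel)) (coord_path t (i, True)))"
    if t: "0 \<le> t" for w t
  proof -
    have "P.indep_vars w (\<lambda>_. PiM {0..} (\<lambda>_. borel)) (\<lambda>i \<omega>. fut t (\<lambda>s\<in>{0..}. W s \<omega> $ i)) UNIV"
      by (rule P.indep_vars_compose2[OF coord_indep fut[OF t]])
    then have ind: "P.indep_vars w (\<lambda>_. PiM {0..} (\<lambda>_. borel)) (\<lambda>i. coord_path t (i, True)) UNIV"
      by (simp only: coord[OF t])
    have "distr (P w) (PiM UNIV (\<lambda>_. PiM {0..} (\<lambda>_. borel))) (\<lambda>\<omega>. \<lambda>i\<in>UNIV. coord_path t (i, True) \<omega>) =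
        PiM UNIV (\<lambda>i. distr (P w) (PiM {0..} (\<lambda>_. borel)) (coord_path t (i, True)))"
      using ind by (subst (asm) P.indep_vars_iff_distr_eq_PiM)
        (use coord_path_measurable[OF t, of "(i, True)" w for i] in \<open>auto simp: path_index_def\<close>)
    moreover have "(\<lambda>\<omega>. \<lambda>i\<in>UNIV. coord_path t (i, True) \<omega>) = future t"
      by (auto simp: future_def fun_eq_iff)
    ultimately show ?thesis by (simp add: future_paths_def)
  qed
  have "distr (P w) (PiM {0..} (\<lambda>_. borel)) (coord_path t (i, True)) = distr (P 0) (PiM {0..} (\<lambda>_. borel)) (coord_path 0 (i, True))" for i
  proof -
    have "distr (P w) borel (\<lambda>\<omega>. W u \<omega> $ i - w $ i) = distr (P 0) borel (\<lambda>\<omega>. W u \<omega> $ i - 0 $ i)" if "0 \<le> u" for u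
      by (rule stable_law_unique[OF stable_law_stable_process[OF coord_stable that] stable_law_stable_process[OF coord_stable that]])
    from levy_path_law_unique[OF coord_levy coord_levy this t order_refl]
    show ?thesis by (simp add: coord_path_def[abs_def])
  qed
  then show ?thesis unfolding path_law_def eq[OF t] eq[OF order_refl] by simp
qed

lemma prob_space_path_law: "prob_space path_law"
  unfolding path_law_def using future_measurable[OF order_refl] by (rule P.prob_space_distr)

lemma sets_path_law [simp, measurable_cong]: "sets path_law = sets future_paths"
  by (simp add: path_law_def)

lemma AE_good_path:
  assumes "norm w < 1"
  shows "AE \<omega> in P w. good_path (\<lambda>t. W t \<omega>) \<and> W 0 \<omega> = w"
  using AE_right_continuous W_0 AE_not_touches[OF assms]
  by eventually_elim (use assms in \<open>auto simp: good_path_def\<close>)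

text \<open>The exit probability written with the single measure \<open>path_law\<close>, which
  makes measurability in the starting point a consequence of Fubini. It is compared with
  \<open>exit_prob\<close> only for starting points inside the ball.\<close>

definition exit_fun :: "(real^'n) set \<Rightarrow> real^'n \<Rightarrow> real" where
  "exit_fun E x = measure path_law {f \<in> space future_paths. grid_exits_ever E (\<lambda>s. x + vec_path f s)}"

lemma pred_exits_from [measurable]:
  "{z \<in> space (borel \<Otimes>\<^sub>M future_paths). grid_exits_ever E (\<lambda>s. fst z + vec_path (snd z) s)} \<in> sets (borel \<Otimes>\<^sub>M future_paths)"
proof (rule predE[OF pred_grid_exits_ever])
  fix s :: real assume "0 \<le> s"
  note [measurable] = vec_path_measurable_future[OF this]
  show "(\<lambda>z. fst z + vec_path (snd z) s) \<in> borel_measurable (borel \<Otimes>\<^sub>M future_paths)" by measurable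
qed

lemma exits_from_section: "{f \<in> space future_paths. grid_exits_ever E (\<lambda>s. x + vec_path f s)} \<in> sets future_paths"
  by (rule predE[OF pred_grid_exits_ever]) (auto intro!: borel_measurable_add vec_path_measurable_future)

lemma exit_fun_measurable [measurable]: "exit_fun E \<in> borel_measurable borel"
proof -
  interpret L: prob_space path_law by (rule prob_space_path_law)
  have "(\<lambda>x. emeasure path_law (Pair x -` {z \<in> space (borel \<Otimes>\<^sub>M future_paths). grid_exits_ever E (\<lambda>s. fst z + vec_path (snd z) s)})) \<in> borel_measurable borel"
    by (rule L.measurable_emeasure_Pair) (simp add: pred_exits_from cong: sets_pair_measure_cong)
  also have "(\<lambda>x. Pair x -` {z \<in> space (borel \<Otimes>\<^sub>M future_paths). grid_exits_ever E (\<lambda>s. fst z + vec_path (snd z) s)}) =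
     (\<lambda>x. {f \<in> space future_paths. grid_exits_ever E (\<lambda>s. x + vec_path f s)})"
    by (auto simp: space_pair_measure fun_eq_iff)
  finally show ?thesis unfolding exit_fun_def[abs_def] measure_def by measurable
qed

lemma exit_fun_bounds: "0 \<le> exit_fun E x" "exit_fun E x \<le> 1"
  unfolding exit_fun_def by (auto intro: prob_space.prob_le_1[OF prob_space_path_law])

definition exit_event :: "(real^'n) set \<Rightarrow> real^'n \<Rightarrow> 'w set" where
  "exit_event E w = {\<omega> \<in> space (P w). exits_into E (\<lambda>t. W t \<omega>)}"

lemma exit_prob_eq_exit_event: "exit_prob P W (ball 0 1) E w = measure (completion (P w)) (exit_event E w)"
  by (simp add: exit_prob_def exit_event_def exits_into_def exit_time_eq_path_exit_time)

lemma grid_exits_ever_event: "{\<omega> \<in> space (P w). grid_exits_ever E (\<lambda>t. W t \<omega>)} \<in> sets (P w)"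
  by (rule predE[OF pred_grid_exits_ever]) (rule W_measurable)

lemma exit_event_AE:
  assumes w: "norm w < 1" and E: "open E" "E \<inter> ball 0 1 = {}"
  shows "AE \<omega> in P w. \<omega> \<in> exit_event E w \<longleftrightarrow> \<omega> \<in> {\<omega> \<in> space (P w). grid_exits_ever E (\<lambda>t. W t \<omega>)}"
  using AE_good_path[OF w]
  by eventually_elim (use exits_into_iff_grid_exits_ever[OF _ E] in \<open>auto simp: exit_event_def\<close>)

lemma exit_event_in_completion:
  assumes w: "norm w < 1" and E: "open E" "E \<inter> ball 0 1 = {}"
  shows "exit_event E w \<in> sets (completion (P w))"
  by (rule completion_AE_eq(1)[OF grid_exits_ever_event _ exit_event_AE[OF assms]]) (auto simp: exit_event_def)

lemma exit_prob_eq_prob_grid: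
  assumes w: "norm w < 1" and E: "open E" "E \<inter> ball 0 1 = {}"
  shows "exit_prob P W (ball 0 1) E w = P.prob w {\<omega> \<in> space (P w). grid_exits_ever E (\<lambda>t. W t \<omega>)}"
  unfolding exit_prob_eq_exit_event
  by (rule completion_AE_eq(2)[OF grid_exits_ever_event _ exit_event_AE[OF assms]]) (auto simp: exit_event_def)

lemma exit_prob_eq_exit_fun:
  assumes w: "norm w < 1" and E: "open E" "E \<inter> ball 0 1 = {}"
  shows "exit_prob P W (ball 0 1) E w = exit_fun E w"
proof -
  let ?S = "{f \<in> space future_paths. grid_exits_ever E (\<lambda>s. w + vec_path f s)}"
  have "exit_fun E w = measure (distr (P w) future_paths (future 0)) ?S"
    by (simp add: exit_fun_def distr_future)
  also have "\<dots> = P.prob w (future 0 -` ?S \<inter> space (P w))"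
    using exits_from_section by (intro measure_distr future_measurable) auto
  also have "\<dots> = P.prob w {\<omega> \<in> space (P w). grid_exits_ever E (\<lambda>t. W t \<omega>)}"
  proof (rule P.finite_measure_eq_AE)
    show "AE \<omega> in P w. \<omega> \<in> future 0 -` ?S \<inter> space (P w) \<longleftrightarrow> \<omega> \<in> {\<omega> \<in> space (P w). grid_exits_ever E (\<lambda>t. W t \<omega>)}"
      using W_0 AE_space
    proof eventually_elim
      case (elim \<omega>)
      have "grid_exits_ever E (\<lambda>s. w + vec_path (future 0 \<omega>) s) = grid_exits_ever E (\<lambda>t. W t \<omega>)"
        using elim(1) by (intro grid_exits_ever_cong) (simp add: vec_path_future)
      then show ?case using elim measurable_space[OF future_measurable[OF order_refl] elim(2)] by auto
    qed
    show "future 0 -` ?S \<inter> space (P w) \<in> P.events w"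
      using measurable_sets[OF future_measurable[OF order_refl] exits_from_section] .
  qed (rule grid_exits_ever_event)
  finally show ?thesis using exit_prob_eq_prob_grid[OF assms] by simp
qed

lemma path_exit_time_0:
  assumes "v 0 \<notin> D"
  shows "path_exit_time D v = 0"
  unfolding path_exit_time_def exit_time_def
proof (rule antisym)
  show "(INF t\<in>{t. 0 \<le> t \<and> v t \<notin> D}. ereal t) \<le> 0"
    using assms by (intro INF_lower2[of 0]) (auto simp: zero_ereal_def)
  show "0 \<le> (INF t\<in>{t. 0 \<le> t \<and> v t \<notin> D}. ereal t)" by (intro INF_greatest) auto
qed

lemma exit_prob_outside:
  assumes w: "1 \<le> norm w"
  shows "exit_prob P W (ball 0 1) E w = indicator E w"
proof -
  have "AE \<omega> in P w. \<omega> \<in> exit_event E w \<longleftrightarrow> \<omega> \<in> (if w \<in> E then space (P w) else {})"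
    using W_0 AE_space
    by eventually_elim (use w in \<open>auto simp: exit_event_def exits_into_def path_exit_time_0\<close>)
  then have "exit_prob P W (ball 0 1) E w = P.prob w (if w \<in> E then space (P w) else {})"
    unfolding exit_prob_eq_exit_event by (intro completion_AE_eq(2)) (auto simp: exit_event_def)
  then show ?thesis by (simp add: P.prob_space)
qed

lemma exit_prob_measurable [measurable]:
  assumes E: "open E" "E \<inter> ball 0 1 = {}"
  shows "exit_prob P W (ball 0 1) E \<in> borel_measurable borel"
proof -
  have "exit_prob P W (ball 0 1) E = (\<lambda>x. if norm x < 1 then exit_fun E x else indicator E x)"
    using exit_prob_eq_exit_fun[OF _ E] exit_prob_outside by (auto simp: fun_eq_iff not_less)
  moreover have "(\<lambda>x. if norm x < 1 then exit_fun E x else indicator E x) \<in> borel_measurable borel"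
    using borel_open[OF E(1)] by measurable
  ultimately show ?thesis by simp
qed

lemma exit_prob_bounds: "0 \<le> exit_prob P W D E x" "exit_prob P W D E x \<le> 1"
  unfolding exit_prob_def
  by (auto intro!: prob_space.prob_le_1 prob_spaceI simp: P.emeasure_space_1)

end

section \<open>Exit probabilities are harmonic\<close>

text \<open>Conditioning on \<open>X\<close>, integrated over an event of \<open>X\<close>: given
  its value, the probability is that of the section of \<open>Q\<close>. In this form the Markov
  property is used.\<close>

lemma (in prob_space) indep_var_integral_section:
  assumes ind: "indep_var S X T Y" and C: "C \<in> sets S" and Q: "Q \<in> sets (S \<Otimes>\<^sub>M T)"
  shows "(\<integral>\<omega>. indicator C (X \<omega>) * indicator Q (X \<omega>, Y \<omega>) \<partial>M) =
    (\<integral>\<omega>. indicator C (X \<omega>) * measure (distr M T Y) (Pair (X \<omega>) -` Q) \<partial>M)"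
proof -
  have X[measurable]: "X \<in> measurable M S" and Y[measurable]: "Y \<in> measurable M T"
    using ind by (auto dest: indep_var_rv1 indep_var_rv2)
  note [measurable] = C Q
  interpret X: prob_space "distr M S X" using X by (rule prob_space_distr)
  interpret Y: prob_space "distr M T Y" using Y by (rule prob_space_distr)
  have eq: "distr M S X \<Otimes>\<^sub>M distr M T Y = distr M (S \<Otimes>\<^sub>M T) (\<lambda>x. (X x, Y x))"
    using ind by (simp add: indep_var_distribution_eq)
  have mY: "(\<lambda>x. emeasure (distr M T Y) (Pair x -` Q)) \<in> borel_measurable S"
    by (rule Y.measurable_emeasure_Pair) (simp add: Q cong: sets_pair_measure_cong)
  then have mY'[measurable]: "(\<lambda>x. measure (distr M T Y) (Pair x -` Q)) \<in> borel_measurable S"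
    unfolding measure_def by measurable
  have "(\<integral>\<^sup>+\<omega>. ennreal (indicator C (X \<omega>) * indicator Q (X \<omega>, Y \<omega>)) \<partial>M) =
      (\<integral>\<^sup>+z. indicator C (fst z) * indicator Q z \<partial>distr M (S \<Otimes>\<^sub>M T) (\<lambda>x. (X x, Y x)))"
    by (subst nn_integral_distr) (auto intro!: nn_integral_cong simp: indicator_def)
  also have "\<dots> = (\<integral>\<^sup>+x. \<integral>\<^sup>+y. indicator C x * indicator Q (x, y) \<partial>distr M T Y \<partial>distr M S X)"
    unfolding eq[symmetric] by (subst Y.nn_integral_fst[symmetric]) auto
  also have "\<dots> = (\<integral>\<^sup>+x. indicator C x * emeasure (distr M T Y) (Pair x -` Q) \<partial>distr M S X)"
  proof (rule nn_integral_cong)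
    fix x
    have sec: "Pair x -` Q \<in> sets T" using Q by (rule sets_Pair1)
    then have [measurable]: "indicator (Pair x -` Q) \<in> borel_measurable T" by (rule borel_measurable_indicator)
    have "(\<integral>\<^sup>+y. indicator (Pair x -` Q) y \<partial>distr M T Y) = emeasure (distr M T Y) (Pair x -` Q)"
      using sec by (intro nn_integral_indicator) simp
    moreover have "(\<integral>\<^sup>+y. indicator C x * indicator Q (x, y) \<partial>distr M T Y) =
        indicator C x * (\<integral>\<^sup>+y. indicator (Pair x -` Q) y \<partial>distr M T Y)"
      by (subst nn_integral_cmult[symmetric]) (auto intro!: nn_integral_cong simp: indicator_def)
    ultimately show "(\<integral>\<^sup>+y. indicator C x * indicator Q (x, y) \<partial>distr M T Y) =
        indicator C x * emeasure (distr M T Y) (Pair x -` Q)" by simp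
  qed
  also have "\<dots> = (\<integral>\<^sup>+\<omega>. indicator C (X \<omega>) * emeasure (distr M T Y) (Pair (X \<omega>) -` Q) \<partial>M)"
    using mY by (subst nn_integral_distr) auto
  also have "\<dots> = (\<integral>\<^sup>+\<omega>. ennreal (indicator C (X \<omega>) * measure (distr M T Y) (Pair (X \<omega>) -` Q)) \<partial>M)"
    by (intro nn_integral_cong) (auto simp: Y.emeasure_eq_measure indicator_def)
  finally show ?thesis
    by (subst (1 2) integral_eq_nn_integral) auto
qed

lemma right_continuous_shift:
  assumes "right_continuous v" "0 \<le> t"
  shows "right_continuous (\<lambda>s. v (t + s))"
  unfolding right_continuous_def continuous_within
proof (intro allI impI)
  fix s :: real assume "0 \<le> s"
  then have "(v \<longlongrightarrow> v (t + s)) (at_right (t + s))"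
    using assms by (auto simp: right_continuous_def continuous_within)
  then show "((\<lambda>s. v (t + s)) \<longlongrightarrow> v (t + s)) (at_right s)"
    unfolding filterlim_at_right_to_0[of v _ "t + s"] filterlim_at_right_to_0[of _ _ s]
    by (simp add: add_ac)
qed

section \<open>The augmented filtration and the martingale property\<close>

context stable_family
begin

lemma augmented_gens_subset:
  "{W s -` A \<inter> space (P w) | s A. 0 \<le> s \<and> s \<le> t \<and> A \<in> sets borel} \<union> null_sets (completion (P w)) \<subseteq> sets (completion (P w))"
proof -
  have "W s -` A \<inter> space (P w) \<in> sets (completion (P w))" if "0 \<le> s" "A \<in> sets borel" for s A
    using measurable_sets[OF W_measurable[OF that(1)] that(2)] by (rule sets_completionI_sets)
  then have "{W s -` A \<inter> space (P w) | s A. 0 \<le> s \<and> s \<le> t \<and> A \<in> sets borel} \<subseteq> sets (completion (P w))"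
    by blast
  moreover have "null_sets (completion (P w)) \<subseteq> sets (completion (P w))"
    by (intro subsetI null_setsD2)
  ultimately show ?thesis by (rule Un_least)
qed

lemma augmented_gens_Pow:
  "{W s -` A \<inter> space (P w) | s A. 0 \<le> s \<and> s \<le> t \<and> A \<in> sets borel} \<union> null_sets (completion (P w)) \<subseteq> Pow (space (P w))"
  using subset_trans[OF augmented_gens_subset[of w t] sets.space_closed[of "completion (P w)"]] by simp

lemma sets_augmented:
  "sets (augmented_filtration (P w) W t) = sigma_sets (space (P w))
     ({W s -` A \<inter> space (P w) | s A. 0 \<le> s \<and> s \<le> t \<and> A \<in> sets borel} \<union> null_sets (completion (P w)))"
  unfolding augmented_filtration_def by (rule sets_measure_of[OF augmented_gens_Pow])

lemma space_augmented: "space (augmented_filtration (P w) W t) = space (P w)"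
  unfolding augmented_filtration_def by (rule space_measure_of[OF augmented_gens_Pow])

lemma subalgebra_augmented: "subalgebra (completion (P w)) (augmented_filtration (P w) W t)"
  unfolding subalgebra_def sets_augmented space_augmented
  using sets.sigma_sets_subset[OF augmented_gens_subset[of w t]] by simp

lemma augmented_mono: "s \<le> t \<Longrightarrow> sets (augmented_filtration (P w) W s) \<subseteq> sets (augmented_filtration (P w) W t)"
  unfolding sets_augmented by (intro sigma_sets_mono') (auto intro: order_trans)

lemma filtration_augmented: "filtration (space (completion (P w))) (augmented_filtration (P w) W)"
  by unfold_locales (simp_all add: space_augmented augmented_mono)

lemma null_in_augmented: "N \<in> null_sets (completion (P w)) \<Longrightarrow> N \<in> sets (augmented_filtration (P w) W t)"
  unfolding sets_augmented by (rule sigma_sets.Basic) simp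

lemma W_augmented: "0 \<le> s \<Longrightarrow> s \<le> t \<Longrightarrow> W s \<in> borel_measurable (augmented_filtration (P w) W t)"
  by (rule measurableI) (auto simp: space_augmented sets_augmented intro!: sigma_sets.Basic)

lemma past_augmented:
  assumes "0 \<le> t"
  shows "past t \<in> measurable (augmented_filtration (P w) W t) (past_paths t)"
proof -
  have c: "(\<lambda>\<omega>. W s \<omega> $ i) \<in> borel_measurable (augmented_filtration (P w) W t)" if "0 \<le> s" "s \<le> t" for s i
    by (rule measurable_compose[OF W_augmented[OF that]])
       (intro borel_measurable_continuous_onI continuous_intros)
  have "(\<lambda>\<omega>. \<lambda>i\<in>UNIV. \<lambda>s\<in>{0..t}. W s \<omega> $ i - W 0 \<omega> $ i) \<in> measurable (augmented_filtration (P w) W t) (past_paths t)"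
    unfolding past_paths_def using assms by (intro measurable_restrict borel_measurable_diff c) auto
  also have "(\<lambda>\<omega>. \<lambda>i\<in>UNIV. \<lambda>s\<in>{0..t}. W s \<omega> $ i - W 0 \<omega> $ i) = past t"
    by (auto simp: past_def coord_path_def fun_eq_iff)
  finally show ?thesis .
qed

text \<open>Transfers the augmented filtration to path space, where the independence of the future
  applies. Under \<open>P w\<close> the position \<open>W s\<close> is a function of increments
  because \<open>W 0 = w\<close> almost surely, and a null set corresponds to the empty set.\<close>

lemma augmented_AE_past:
  assumes t: "0 \<le> t" and A: "A \<in> sets (augmented_filtration (P w) W t)"
  shows "\<exists>C\<in>sets (past_paths t). AE \<omega> in P w. \<omega> \<in> A \<longleftrightarrow> past t \<omega> \<in> C"
  using A unfolding sets_augmented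
proof induction
  case (Basic a)
  then consider s B where "a = W s -` B \<inter> space (P w)" "0 \<le> s" "s \<le> t" "B \<in> sets borel" | "a \<in> null_sets (completion (P w))"
    by blast
  then show ?case
  proof cases
    case 1
    let ?C = "{f \<in> space (past_paths t). w + vec_path f s \<in> B}"
    have "?C \<in> sets (past_paths t)"
      using vec_path_measurable_past[OF 1(2,3)] 1(4) by measurable
    moreover have "AE \<omega> in P w. \<omega> \<in> a \<longleftrightarrow> past t \<omega> \<in> ?C"
      using W_0 AE_space
      by eventually_elim (use 1 measurable_space[OF past_measurable[OF t, of w]] in \<open>auto simp: vec_path_past\<close>)
    ultimately show ?thesis by blast
  next
    case 2
    then have "AE \<omega> in completion (P w). \<omega> \<notin> a" by (rule AE_not_in)
    then have "AE \<omega> in P w. \<omega> \<in> a \<longleftrightarrow> past t \<omega> \<in> {}" by (simp add: AE_completion_iff)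
    then show ?thesis by blast
  qed
next
  case Empty
  then show ?case by (intro bexI[of _ "{}"]) auto
next
  case (Compl a)
  then obtain C where C: "C \<in> sets (past_paths t)" "AE \<omega> in P w. \<omega> \<in> a \<longleftrightarrow> past t \<omega> \<in> C" by blast
  from C(2) AE_space have "AE \<omega> in P w. \<omega> \<in> space (P w) - a \<longleftrightarrow> past t \<omega> \<in> space (past_paths t) - C"
    by eventually_elim (use measurable_space[OF past_measurable[OF t, of w]] in auto)
  then show ?case using C(1) by blast
next
  case (Union a)
  then have "\<forall>i. \<exists>C. C \<in> sets (past_paths t) \<and> (AE \<omega> in P w. \<omega> \<in> a i \<longleftrightarrow> past t \<omega> \<in> C)" by blast
  from choice[OF this] obtain C where C: "\<And>i. C i \<in> sets (past_paths t)"
    "\<And>i. AE \<omega> in P w. \<omega> \<in> a i \<longleftrightarrow> past t \<omega> \<in> C i" by blast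
  from C(2) have "AE \<omega> in P w. \<forall>i. \<omega> \<in> a i \<longleftrightarrow> past t \<omega> \<in> C i" by (simp add: AE_all_countable)
  then have "AE \<omega> in P w. \<omega> \<in> (\<Union>i. a i) \<longleftrightarrow> past t \<omega> \<in> (\<Union>i. C i)" by eventually_elim auto
  moreover have "(\<Union>i. C i) \<in> sets (past_paths t)" using C(1) by auto
  ultimately show ?case by blast
qed

text \<open>Every sigma-algebra of the filtration contains the null sets of the completion, which
  absorb the exceptional sets.\<close>

lemma augmented_measurable_AE_eq:
  fixes Y Z :: "'w \<Rightarrow> real"
  assumes Z: "Z \<in> borel_measurable (augmented_filtration (P w) W t)" and ae: "AE \<omega> in P w. Y \<omega> = Z \<omega>"
  shows "Y \<in> borel_measurable (augmented_filtration (P w) W t)"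
proof (rule measurableI)
  fix B :: "real set" assume B: "B \<in> sets borel"
  let ?F = "augmented_filtration (P w) W t"
  from AE_E[OF ae] obtain N where N: "{\<omega>\<in>space (P w). \<not> Y \<omega> = Z \<omega>} \<subseteq> N" "emeasure (P w) N = 0" "N \<in> sets (P w)" .
  then have N0: "N \<in> null_sets (completion (P w))" by (intro null_sets_completionI) auto
  let ?D1 = "{\<omega>\<in>space (P w). Z \<omega> \<in> B \<and> Y \<omega> \<notin> B}" and ?D2 = "{\<omega>\<in>space (P w). Y \<omega> \<in> B \<and> Z \<omega> \<notin> B}"
  have "?D1 \<in> sets ?F" "?D2 \<in> sets ?F"
    using N(1) by (auto intro!: null_in_augmented null_sets_completion_subset[OF _ N0])
  moreover have "Z -` B \<inter> space ?F \<in> sets ?F" using measurable_sets[OF Z B] .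
  ultimately have "(Z -` B \<inter> space ?F - ?D1) \<union> ?D2 \<in> sets ?F" by blast
  also have "(Z -` B \<inter> space ?F - ?D1) \<union> ?D2 = Y -` B \<inter> space ?F" by (auto simp: space_augmented)
  finally show "Y -` B \<inter> space ?F \<in> sets ?F" .
qed simp

text \<open>\<open>AE_not_touches\<close> from the random point \<open>W t\<close>: by the Markov
  property one integrates, over the value of \<open>W t\<close> in the ball, the probability of
  touching from that fixed point, which is 0.\<close>

lemma AE_future_not_touches:
  assumes t: "0 \<le> t"
  shows "AE \<omega> in P w. norm (W t \<omega>) < 1 \<longrightarrow> (\<forall>q\<in>\<rat>. 0 < q \<longrightarrow> \<not> touches_sphere q (\<lambda>s. W (t + s) \<omega>))"
proof -
  let ?S = "past_paths t \<Otimes>\<^sub>M future_paths"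
  have one: "AE \<omega> in P w. norm (W t \<omega>) < 1 \<longrightarrow> \<not> touches_sphere q (\<lambda>s. W (t + s) \<omega>)" if q: "q \<in> \<rat>" "0 < q" for q
  proof -
    define C where "C = {y \<in> space (past_paths t). norm (w + vec_path y t) < 1}"
    define Q where "Q = {z \<in> space ?S. touches_sphere q (\<lambda>s. (w + vec_path (fst z) t) + vec_path (snd z) s)}"
    note [measurable] = vec_path_measurable_past[OF t order_refl]
    have C: "C \<in> sets (past_paths t)" unfolding C_def by measurable
    have Q: "Q \<in> sets ?S"
      unfolding Q_def
    proof (rule predE[OF pred_touches_sphere])
      fix s :: real assume "0 \<le> s"
      note [measurable] = vec_path_measurable_future[OF this]
      show "(\<lambda>z. (w + vec_path (fst z) t) + vec_path (snd z) s) \<in> borel_measurable ?S" by measurable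
    qed
    have null: "measure (distr (P w) future_paths (future t)) (Pair y -` Q) = 0" if "y \<in> C" for y
    proof -
      let ?x = "w + vec_path y t"
      have x: "norm ?x < 1" "y \<in> space (past_paths t)" using that by (auto simp: C_def)
      have sec: "Pair y -` Q \<in> sets future_paths" using Q by (rule sets_Pair1)
      have "measure (distr (P w) future_paths (future t)) (Pair y -` Q) = measure (distr (P ?x) future_paths (future 0)) (Pair y -` Q)"
        by (simp only: distr_future[OF t] distr_future[OF order_refl])
      also have "\<dots> = P.prob ?x (future 0 -` (Pair y -` Q) \<inter> space (P ?x))"
        by (rule measure_distr[OF future_measurable[OF order_refl] sec])
      also have "\<dots> = P.prob ?x {}"
      proof (rule P.finite_measure_eq_AE)
        show "AE \<omega> in P ?x. \<omega> \<in> future 0 -` Pair y -` Q \<inter> space (P ?x) \<longleftrightarrow> \<omega> \<in> {}"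
          using AE_not_touches[OF x(1)] W_0
        proof eventually_elim
          case (elim \<omega>)
          have "touches_sphere q (\<lambda>s. ?x + vec_path (future 0 \<omega>) s) = touches_sphere q (\<lambda>s. W s \<omega>)"
            using elim(2) by (intro touches_sphere_cong) (simp add: vec_path_future)
          then show ?case using elim(1) q by (auto simp: Q_def)
        qed
        show "future 0 -` Pair y -` Q \<inter> space (P ?x) \<in> P.events ?x"
          using measurable_sets[OF future_measurable[OF order_refl] sec] .
      qed simp
      finally show ?thesis by simp
    qed
    have "(\<integral>\<omega>. indicator C (past t \<omega>) * indicator Q (past t \<omega>, future t \<omega>) \<partial>P w) =
      (\<integral>\<omega>. indicator C (past t \<omega>) * measure (distr (P w) future_paths (future t)) (Pair (past t \<omega>) -` Q) \<partial>P w)"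
      by (rule P.indep_var_integral_section[OF markov[OF t] C Q])
    also have "\<dots> = (\<integral>\<omega>. 0 \<partial>P w)"
      using null by (intro Bochner_Integration.integral_cong refl) (auto simp: indicator_def)
    finally have z: "(\<integral>\<omega>. indicator C (past t \<omega>) * indicator Q (past t \<omega>, future t \<omega>) \<partial>P w) = (0::real)" by simp
    note [measurable] = past_measurable[OF t, of w] future_measurable[OF t, of w] C Q
    have "integrable (P w) (\<lambda>\<omega>. indicator C (past t \<omega>) * indicator Q (past t \<omega>, future t \<omega>) :: real)"
      by (intro P.integrable_const_bound[where B=1]) (auto simp: indicator_def)
    from integral_nonneg_eq_0_iff_AE[OF this] z
    have "AE \<omega> in P w. indicator C (past t \<omega>) * indicator Q (past t \<omega>, future t \<omega>) = (0::real)"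
      by (simp add: AE_I2)
    with W_0 AE_space show ?thesis
    proof eventually_elim
      case (elim \<omega>)
      have sp: "past t \<omega> \<in> space (past_paths t)" "future t \<omega> \<in> space future_paths"
        using measurable_space[OF past_measurable[OF t] elim(2)] measurable_space[OF future_measurable[OF t] elim(2)] by auto
      have w: "w + vec_path (past t \<omega>) t = W t \<omega>" using elim(1) t by (simp add: vec_path_past)
      have "touches_sphere q (\<lambda>s. (w + vec_path (past t \<omega>) t) + vec_path (future t \<omega>) s) = touches_sphere q (\<lambda>s. W (t + s) \<omega>)"
        unfolding w by (intro touches_sphere_cong) (simp add: vec_path_future)
      then show ?case using elim(3) sp w
        by (auto simp: C_def Q_def space_pair_measure indicator_def split: if_splits)
    qed
  qed
  have "AE \<omega> in P w. \<forall>q\<in>\<rat> \<inter> {0<..}. norm (W t \<omega>) < 1 \<longrightarrow> \<not> touches_sphere q (\<lambda>s. W (t + s) \<omega>)"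
    by (intro AE_ball_countable[THEN iffD2] countable_Rats_Int ballI one) auto
  then show ?thesis by eventually_elim auto
qed

lemma AE_good_future:
  assumes w: "norm w < 1" and t: "0 \<le> t"
  shows "AE \<omega> in P w. norm (W t \<omega>) < 1 \<longrightarrow> good_path (\<lambda>s. W (t + s) \<omega>)"
  using AE_future_not_touches[OF t] AE_right_continuous
proof eventually_elim
  case (elim \<omega>)
  then show ?case using right_continuous_shift[OF elim(2) t] by (simp add: good_path_def)
qed

lemma past_alive_iff:
  assumes t: "0 \<le> t" and good: "good_path (\<lambda>s. W s \<omega>)" "W 0 \<omega> = w"
  shows "ereal t < path_exit_time (ball 0 1) (\<lambda>s. W s \<omega>) \<longleftrightarrow>
    (\<forall>s\<in>\<rat> \<inter> {0..t}. norm (w + vec_path (past t \<omega>) s) < 1) \<and> norm (w + vec_path (past t \<omega>) t) < 1"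
proof -
  have "w + vec_path (past t \<omega>) s = W s \<omega>" if "0 \<le> s" "s \<le> t" for s
    using that good(2) by (simp add: vec_path_past)
  then have "(\<forall>s\<in>\<rat> \<inter> {0..t}. norm (w + vec_path (past t \<omega>) s) < 1) \<longleftrightarrow> (\<forall>s\<in>\<rat> \<inter> {0..t}. norm (W s \<omega>) < 1)"
    "norm (w + vec_path (past t \<omega>) t) < 1 \<longleftrightarrow> norm (W t \<omega>) < 1"
    using t by (auto simp: atLeastAtMost_iff)
  then show ?thesis
    using good(1) t by (subst path_exit_time_gt_iff) (auto simp: good_path_def)
qed

text \<open>By the Markov property at time \<open>t\<close>, the process in question is \<open>P(exit into E | F t)\<close>.\<close>

theorem harmonic_exit_prob:
  assumes E: "open E" "E \<inter> ball 0 1 = {}"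
  shows "harmonic P W (ball 0 1) (exit_prob P W (ball 0 1) E)"
  unfolding harmonic_def
proof
  fix w :: "real^'n" assume "w \<in> ball 0 1"
  then have w: "norm w < 1" by simp
  let ?h = "exit_prob P W (ball 0 1) E"
  let ?M = "completion (P w)" and ?F = "augmented_filtration (P w) W"
  define Y where "Y t \<omega> = ?h (W (real_of_ereal (min (ereal t) (exit_time W (ball 0 1) \<omega>))) \<omega>)" for t \<omega>
  interpret C: prob_space ?M
    by (rule prob_spaceI) (simp add: P.emeasure_space_1)
  define alive where "alive t = {f \<in> space (past_paths t). (\<forall>s\<in>\<rat> \<inter> {0..t}. norm (w + vec_path f s) < 1) \<and> norm (w + vec_path f t) < 1}" for t
  define gr where "gr t = {f \<in> space (past_paths t). grid_exits_open t E (\<lambda>s. w + vec_path f s)}" for t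
  define Q where "Q t = {z \<in> space (past_paths t \<Otimes>\<^sub>M future_paths). grid_exits_ever E (\<lambda>s. (w + vec_path (fst z) t) + vec_path (snd z) s)}" for t
  \<comment> \<open>The stopped process as a function of the past path. A path alive at
    \<open>t\<close> exits into \<open>E\<close> with the probability seen from its current
    position; for any other path it is already decided whether it has.\<close>
  define Yhat where "Yhat t f = (if f \<in> alive t then exit_fun E (w + vec_path f t) else indicator (gr t) f)" for t f
  have alive: "alive t \<in> sets (past_paths t)" if t: "0 \<le> t" for t
  proof -
    have n: "Measurable.pred (past_paths t) (\<lambda>f. norm (w + vec_path f s) < 1)" if "0 \<le> s" "s \<le> t" for s
      using vec_path_measurable_past[OF that] by measurable
    show ?thesis unfolding alive_def
      by (rule predE) (intro pred_intros_logic pred_ball_countable countable_Rats_Int n; use t in auto)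
  qed
  have gr: "gr t \<in> sets (past_paths t)" if t: "0 \<le> t" for t
    unfolding gr_def
    by (rule predE[OF pred_grid_exits_open]) (intro borel_measurable_add borel_measurable_const vec_path_measurable_past, assumption+, rule t)
  have Q: "Q t \<in> sets (past_paths t \<Otimes>\<^sub>M future_paths)" if t: "0 \<le> t" for t
    unfolding Q_def
  proof (rule predE[OF pred_grid_exits_ever])
    fix s :: real assume "0 \<le> s"
    note [measurable] = vec_path_measurable_future[OF this] vec_path_measurable_past[OF t order_refl]
    show "(\<lambda>z. (w + vec_path (fst z) t) + vec_path (snd z) s) \<in> borel_measurable (past_paths t \<Otimes>\<^sub>M future_paths)"
      by measurable
  qed
  have Yhat: "Yhat t \<in> borel_measurable (past_paths t)" if t: "0 \<le> t" for t
  proof -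
    note [measurable] = alive[OF t] gr[OF t] vec_path_measurable_past[OF t order_refl]
    show ?thesis unfolding Yhat_def[abs_def] by measurable
  qed
  have past_space: "past t \<omega> \<in> space (past_paths t)" "future t \<omega> \<in> space future_paths" if "0 \<le> t" "\<omega> \<in> space (P w)" for t \<omega>
    using measurable_space[OF past_measurable[OF that(1)] that(2)] measurable_space[OF future_measurable[OF that(1)] that(2)] .
  have grW: "past t \<omega> \<in> gr t \<longleftrightarrow> grid_exits_open t E (\<lambda>s. W s \<omega>)" if "0 \<le> t" "\<omega> \<in> space (P w)" "W 0 \<omega> = w" for t \<omega>
  proof -
    have "grid_exits_open t E (\<lambda>s. w + vec_path (past t \<omega>) s) = grid_exits_open t E (\<lambda>s. W s \<omega>)"
      using that by (intro grid_exits_open_cong) (auto simp: vec_path_past)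
    then show ?thesis using past_space[OF that(1,2)] by (simp add: gr_def)
  qed
  have aliveW: "past t \<omega> \<in> alive t \<longleftrightarrow> ereal t < path_exit_time (ball 0 1) (\<lambda>s. W s \<omega>)"
    if "0 \<le> t" "\<omega> \<in> space (P w)" "good_path (\<lambda>s. W s \<omega>)" "W 0 \<omega> = w" for t \<omega>
    using past_alive_iff[OF that(1,3,4)] past_space[OF that(1,2)] by (simp add: alive_def)
  have Y_AE: "AE \<omega> in P w. Y t \<omega> = Yhat t (past t \<omega>)" if t: "0 \<le> t" for t
    using AE_good_path[OF w] AE_space
  proof eventually_elim
    case (elim \<omega>)
    let ?v = "\<lambda>s. W s \<omega>"
    have good: "good_path ?v" "W 0 \<omega> = w" and rc: "right_continuous ?v" using elim by (auto simp: good_path_def)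
    have wp: "w + vec_path (past t \<omega>) t = W t \<omega>" using t good(2) by (simp add: vec_path_past)
    show ?case
    proof (cases "ereal t < path_exit_time (ball 0 1) ?v")
      case True
      then have "norm (W t \<omega>) < 1" using aliveW[OF t elim(2) good] wp by (simp add: alive_def)
      moreover have "min (ereal t) (path_exit_time (ball 0 1) ?v) = ereal t" using True by simp
      ultimately show ?thesis
        using True aliveW[OF t elim(2) good] wp exit_prob_eq_exit_fun[OF _ E]
        by (simp add: Y_def Yhat_def exit_time_eq_path_exit_time)
    next
      case False
      then obtain \<tau> where \<tau>: "path_exit_time (ball 0 1) ?v = ereal \<tau>" "\<tau> \<le> t" "1 \<le> norm (?v \<tau>)"
        by (cases rule: path_exit_time_cases[OF rc open_ball[of 0 1]]) auto
      have "past t \<omega> \<in> gr t \<longleftrightarrow> W \<tau> \<omega> \<in> E"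
        unfolding grW[OF t elim(2) good(2)] exit_by_iff_grid_exits_open[OF good(1) E t, symmetric] using \<tau> by auto
      then have "indicator (gr t) (past t \<omega>) = (indicator E (W \<tau> \<omega>) :: real)" by (simp add: indicator_def)
      then show ?thesis
        using False \<tau> aliveW[OF t elim(2) good] exit_prob_outside[OF \<tau>(3), of E]
        by (simp add: Y_def Yhat_def exit_time_eq_path_exit_time)
    qed
  qed
  \<comment> \<open>The exit event splits in the same way, with the future path in place of its
    probability; integrating out the future therefore yields \<open>Yhat\<close>.\<close>
  have G_AE: "AE \<omega> in P w. indicator (exit_event E w) \<omega> =
      (if past t \<omega> \<in> alive t then indicator (Q t) (past t \<omega>, future t \<omega>) else indicator (gr t) (past t \<omega>) :: real)" if t: "0 \<le> t" for t
    using AE_good_path[OF w] AE_good_future[OF w t] AE_space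
  proof eventually_elim
    case (elim \<omega>)
    let ?v = "\<lambda>s. W s \<omega>"
    have good: "good_path ?v" "W 0 \<omega> = w" and rc: "right_continuous ?v" using elim by (auto simp: good_path_def)
    have wp: "w + vec_path (past t \<omega>) t = W t \<omega>" using t good(2) by (simp add: vec_path_past)
    show ?case
    proof (cases "ereal t < path_exit_time (ball 0 1) ?v")
      case True
      from exits_into_shift[OF rc t True] elim(2)
      have "exits_into E ?v \<longleftrightarrow> grid_exits_ever E (\<lambda>s. W (t + s) \<omega>)"
        using exits_into_iff_grid_exits_ever[OF _ E] by blast
      also have "\<dots> \<longleftrightarrow> grid_exits_ever E (\<lambda>s. (w + vec_path (past t \<omega>) t) + vec_path (future t \<omega>) s)"
        unfolding wp by (intro grid_exits_ever_cong) (simp add: vec_path_future)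
      finally show ?thesis
        using True aliveW[OF t elim(3) good] past_space[OF t elim(3)] elim(3)
        by (simp add: Q_def exit_event_def space_pair_measure indicator_def)
    next
      case False
      then obtain \<tau> where \<tau>: "path_exit_time (ball 0 1) ?v = ereal \<tau>" "\<tau> \<le> t" "1 \<le> norm (?v \<tau>)"
        by (cases rule: path_exit_time_cases[OF rc open_ball[of 0 1]]) auto
      have "past t \<omega> \<in> gr t \<longleftrightarrow> W \<tau> \<omega> \<in> E"
        unfolding grW[OF t elim(3) good(2)] exit_by_iff_grid_exits_open[OF good(1) E t, symmetric] using \<tau> by auto
      then show ?thesis
        using False \<tau> aliveW[OF t elim(3) good] elim(3)
        by (simp add: exit_event_def exits_into_def indicator_def)
    qed
  qed
  have Y_meas: "Y t \<in> borel_measurable (?F t)" if t: "0 \<le> t" for t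
    by (rule augmented_measurable_AE_eq[OF measurable_compose[OF past_augmented[OF t] Yhat[OF t]] Y_AE[OF t]])
  have Y_meas': "Y t \<in> borel_measurable ?M" if t: "0 \<le> t" for t
    using measurable_from_subalg[OF subalgebra_augmented Y_meas[OF t]] .
  have Y_int: "integrable ?M (Y t)" if t: "0 \<le> t" for t
    using Y_meas'[OF t] exit_prob_bounds by (intro C.integrable_const_bound[where B=1]) (auto simp: Y_def)
  have G: "exit_event E w \<in> sets ?M" by (rule exit_event_in_completion[OF w E])
  have G_int: "integrable ?M (indicator (exit_event E w) :: 'w \<Rightarrow> real)"
    using G by (intro C.integrable_const_bound[where B=1]) auto
  \<comment> \<open>The stopped process is the conditional probability of one fixed event, so the
    martingale property becomes the tower property.\<close>
  have cond: "AE \<omega> in ?M. real_cond_exp ?M (?F t) (indicator (exit_event E w)) \<omega> = Y t \<omega>" if t: "0 \<le> t" for t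
  proof -
    interpret S: finite_measure_subalgebra ?M "?F t"
      by unfold_locales (rule subalgebra_augmented)
    note pm[measurable] = past_measurable[OF t, of w] and fm[measurable] = future_measurable[OF t, of w]
    note [measurable] = alive[OF t] gr[OF t] Q[OF t] Yhat[OF t]
    show ?thesis
    proof (rule S.real_cond_exp_charact)
      fix A assume A: "A \<in> sets (?F t)"
      then have AM: "A \<in> sets ?M" using subalgebra_augmented[of w t] by (auto simp: subalgebra_def)
      obtain C where C[measurable]: "C \<in> sets (past_paths t)" and CA: "AE \<omega> in P w. \<omega> \<in> A \<longleftrightarrow> past t \<omega> \<in> C"
        using augmented_AE_past[OF t A] by blast
      let ?rest = "\<lambda>\<omega>. indicator (C \<inter> gr t - alive t) (past t \<omega>) :: real"
      have i1: "integrable (P w) ?rest" by (intro P.integrable_const_bound[where B=1]) auto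
      have i2: "integrable (P w) (\<lambda>\<omega>. indicator (C \<inter> alive t) (past t \<omega>) * indicator (Q t) (past t \<omega>, future t \<omega>) :: real)"
        by (intro P.integrable_const_bound[where B=1]) (auto simp: indicator_def)
      have mef: "(\<lambda>\<omega>. exit_fun E (w + vec_path (past t \<omega>) t)) \<in> borel_measurable (P w)"
        using vec_path_measurable_past[OF t order_refl] by measurable
      have i3: "integrable (P w) (\<lambda>\<omega>. indicator (C \<inter> alive t) (past t \<omega>) * exit_fun E (w + vec_path (past t \<omega>) t))"
        using mef exit_fun_bounds by (intro P.integrable_const_bound[where B=1]) (auto simp: indicator_def)
      have "(\<integral>\<omega>\<in>A. indicator (exit_event E w) \<omega> \<partial>?M) =
        (\<integral>\<omega>. indicator (C \<inter> alive t) (past t \<omega>) * indicator (Q t) (past t \<omega>, future t \<omega>) + ?rest \<omega> \<partial>?M)"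
        unfolding set_lebesgue_integral_def
      proof (rule integral_cong_AE)
        show "AE \<omega> in ?M. indicator A \<omega> *\<^sub>R indicator (exit_event E w) \<omega> =
          indicator (C \<inter> alive t) (past t \<omega>) * indicator (Q t) (past t \<omega>, future t \<omega>) + ?rest \<omega>"
          using AE_completion[OF CA] AE_completion[OF G_AE[OF t]]
          by eventually_elim (auto simp: indicator_def split: if_splits)
        show "(\<lambda>\<omega>. indicator A \<omega> *\<^sub>R indicator (exit_event E w) \<omega> :: real) \<in> borel_measurable ?M" using AM G by measurable
        show "(\<lambda>\<omega>. indicator (C \<inter> alive t) (past t \<omega>) * indicator (Q t) (past t \<omega>, future t \<omega>) + ?rest \<omega>) \<in> borel_measurable ?M"
          by (rule measurable_completion) (use i1 i2 in auto)
      qed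
      also have "\<dots> = (\<integral>\<omega>. indicator (C \<inter> alive t) (past t \<omega>) * indicator (Q t) (past t \<omega>, future t \<omega>) + ?rest \<omega> \<partial>P w)"
        by (rule integral_completion) (use i1 i2 in auto)
      also have "\<dots> = (\<integral>\<omega>. indicator (C \<inter> alive t) (past t \<omega>) * indicator (Q t) (past t \<omega>, future t \<omega>) \<partial>P w) + (\<integral>\<omega>. ?rest \<omega> \<partial>P w)"
        by (rule Bochner_Integration.integral_add[OF i2 i1])
      \<comment> \<open>Here the future is integrated out; the section probability is then
        recognised as \<open>exit_fun\<close> at the current position.\<close>
      also have "(\<integral>\<omega>. indicator (C \<inter> alive t) (past t \<omega>) * indicator (Q t) (past t \<omega>, future t \<omega>) \<partial>P w) =
          (\<integral>\<omega>. indicator (C \<inter> alive t) (past t \<omega>) * measure (distr (P w) future_paths (future t)) (Pair (past t \<omega>) -` Q t) \<partial>P w)"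
        by (rule P.indep_var_integral_section[OF markov[OF t] _ Q[OF t]]) measurable
      also have "\<dots> = (\<integral>\<omega>. indicator (C \<inter> alive t) (past t \<omega>) * exit_fun E (w + vec_path (past t \<omega>) t) \<partial>P w)"
      proof (intro Bochner_Integration.integral_cong refl arg_cong2[where f="(*)"])
        fix \<omega> assume \<omega>: "\<omega> \<in> space (P w)"
        have "Pair (past t \<omega>) -` Q t = {f \<in> space future_paths. grid_exits_ever E (\<lambda>s. (w + vec_path (past t \<omega>) t) + vec_path f s)}"
          using past_space[OF t \<omega>] by (auto simp: Q_def space_pair_measure)
        then show "measure (distr (P w) future_paths (future t)) (Pair (past t \<omega>) -` Q t) = exit_fun E (w + vec_path (past t \<omega>) t)"
          by (simp add: exit_fun_def distr_future[OF t])
      qed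
      also have "\<dots> + (\<integral>\<omega>. ?rest \<omega> \<partial>P w) =
          (\<integral>\<omega>. indicator (C \<inter> alive t) (past t \<omega>) * exit_fun E (w + vec_path (past t \<omega>) t) + ?rest \<omega> \<partial>P w)"
        by (rule Bochner_Integration.integral_add[OF i3 i1, symmetric])
      also have "\<dots> = (\<integral>\<omega>. indicator (C \<inter> alive t) (past t \<omega>) * exit_fun E (w + vec_path (past t \<omega>) t) + ?rest \<omega> \<partial>?M)"
        by (rule integral_completion[symmetric]) (use i1 i3 in auto)
      also have "\<dots> = (\<integral>\<omega>\<in>A. Y t \<omega> \<partial>?M)"
        unfolding set_lebesgue_integral_def
      proof (rule integral_cong_AE)
        show "AE \<omega> in ?M. indicator (C \<inter> alive t) (past t \<omega>) * exit_fun E (w + vec_path (past t \<omega>) t) + ?rest \<omega> =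
          indicator A \<omega> *\<^sub>R Y t \<omega>"
          using AE_completion[OF CA] AE_completion[OF Y_AE[OF t]]
          by eventually_elim (auto simp: indicator_def Yhat_def split: if_splits)
        show "(\<lambda>\<omega>. indicator A \<omega> *\<^sub>R Y t \<omega>) \<in> borel_measurable ?M" using AM Y_meas'[OF t] by measurable
        show "(\<lambda>\<omega>. indicator (C \<inter> alive t) (past t \<omega>) * exit_fun E (w + vec_path (past t \<omega>) t) + ?rest \<omega>) \<in> borel_measurable ?M"
          by (rule measurable_completion) (use i1 i3 in auto)
      qed
      finally show "(\<integral>\<omega>\<in>A. indicator (exit_event E w) \<omega> \<partial>?M) = (\<integral>\<omega>\<in>A. Y t \<omega> \<partial>?M)" .
    qed (use G_int Y_int[OF t] Y_meas[OF t] in auto)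
  qed
  have "AE \<omega> in ?M. real_cond_exp ?M (?F s) (Y t) \<omega> = Y s \<omega>" if st: "0 \<le> s" "s \<le> t" for s t
  proof -
    have t: "0 \<le> t" using st by simp
    interpret S: finite_measure_subalgebra ?M "?F s"
      by unfold_locales (rule subalgebra_augmented)
    have sub: "subalgebra (?F t) (?F s)"
      using augmented_mono[OF st(2)] by (simp add: subalgebra_def space_augmented)
    have "AE \<omega> in ?M. real_cond_exp ?M (?F s) (real_cond_exp ?M (?F t) (indicator (exit_event E w))) \<omega> =
        real_cond_exp ?M (?F s) (indicator (exit_event E w)) \<omega>"
      by (rule S.real_cond_exp_nested_subalg[OF subalgebra_augmented sub G_int])
    moreover have "AE \<omega> in ?M. real_cond_exp ?M (?F s) (real_cond_exp ?M (?F t) (indicator (exit_event E w))) \<omega> =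
        real_cond_exp ?M (?F s) (Y t) \<omega>"
      by (rule S.real_cond_exp_cong[OF cond[OF t]]) (use Y_meas'[OF t] in auto)
    ultimately show ?thesis using cond[OF st(1)] by eventually_elim simp
  qed
  then show "martingale ?M ?F (\<lambda>t \<omega>. ?h (W (real_of_ereal (min (ereal t) (exit_time W (ball 0 1) \<omega>))) \<omega>))"
    unfolding martingale_def Y_def[symmetric]
    using filtration_augmented subalgebra_augmented Y_meas Y_int by auto
qed

end

section \<open>Estimates of the exit probability\<close>

lemma (in prob_space) prob_ge_limsup:
  assumes A: "\<And>n. A n \<in> events" and p: "\<And>n. p \<le> prob (A n)"
  shows "p \<le> prob (\<Inter>N. \<Union>n\<in>{N::nat..}. A n)"
proof -
  have "(\<lambda>N. prob (\<Union>n\<in>{N..}. A n)) \<longlonglongrightarrow> prob (\<Inter>N. \<Union>n\<in>{N..}. A n)"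
  proof (rule finite_Lim_measure_decseq)
    show "range (\<lambda>N. \<Union>n\<in>{N..}. A n) \<subseteq> events" using A by auto
    show "decseq (\<lambda>N. \<Union>n\<in>{N..}. A n)" by (force simp: decseq_def)
  qed
  moreover have "p \<le> prob (\<Union>n\<in>{N..}. A n)" for N
    by (rule order_trans[OF p[of N] finite_measure_mono]) (use A in auto)
  ultimately show ?thesis by (intro LIMSEQ_le_const) auto
qed

lemma (in prob_space) prob_le_liminf:
  assumes A: "\<And>n. A n \<in> events" and p: "\<And>n. prob (A n) \<le> p"
  shows "prob (\<Union>N. \<Inter>n\<in>{N::nat..}. A n) \<le> p"
proof -
  have m: "(\<Inter>n\<in>{N..}. A n) \<in> events" for N using A by (intro sets.countable_INT) auto
  have "(\<lambda>N. prob (\<Inter>n\<in>{N..}. A n)) \<longlonglongrightarrow> prob (\<Union>N. \<Inter>n\<in>{N..}. A n)"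
  proof (rule finite_Lim_measure_incseq)
    show "range (\<lambda>N. \<Inter>n\<in>{N..}. A n) \<subseteq> events" using m by auto
    show "incseq (\<lambda>N. \<Inter>n\<in>{N..}. A n)" by (force simp: incseq_def)
  qed
  moreover have "prob (\<Inter>n\<in>{N..}. A n) \<le> p" for N
    by (rule order_trans[OF finite_measure_mono p[of N]]) (use A in auto)
  ultimately show ?thesis by (intro LIMSEQ_le_const2) auto
qed

definition grid_exit_at :: "nat \<Rightarrow> real \<Rightarrow> 'a set \<Rightarrow> (real \<Rightarrow> 'a::real_normed_vector) \<Rightarrow> bool" where
  "grid_exit_at n T K v \<longleftrightarrow> (\<exists>k<n. (\<forall>j\<le>k. norm (v (real j * T / real n)) < 1) \<and> v (real (Suc k) * T / real n) \<in> K)"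

section \<open>Grid events of independent coordinates\<close>

context stable_family
begin

lemma prob_coord_paths:
  assumes t: "0 \<le> t" and B: "\<And>j. B j \<in> sets (path_index t j)"
  shows "P.prob w {\<omega> \<in> space (P w). \<forall>j. coord_path t j \<omega> \<in> B j} =
    (\<Prod>j\<in>UNIV. P.prob w {\<omega> \<in> space (P w). coord_path t j \<omega> \<in> B j})"
proof -
  have "P.prob w (\<Inter>j\<in>UNIV. coord_path t j -` B j \<inter> space (P w)) =
    (\<Prod>j\<in>UNIV. P.prob w (coord_path t j -` B j \<inter> space (P w)))"
    by (rule P.indep_varsD[OF indep_coord_paths[OF t]]) (use B in auto)
  moreover have "(\<Inter>j\<in>UNIV. coord_path t j -` B j \<inter> space (P w)) = {\<omega> \<in> space (P w). \<forall>j. coord_path t j \<omega> \<in> B j}"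
    by auto
  moreover have "coord_path t j -` B j \<inter> space (P w) = {\<omega> \<in> space (P w). coord_path t j \<omega> \<in> B j}" for j
    by auto
  ultimately show ?thesis by simp
qed

lemma prob_past_future:
  assumes t: "0 \<le> t"
    and A: "\<And>i. Measurable.pred (PiM {0..t} (\<lambda>_. borel)) (A i)"
    and B: "\<And>i. Measurable.pred (PiM {0..} (\<lambda>_. borel)) (B i)"
  shows "P.prob w {\<omega> \<in> space (P w). \<forall>i. A i (coord_path t (i, False) \<omega>) \<and> B i (coord_path t (i, True) \<omega>)} =
    (\<Prod>i\<in>UNIV. P.prob w {\<omega> \<in> space (P w). A i (coord_path t (i, False) \<omega>)} *
      P.prob w {\<omega> \<in> space (P w). B i (coord_path t (i, True) \<omega>)})"
proof -
  define D where "D j = (if snd j then {f \<in> space (path_index t j). B (fst j) f} else {f \<in> space (path_index t j). A (fst j) f})" for j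
  have D: "D j \<in> sets (path_index t j)" for j
    using A[of "fst j"] B[of "fst j"] by (auto simp: D_def path_index_def pred_def)
  have sp: "coord_path t j \<omega> \<in> space (path_index t j)" if "\<omega> \<in> space (P w)" for j \<omega>
    using measurable_space[OF coord_path_measurable[OF t] that] .
  have e1: "{\<omega> \<in> space (P w). \<forall>i. A i (coord_path t (i, False) \<omega>) \<and> B i (coord_path t (i, True) \<omega>)} =
      {\<omega> \<in> space (P w). \<forall>j. coord_path t j \<omega> \<in> D j}"
    using sp by (auto simp: D_def)
  have e2: "{\<omega> \<in> space (P w). A i (coord_path t (i, False) \<omega>)} = {\<omega> \<in> space (P w). coord_path t (i, False) \<omega> \<in> D (i, False)}"
    "{\<omega> \<in> space (P w). B i (coord_path t (i, True) \<omega>)} = {\<omega> \<in> space (P w). coord_path t (i, True) \<omega> \<in> D (i, True)}" for i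
    using sp by (auto simp: D_def)
  have "(\<Prod>j\<in>UNIV. P.prob w {\<omega> \<in> space (P w). coord_path t j \<omega> \<in> D j}) =
      (\<Prod>i\<in>UNIV. \<Prod>b\<in>UNIV. P.prob w {\<omega> \<in> space (P w). coord_path t (i, b) \<omega> \<in> D (i, b)})"
    by (simp add: prod.cartesian_product UNIV_Times_UNIV[symmetric] del: UNIV_Times_UNIV)
  then show ?thesis
    unfolding e1 e2 prob_coord_paths[OF t D] by (simp add: UNIV_bool)
qed

lemma prob_coords:
  assumes B: "\<And>i. Measurable.pred (PiM {0..} (\<lambda>_. borel)) (B i)"
  shows "P.prob w {\<omega> \<in> space (P w). \<forall>i. B i (coord_path 0 (i, True) \<omega>)} =
    (\<Prod>i\<in>UNIV. P.prob w {\<omega> \<in> space (P w). B i (coord_path 0 (i, True) \<omega>)})"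
  using prob_past_future[of 0 "\<lambda>_ _. True" B w, OF order_refl _ B] by (simp add: P.prob_space)

lemma coord_path_True: "0 \<le> s \<Longrightarrow> coord_path t (i, True) \<omega> s = W (t + s) \<omega> $ i - W t \<omega> $ i"
  by (simp add: coord_path_def)

lemma coord_path_False: "0 \<le> s \<Longrightarrow> s \<le> t \<Longrightarrow> coord_path t (i, False) \<omega> s = W s \<omega> $ i - W 0 \<omega> $ i"
  by (simp add: coord_path_def)

definition steps :: "real \<Rightarrow> real \<Rightarrow> 'n \<Rightarrow> nat \<Rightarrow> 'w \<Rightarrow> real" where
  "steps t d i j \<omega> = W (t + real j * d) \<omega> $ i - W t \<omega> $ i"

lemma walk_eq_steps:
  "stable_process.walk (\<lambda>t \<omega>. W t \<omega> $ i - w $ i) t d j \<omega> = steps t d i j \<omega>"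
proof -
  interpret X: stable_process \<alpha> \<kappa> "P w" "\<lambda>t \<omega>. W t \<omega> $ i - w $ i" by (rule coord_stable_process)
  show ?thesis by (simp add: X.walk_def steps_def)
qed

lemmas steps_maximal = stable_process.walk_maximal[OF coord_stable_process, unfolded walk_eq_steps]
lemmas steps_jump_landing = stable_process.walk_jump_landing[OF coord_stable_process, unfolded walk_eq_steps]
lemmas steps_reaches_interval = stable_process.walk_reaches_interval[OF coord_stable_process, unfolded walk_eq_steps]

lemma steps_measurable: "0 \<le> t \<Longrightarrow> 0 \<le> d \<Longrightarrow> steps t d i j \<in> borel_measurable (P w)"
  unfolding steps_def[abs_def] by (intro borel_measurable_diff coord_measurable) auto

lemma steps_stay:
  assumes t: "0 \<le> t" "0 \<le> d" and r: "0 < r"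
  shows "1 - 2 * (tail_const * (real n * d) * r powr (- \<alpha>)) \<le> P.prob w {\<omega> \<in> space (P w). \<forall>j\<le>n. \<bar>steps t d i j \<omega>\<bar> < 2 * r}"
proof -
  note [measurable] = steps_measurable[OF t]
  have "{\<omega> \<in> space (P w). \<forall>j\<le>n. \<bar>steps t d i j \<omega>\<bar> < 2 * r} = space (P w) - {\<omega> \<in> space (P w). \<exists>j\<le>n. 2 * r \<le> \<bar>steps t d i j \<omega>\<bar>}"
    by (auto simp: not_le)
  moreover have "P.prob w (space (P w) - {\<omega> \<in> space (P w). \<exists>j\<le>n. 2 * r \<le> \<bar>steps t d i j \<omega>\<bar>}) =
      1 - P.prob w {\<omega> \<in> space (P w). \<exists>j\<le>n. 2 * r \<le> \<bar>steps t d i j \<omega>\<bar>}"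
    by (rule P.prob_compl) measurable
  ultimately show ?thesis using steps_maximal[OF t r, where n=n and i=i and w=w] by simp
qed

lemma grid_exit_at_event:
  assumes T: "0 \<le> T" and K: "closed K"
  shows "{\<omega> \<in> space (P w). grid_exit_at m T K (\<lambda>s. x + (W s \<omega> - W 0 \<omega>))} \<in> P.events w"
proof -
  have v: "(\<lambda>\<omega>. x + (W s \<omega> - W 0 \<omega>)) \<in> borel_measurable (P w)" if "0 \<le> s" for s
    using that by (intro borel_measurable_add borel_measurable_diff W_measurable) auto
  have n: "Measurable.pred (P w) (\<lambda>\<omega>. norm (x + (W (real j * T / real m) \<omega> - W 0 \<omega>)) < 1)" for j
    using T by (intro borel_measurable_pred_less measurable_compose[OF v borel_measurable_norm]) auto
  have k: "Measurable.pred (P w) (\<lambda>\<omega>. x + (W (real j * T / real m) \<omega> - W 0 \<omega>) \<in> K)" for j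
    using T by (intro pred_sets2[OF borel_closed[OF K]] v) auto
  show ?thesis unfolding grid_exit_at_def
    by (rule predE) (intro pred_intros_logic pred_intros_countable n k; simp)
qed

text \<open>A bound \<open>p\<close> uniform in the mesh passes to the upper limit of the grid
  events, on which the path exits into \<open>K\<close> by \<open>grid_exitsD\<close>. The factor
  \<open>c\<close> restricts to numbers of steps divisible by \<open>c\<close>, so that a
  construction in \<open>c\<close> phases of equal length fits the grid.\<close>

lemma exit_prob_ge_grid:
  assumes w: "norm w < 1" and E: "open E" "E \<inter> ball 0 1 = {}" and K: "closed K" "K \<subseteq> E"
    and T: "0 \<le> T" and c: "0 < c"
    and p: "\<And>n. 0 < n \<Longrightarrow> p \<le> P.prob w {\<omega> \<in> space (P w). grid_exit_at (c * n) T K (\<lambda>s. w + (W s \<omega> - W 0 \<omega>))}"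
  shows "p \<le> exit_prob P W (ball 0 1) E w"
proof -
  define A where "A n = {\<omega> \<in> space (P w). grid_exit_at (c * Suc n) T K (\<lambda>s. w + (W s \<omega> - W 0 \<omega>))}" for n
  have A: "A n \<in> P.events w" for n
    unfolding A_def by (rule grid_exit_at_event[OF T K(1)])
  have "p \<le> P.prob w (\<Inter>N. \<Union>n\<in>{N..}. A n)"
    by (rule P.prob_ge_limsup[OF A]) (unfold A_def, rule p, simp)
  also have "\<dots> = measure (completion (P w)) (\<Inter>N. \<Union>n\<in>{N..}. A n)"
    using A by (intro measure_completion[symmetric]) auto
  also have "\<dots> \<le> measure (completion (P w)) (exit_event E w)"
  proof -
    interpret C: prob_space "completion (P w)" by (rule prob_spaceI) (simp add: P.emeasure_space_1)
    show ?thesis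
    proof (rule C.finite_measure_mono_AE)
      show "AE \<omega> in completion (P w). \<omega> \<in> (\<Inter>N. \<Union>n\<in>{N..}. A n) \<longrightarrow> \<omega> \<in> exit_event E w"
        using AE_completion[OF AE_good_path[OF w]]
      proof eventually_elim
        case (elim \<omega>)
        show ?case
        proof
          assume \<omega>: "\<omega> \<in> (\<Inter>N. \<Union>n\<in>{N..}. A n)"
          then obtain n where "\<omega> \<in> A n" by blast
          then have sp: "\<omega> \<in> space (P w)" by (simp add: A_def)
          have g: "grid_exits T K (\<lambda>s. W s \<omega>)"
            unfolding grid_exits_def
          proof
            fix N
            have "\<omega> \<in> (\<Union>n\<in>{N..}. A n)" using \<omega> by (rule INT_E[of _ _ _ N]) simp_all
            then obtain n where n: "N \<le> n" "\<omega> \<in> A n" by auto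
            have eq: "w + (W s \<omega> - W 0 \<omega>) = W s \<omega>" for s using elim by simp
            have "grid_exit_at (c * Suc n) T K (\<lambda>s. W s \<omega>)" using n(2) by (simp only: A_def mem_Collect_eq eq)
            moreover have "Suc n \<le> c * Suc n" using mult_le_mono1[of 1 c "Suc n"] c by simp
            then have "N \<le> c * Suc n" using n(1) by linarith
            ultimately show "\<exists>n\<ge>N. \<exists>k<n. (\<forall>j\<le>k. norm (W (real j * T / real n) \<omega>) < 1) \<and> W (real (Suc k) * T / real n) \<omega> \<in> K"
              unfolding grid_exit_at_def by (rule_tac exI[of _ "c * Suc n"], rule_tac conjI)
          qed
          have rc: "right_continuous (\<lambda>s. W s \<omega>)" and nt: "\<And>q. q \<in> \<rat> \<Longrightarrow> 0 < q \<Longrightarrow> \<not> touches_sphere q (\<lambda>s. W s \<omega>)"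
            using elim by (simp_all add: good_path_def)
          have "K \<inter> ball 0 1 = {}" using K(2) E(2) by blast
          from grid_exitsD[OF rc T K(1) this nt g] obtain \<tau> where
            "path_exit_time (ball 0 1) (\<lambda>s. W s \<omega>) = ereal \<tau>" "W \<tau> \<omega> \<in> K" by metis
          then show "\<omega> \<in> exit_event E w" using sp K(2) by (auto simp: exit_event_def exits_into_def)
        qed
      qed
    qed (rule exit_event_in_completion[OF w E])
  qed
  finally show ?thesis by (simp add: exit_prob_eq_exit_event)
qed

end

lemma pred_path_component:
  assumes "s \<in> I" "S \<in> sets borel"
  shows "Measurable.pred (PiM I (\<lambda>_. borel)) (\<lambda>f. f s \<in> S)"
  by (rule pred_sets2[OF assms(2) measurable_component_singleton[OF assms(1)]])

lemma pred_steps_stay: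
  assumes "\<And>j. j \<le> n \<Longrightarrow> real j * d \<in> I"
  shows "Measurable.pred (PiM I (\<lambda>_. borel)) (\<lambda>f. \<forall>j\<le>n. \<bar>f (real j * d) + c\<bar> < (r :: real))"
proof -
  have S: "{x::real. \<bar>x + c\<bar> < r} \<in> sets borel" by measurable
  have "Measurable.pred (PiM I (\<lambda>_. borel)) (\<lambda>f. \<forall>j\<in>{..n}. f (real j * d) \<in> {x. \<bar>x + c\<bar> < r})"
    by (rule pred_intros_finite(3)[OF finite_atMost]) (rule pred_path_component[OF assms S], simp only: atMost_iff)
  then show ?thesis by (simp only: Ball_def atMost_iff mem_Collect_eq)
qed

lemma pred_steps_jump:
  assumes "\<And>j. real j * d \<in> I"
  shows "Measurable.pred (PiM I (\<lambda>_. borel)) (\<lambda>f. \<exists>k<n. (\<forall>i\<le>k. \<bar>f (real i * d)\<bar> < (r::real)) \<and>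
    a \<le> f (real (Suc k) * d) \<and> f (real (Suc k) * d) \<le> b)"
proof -
  have [measurable]: "(\<lambda>f. f (real j * d)) \<in> borel_measurable (PiM I (\<lambda>_. borel :: real measure))" for j
    by (rule measurable_component_singleton[OF assms])
  show ?thesis by measurable
qed

lemma norm_vec3_less_1: "(norm (x::real^3) < 1) \<longleftrightarrow> (x$1)\<^sup>2 + (x$2)\<^sup>2 + (x$3)\<^sup>2 < 1"
  by (simp add: norm_vec_def L2_set_def sum_3)

lemma open_E_box: "open (E_box \<epsilon>)"
proof -
  have "E_box \<epsilon> = {w. 2 < w$1} \<inter> {w. w$1 < 4} \<inter> {w. -\<epsilon> < w$2} \<inter> {w. w$2 < \<epsilon>} \<inter> {w. -\<epsilon> < w$3} \<inter> {w. w$3 < \<epsilon>}"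
    by (auto simp: E_box_def)
  also have "open \<dots>" by (intro open_Int open_Collect_less continuous_intros)
  finally show ?thesis .
qed

lemma E_box_disjoint: "E_box \<epsilon> \<inter> ball 0 1 = {}"
proof -
  have "x \<notin> ball 0 1" if "x \<in> E_box \<epsilon>" for x
    using component_le_norm_cart[of x 1] that by (auto simp: E_box_def)
  then show ?thesis by blast
qed

text \<open>The range of the first coordinate allows for a jump into \<open>[22/10, 38/10]\<close>
  that starts within 1/10 of 0.\<close>

definition inner_box :: "real \<Rightarrow> (real^3) set" where
  "inner_box \<epsilon> = {w. 21/10 \<le> w$1 \<and> w$1 \<le> 39/10 \<and> \<bar>w$2\<bar> \<le> \<epsilon>/2 \<and> \<bar>w$3\<bar> \<le> \<epsilon>/2}"

lemma closed_inner_box: "closed (inner_box \<epsilon>)"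
  unfolding inner_box_def by (intro closed_Collect_conj closed_Collect_le continuous_intros)

lemma inner_box_subset: "0 < \<epsilon> \<Longrightarrow> inner_box \<epsilon> \<subseteq> E_box \<epsilon>"
  by (auto simp: inner_box_def E_box_def)

section \<open>Lower bound at the origin\<close>

locale stable_family3 = stable_family \<alpha> \<kappa> P W
  for \<alpha> \<kappa> :: real and P :: "real^3 \<Rightarrow> 'w measure" and W :: "real \<Rightarrow> 'w \<Rightarrow> real^3"
begin

lemma exit_prob_lower_bound:
  "\<exists>c>0. \<exists>\<epsilon>0>0. \<forall>\<epsilon>. 0 < \<epsilon> \<longrightarrow> \<epsilon> < \<epsilon>0 \<longrightarrow> c * \<epsilon> powr \<alpha> \<le> exit_prob P W (ball 0 1) (E_box \<epsilon>) 0"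
proof -
  from steps_jump_landing[of 0 1] obtain b \<delta> where b: "0 < b" "0 < \<delta>"
    and land: "\<forall>t d n. 0 \<le> t \<longrightarrow> 0 \<le> d \<longrightarrow> 0 < real n * d \<longrightarrow> real n * d < \<delta> \<longrightarrow>
    b * (real n * d) \<le> P.prob 0 {\<omega> \<in> space (P 0). \<exists>k<n. (\<forall>i\<le>k. \<bar>steps t d 1 i \<omega>\<bar> < 1/10) \<and>
      22/10 \<le> steps t d 1 (Suc k) \<omega> \<and> steps t d 1 (Suc k) \<omega> \<le> 38/10}"
    by (elim exE conjE) (rule that)
  \<comment> \<open>With this \<open>a\<close> the maximal inequality at time
    \<open>a * \<epsilon> powr \<alpha>\<close> and \<open>r = \<epsilon> / 4\<close> has the value
    1/2: a transverse coordinate stays within \<open>\<epsilon> / 2\<close> with probability at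
    least 1/2.\<close>
  define a where "a = 1 / (4 * tail_const * 4 powr \<alpha>)"
  have a: "0 < a" using tail_const_pos by (simp add: a_def)
  have "((\<lambda>\<epsilon>. a * \<epsilon> powr \<alpha>) \<longlongrightarrow> a * 0) (at_right 0)"
  proof (intro tendsto_mult tendsto_const tendsto_zero_powrI[where b=\<alpha>])
    show "((\<lambda>\<epsilon>. \<epsilon>) \<longlongrightarrow> 0) (at_right (0::real))" by (rule tendsto_ident_at)
    show "eventually (\<lambda>\<epsilon>. 0 \<le> \<epsilon>) (at_right (0::real))"
      by (rule eventually_mono[OF eventually_at_right_less]) simp
  qed (rule \<alpha>(1))
  then have "eventually (\<lambda>\<epsilon>. a * \<epsilon> powr \<alpha> < \<delta>) (at_right 0)"
    using b(2) by (intro order_tendstoD(2)) auto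
  then obtain e where e: "0 < e" "\<forall>\<epsilon>>0. \<epsilon> < e \<longrightarrow> a * \<epsilon> powr \<alpha> < \<delta>"
    unfolding eventually_at_right_field by blast
  have "b * a / 4 * \<epsilon> powr \<alpha> \<le> exit_prob P W (ball 0 1) (E_box \<epsilon>) 0" if \<epsilon>: "0 < \<epsilon>" "\<epsilon> < min e (1/2)" for \<epsilon>
  proof -
    define T where "T = a * \<epsilon> powr \<alpha>"
    have T: "0 < T" "T < \<delta>" using a \<epsilon> e(2) by (auto simp: T_def)
    have half: "2 * (tail_const * T * (\<epsilon>/4) powr (- \<alpha>)) = 1/2"
      using \<epsilon> tail_const_pos by (simp add: T_def a_def powr_divide powr_minus_divide field_simps)
    have "b * T / 4 \<le> P.prob 0 {\<omega> \<in> space (P 0). grid_exit_at (1 * n) T (inner_box \<epsilon>) (\<lambda>s. 0 + (W s \<omega> - W 0 \<omega>))}"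
      if n: "0 < n" for n :: nat
    proof -
      define d where "d = T / real n"
      have d: "0 \<le> d" "real n * d = T" using T n by (auto simp: d_def)
      have jd: "real j * T / real n = real j * d" for j by (simp add: d_def)
      define B where "B = (\<lambda>i::3. \<lambda>f. if i = 1 then
          (\<exists>k<n. (\<forall>i\<le>k. \<bar>f (real i * d)\<bar> < 1/10) \<and> 22/10 \<le> f (real (Suc k) * d) \<and> f (real (Suc k) * d) \<le> 38/10)
        else (\<forall>j\<le>n. \<bar>f (real j * d) + 0\<bar> < \<epsilon>/2))"
      have B: "Measurable.pred (PiM {0..} (\<lambda>_. borel)) (B i)" for i
        unfolding B_def using d(1) by (cases "i = 1") (auto intro!: pred_steps_jump pred_steps_stay)
      have s: "coord_path 0 (i, True) \<omega> (real j * d) = steps 0 d i j \<omega>" for i j \<omega>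
        using d(1) by (simp add: coord_path_True steps_def)
      have stay: "1/2 \<le> P.prob 0 {\<omega> \<in> space (P 0). B i (coord_path 0 (i, True) \<omega>)}" if "i \<noteq> 1" for i
        using steps_stay[OF order_refl d(1), of "\<epsilon>/4" n 0 i] \<epsilon> half that by (simp add: B_def s d(2))
      have jump: "b * T \<le> P.prob 0 {\<omega> \<in> space (P 0). B 1 (coord_path 0 (1, True) \<omega>)}"
        using land[rule_format, of 0 d n] d T unfolding B_def s by simp
      have "b * T / 4 = b * T * (1/2) * (1/2)" by simp
      also have "\<dots> \<le> (\<Prod>i\<in>UNIV. P.prob 0 {\<omega> \<in> space (P 0). B i (coord_path 0 (i, True) \<omega>)})"
      proof -
        have "b * T * (1/2) * (1/2) \<le> P.prob 0 {\<omega> \<in> space (P 0). B 1 (coord_path 0 (1, True) \<omega>)} *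
            P.prob 0 {\<omega> \<in> space (P 0). B 2 (coord_path 0 (2, True) \<omega>)} *
            P.prob 0 {\<omega> \<in> space (P 0). B 3 (coord_path 0 (3, True) \<omega>)}"
          by (intro mult_mono jump stay) (use b T in auto)
        then show ?thesis unfolding UNIV_3 by (simp add: mult.assoc)
      qed
      also have "\<dots> = P.prob 0 {\<omega> \<in> space (P 0). \<forall>i. B i (coord_path 0 (i, True) \<omega>)}"
        by (rule prob_coords[OF B, symmetric])
      also have "\<dots> \<le> P.prob 0 {\<omega> \<in> space (P 0). grid_exit_at (1 * n) T (inner_box \<epsilon>) (\<lambda>s. 0 + (W s \<omega> - W 0 \<omega>))}"
      proof (rule P.finite_measure_mono)
        show "{\<omega> \<in> space (P 0). \<forall>i. B i (coord_path 0 (i, True) \<omega>)} \<subseteq>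
            {\<omega> \<in> space (P 0). grid_exit_at (1 * n) T (inner_box \<epsilon>) (\<lambda>s. 0 + (W s \<omega> - W 0 \<omega>))}"
        proof (clarify)
          fix \<omega> assume all: "\<forall>i. B i (coord_path 0 (i, True) \<omega>)"
          from all[rule_format, of 1] obtain k where k: "k < n" "\<And>i. i \<le> k \<Longrightarrow> \<bar>steps 0 d 1 i \<omega>\<bar> < 1/10"
            "22/10 \<le> steps 0 d 1 (Suc k) \<omega>" "steps 0 d 1 (Suc k) \<omega> \<le> 38/10" unfolding B_def s by auto
          have yz: "\<bar>steps 0 d i j \<omega>\<bar> < \<epsilon>/2" if "i \<noteq> 1" "j \<le> n" for i j
            using all[rule_format, of i] that unfolding B_def s by simp
          have comp: "(0 + (W (real j * T / real n) \<omega> - W 0 \<omega>)) $ i = steps 0 d i j \<omega>" for i j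
            by (simp add: steps_def jd)
          have "norm (0 + (W (real j * T / real n) \<omega> - W 0 \<omega>)) < 1" if "j \<le> k" for j
          proof -
            have "(steps 0 d 1 j \<omega>)\<^sup>2 \<le> (1/10)\<^sup>2" "(steps 0 d 2 j \<omega>)\<^sup>2 \<le> (1/2)\<^sup>2" "(steps 0 d 3 j \<omega>)\<^sup>2 \<le> (1/2)\<^sup>2"
              using k(1) k(2)[OF that] yz[of 2 j] yz[of 3 j] that \<epsilon> by (auto simp: abs_le_square_iff[symmetric])
            then show ?thesis unfolding norm_vec3_less_1 comp by (simp add: power2_eq_square)
          qed
          moreover have "0 + (W (real (Suc k) * T / real n) \<omega> - W 0 \<omega>) \<in> inner_box \<epsilon>"
            unfolding inner_box_def mem_Collect_eq comp
            using k yz[of 2 "Suc k"] yz[of 3 "Suc k"] by auto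
          ultimately show "grid_exit_at (1 * n) T (inner_box \<epsilon>) (\<lambda>s. 0 + (W s \<omega> - W 0 \<omega>))"
            unfolding grid_exit_at_def using k(1) by auto
        qed
        show "{\<omega> \<in> space (P 0). grid_exit_at (1 * n) T (inner_box \<epsilon>) (\<lambda>s. 0 + (W s \<omega> - W 0 \<omega>))} \<in> P.events 0"
          by (rule grid_exit_at_event) (use T closed_inner_box in auto)
      qed
      finally show ?thesis .
    qed
    then have "b * T / 4 \<le> exit_prob P W (ball 0 1) (E_box \<epsilon>) 0"
      using T(1) \<epsilon> by (intro exit_prob_ge_grid[OF _ open_E_box E_box_disjoint closed_inner_box inner_box_subset, where c=1 and T=T]) auto
    then show ?thesis by (simp add: T_def)
  qed
  then show ?thesis using a b(1) e(1) by (intro exI[of _ "b * a / 4"] conjI exI[of _ "min e (1/2)"]) auto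
qed

end

section \<open>Riemann sums for the time integral\<close>

text \<open>Applied with \<open>s = 1 - r\<close>, which is why \<open>r\<close> is kept at most
  1/2. The factor 2 bounds \<open>1 + sqrt x\<close>.\<close>

lemma one_minus_le_powr:
  fixes x s :: real
  assumes "0 \<le> x" "x \<le> 1" "1/2 \<le> s"
  shows "1 - x \<le> 2 * (1 - x powr s)"
proof -
  have "x powr s \<le> x powr (1/2)"
    using assms by (cases "x = 0") (auto intro!: powr_mono_both' simp: powr_mono')
  also have "x powr (1/2) = sqrt x" using assms(1) by (simp add: powr_half_sqrt)
  finally have "x powr s \<le> sqrt x" .
  have "1 - x = (1 - sqrt x) * (1 + sqrt x)" using assms(1) by (simp add: algebra_simps)
  also have "\<dots> \<le> (1 - sqrt x) * 2"
    using assms by (intro mult_left_mono) auto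
  also have "\<dots> \<le> (1 - x powr s) * 2" using \<open>x powr s \<le> sqrt x\<close> by simp
  finally show ?thesis by (simp only: mult.commute)
qed

text \<open>From \<open>ln x \<le> x - 1\<close> and \<open>1 + y \<le> exp y\<close>.\<close>

lemma one_minus_le_powr_minus:
  fixes x r :: real
  assumes "0 < x" "0 < r"
  shows "1 - x \<le> (x powr (- r) - 1) / r"
proof -
  have "1 + r * (1 - x) \<le> 1 + r * (- ln x)"
    using assms ln_le_minus_one[of x] by (intro add_left_mono mult_left_mono) auto
  also have "\<dots> \<le> exp (r * (- ln x))" by (rule exp_ge_add_one_self)
  also have "\<dots> = x powr (- r)" using assms by (simp add: powr_def)
  finally show ?thesis using assms by (simp add: field_simps)
qed

text \<open>Both \<open>t powr (- r)\<close> on \<open>(0, 1]\<close> and \<open>t powr (- 1 - r)\<close> on \<open>[1, \<infinity>)\<close> are integrable and decreasing;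
  \<open>G\<close> is, up to constants, an antiderivative.\<close>

lemma riemann_sum_bound:
  fixes r d :: real
  assumes r: "0 < r" "r \<le> 1/2" and d: "0 < d"
  shows "(\<Sum>k<m. d * (min 1 (real (Suc k) * d) * (real (Suc k) * d) powr (- 1 - r))) \<le> 2 + 1 / r"
proof -
  \<comment> \<open>\<open>min t 1\<close> and \<open>max t 1\<close> freeze each of the two
    antiderivatives outside its own range, so that their sum works on both.\<close>
  define G where "G t = 2 * min t 1 powr (1 - r) - max t 1 powr (- r) / r" for t :: real
  have step: "(b - a) * (min 1 b * b powr (- 1 - r)) \<le> G b - G a" if ab: "0 \<le> a" "a < b" for a b
  proof -
    have low: "(b - a) * b powr (- r) \<le> 2 * (b powr (1 - r) - a powr (1 - r))" if "0 \<le> a" "a < b" for a b :: real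
    proof -
      have b: "0 < b" using that by simp
      have "1 - a / b \<le> 2 * (1 - (a / b) powr (1 - r))"
        using that b r by (intro one_minus_le_powr) auto
      then have "b powr (1 - r) * (1 - a / b) \<le> b powr (1 - r) * (2 * (1 - (a / b) powr (1 - r)))"
        by (intro mult_left_mono) auto
      also have "\<dots> = 2 * (b powr (1 - r) - a powr (1 - r))"
        using that b by (simp add: powr_divide right_diff_distrib)
      also have "b powr (1 - r) * (1 - a / b) = (b - a) * b powr (- r)"
        using b powr_add[of b 1 "- r"] by (simp add: field_simps)
      finally show ?thesis .
    qed
    have high: "(b - a) * b powr (- 1 - r) \<le> a powr (- r) / r - b powr (- r) / r" if "0 < a" "a \<le> b" for a b :: real
    proof -
      have b: "0 < b" using that by simp
      have "1 - a / b \<le> ((a / b) powr (- r) - 1) / r"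
        using that b r by (intro one_minus_le_powr_minus) auto
      then have "b powr (- r) * (1 - a / b) \<le> b powr (- r) * (((a / b) powr (- r) - 1) / r)"
        by (intro mult_left_mono) auto
      also have "\<dots> = a powr (- r) / r - b powr (- r) / r"
        using that b by (simp add: powr_divide right_diff_distrib diff_divide_distrib)
      also have "b powr (- r) * (1 - a / b) = (b - a) * b powr (- 1 - r)"
        using b powr_add[of b "-1" "- r"] by (simp add: field_simps powr_minus_divide)
      finally show ?thesis .
    qed
    have g1: "min 1 b * b powr (- 1 - r) = b powr (- r)" if "b \<le> 1"
      using that ab powr_add[of b 1 "- 1 - r"] by (simp add: min_def)
    consider "b \<le> 1" | "1 \<le> a" | "a < 1" "1 < b" by linarith
    then show ?thesis
    proof cases
      case 1
      then show ?thesis using low[OF ab] g1 ab by (simp add: G_def min_def max_def)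
    next
      case 2
      then show ?thesis using high[of a b] ab by (cases "a = 1") (simp_all add: G_def min_def max_def)
    next
      \<comment> \<open>A cell that straddles 1 is split there. The summand is evaluated at the
        right end \<open>b\<close>, where the power is at most 1; this bounds the left part.\<close>
      case 3
      have q: "b powr (- 1 - r) \<le> 1 powr (- 1 - r)" using 3 r by (intro powr_mono2') auto
      have "(b - a) * b powr (- 1 - r) = (1 - a) * b powr (- 1 - r) + (b - 1) * b powr (- 1 - r)"
        by (simp add: algebra_simps)
      also have "\<dots> \<le> (1 - a) * 1 + (1 / r - b powr (- r) / r)"
        using q high[of 1 b] 3 by (intro add_mono mult_left_mono) auto
      also have "\<dots> \<le> 2 * (1 - a powr (1 - r)) + (1 / r - b powr (- r) / r)"
        using low[of a 1] 3 ab by simp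
      finally have "(b - a) * b powr (- 1 - r) \<le> 2 * (1 - a powr (1 - r)) + (1 / r - b powr (- r) / r)" .
      then show ?thesis using 3 by (simp add: G_def min_def max_def algebra_simps)
    qed
  qed
  have "(\<Sum>k<m. d * (min 1 (real (Suc k) * d) * (real (Suc k) * d) powr (- 1 - r))) \<le>
      (\<Sum>k<m. G (real (Suc k) * d) - G (real k * d))"
  proof (rule sum_mono)
    fix k
    have "real (Suc k) * d - real k * d = d" by (simp add: algebra_simps)
    then show "d * (min 1 (real (Suc k) * d) * (real (Suc k) * d) powr (- 1 - r)) \<le> G (real (Suc k) * d) - G (real k * d)"
      using step[of "real k * d" "real (Suc k) * d"] d by simp
  qed
  also have "\<dots> = G (real m * d) - G (real 0 * d)"
    by (rule sum_lessThan_telescope[of "\<lambda>k. G (real k * d)"])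
  also have "G (real m * d) \<le> 2"
  proof -
    have "min (real m * d) 1 powr (1 - r) \<le> 1" using d r by (intro powr_le1) auto
    moreover have "0 \<le> max (real m * d) 1 powr (- r) / r" using r by simp
    ultimately show ?thesis by (simp add: G_def)
  qed
  also have "G (real 0 * d) = - 1 / r" using r by (simp add: G_def)
  finally show ?thesis by simp
qed

section \<open>Small-ball probability of a displaced coordinate\<close>

lemma (in prob_space) indep_var_commute:
  assumes "indep_var S X T Y"
  shows "indep_var T Y S X"
proof -
  have "prob (b \<inter> a) = prob b * prob a" if "prob (a \<inter> b) = prob a * prob b" for a b
    using that by (simp add: Int_commute mult.commute)
  then show ?thesis using assms unfolding indep_var_eq indep_sets2_eq by blast
qed

text \<open>Given the value of \<open>U\<close>, the variable \<open>V\<close> must lie in an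
  interval of length \<open>2 * \<epsilon>\<close>; the bound \<open>m\<close> is uniform in the
  centre.\<close>

lemma (in prob_space) indep_var_small_ball:
  fixes U V :: "'a \<Rightarrow> real"
  assumes ind: "indep_var borel U borel V" and m: "\<And>a. \<P>(\<omega> in M. \<bar>V \<omega> - a\<bar> \<le> \<epsilon>) \<le> m"
  shows "\<P>(\<omega> in M. r \<le> \<bar>U \<omega>\<bar> \<and> \<bar>U \<omega> + V \<omega> + c\<bar> \<le> \<epsilon>) \<le> \<P>(\<omega> in M. r \<le> \<bar>U \<omega>\<bar>) * m"
proof -
  have [measurable]: "U \<in> borel_measurable M" "V \<in> borel_measurable M"
    using ind by (auto dest: indep_var_rv1 indep_var_rv2)
  let ?C = "{u::real. r \<le> \<bar>u\<bar>}"
  let ?Q = "{z\<in>space (borel \<Otimes>\<^sub>M borel). \<bar>fst z + snd z + c\<bar> \<le> (\<epsilon>::real)}"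
  have Q: "?Q \<in> sets (borel \<Otimes>\<^sub>M borel)" by measurable
  have sec: "measure (distr M borel V) (Pair u -` ?Q) \<le> m" for u
  proof -
    have "Pair u -` ?Q = {v. \<bar>u + v + c\<bar> \<le> \<epsilon>}" by (auto simp: space_pair_measure)
    then have "measure (distr M borel V) (Pair u -` ?Q) = \<P>(\<omega> in M. \<bar>V \<omega> - (- u - c)\<bar> \<le> \<epsilon>)"
      by (subst measure_distr) (auto intro!: arg_cong[where f=prob] simp: algebra_simps)
    then show ?thesis using m by simp
  qed
  have "\<P>(\<omega> in M. r \<le> \<bar>U \<omega>\<bar> \<and> \<bar>U \<omega> + V \<omega> + c\<bar> \<le> \<epsilon>) =
      (\<integral>\<omega>. indicator {\<omega>\<in>space M. r \<le> \<bar>U \<omega>\<bar> \<and> \<bar>U \<omega> + V \<omega> + c\<bar> \<le> \<epsilon>} \<omega> \<partial>M)"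
    by simp
  also have "\<dots> = (\<integral>\<omega>. indicator ?C (U \<omega>) * indicator ?Q (U \<omega>, V \<omega>) \<partial>M)"
    by (intro Bochner_Integration.integral_cong refl) (auto simp: indicator_def space_pair_measure)
  also have "\<dots> = (\<integral>\<omega>. indicator ?C (U \<omega>) * measure (distr M borel V) (Pair (U \<omega>) -` ?Q) \<partial>M)"
    by (rule indep_var_integral_section[OF ind _ Q]) measurable
  also have "\<dots> \<le> (\<integral>\<omega>. indicator ?C (U \<omega>) * m \<partial>M)"
  proof (rule integral_mono_AE')
    show "integrable M (\<lambda>\<omega>. indicator ?C (U \<omega>) * m)"
      by (intro integrable_mult_left integrable_const_bound[where B=1]) auto
    show "AE \<omega> in M. indicator ?C (U \<omega>) * measure (distr M borel V) (Pair (U \<omega>) -` ?Q) \<le> indicator ?C (U \<omega>) * m"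
      using sec by (intro AE_I2 mult_left_mono) auto
    show "AE \<omega> in M. 0 \<le> indicator ?C (U \<omega>) * m"
      using order_trans[OF measure_nonneg m] by (intro AE_I2 mult_nonneg_nonneg) auto
  qed
  also have "\<dots> = (\<integral>\<omega>. indicator {\<omega>\<in>space M. r \<le> \<bar>U \<omega>\<bar>} \<omega> \<partial>M) * m"
    unfolding integral_mult_left_zero
    by (intro arg_cong2[where f="(*)"] Bochner_Integration.integral_cong refl) (auto simp: indicator_def)
  finally show ?thesis by simp
qed

text \<open>One of the two halves of \<open>[0, t]\<close> contributes a displacement of at least 1/8; the other, independent half
  then has to hit an interval of length \<open>2 \<epsilon>\<close>.\<close>

lemma (in stable_process) prob_displaced_small_ball:
  assumes t: "0 < t" and \<epsilon>: "0 < \<epsilon>" "\<epsilon> \<le> 1/4"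
  shows "\<P>(\<omega> in M. \<bar>X t \<omega> - X 0 \<omega> + 1/2\<bar> < \<epsilon>) \<le>
    tail_const * t * (1/8) powr (- \<alpha>) * min 1 (conc_const * \<epsilon> * (t/2) powr (- 1 / \<alpha>))"
proof -
  define h where "h = t / 2"
  have h: "0 < h" "0 \<le> h" "h + h = t" using t by (auto simp: h_def)
  let ?m = "min 1 (conc_const * \<epsilon> * h powr (- 1 / \<alpha>))"
  let ?U = "\<lambda>\<omega>. X h \<omega> - X 0 \<omega>" and ?V = "\<lambda>\<omega>. X (h + h) \<omega> - X h \<omega>"
  have [measurable]: "?U \<in> borel_measurable M" "?V \<in> borel_measurable M" using h by (auto intro!: increment_measurable)
  have "indep_var borel ((\<lambda>f. f h) \<circ> (\<lambda>\<omega>. \<lambda>s\<in>{0..h}. X s \<omega> - X 0 \<omega>)) borel ((\<lambda>f. f h) \<circ> (\<lambda>\<omega>. \<lambda>s\<in>{0..}. X (h + s) \<omega> - X h \<omega>))"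
    by (rule indep_var_compose[OF past_future_indep[OF h(2)]]) (use h in \<open>auto intro!: measurable_component_singleton\<close>)
  then have UV: "indep_var borel ?U borel ?V" using h by (simp add: comp_def)
  have mU: "\<P>(\<omega> in M. \<bar>?U \<omega> - a\<bar> \<le> \<epsilon>) \<le> ?m" for a
    using prob_increment_concentration[of 0 h \<epsilon> a] h \<epsilon> by simp
  have mV: "\<P>(\<omega> in M. \<bar>?V \<omega> - a\<bar> \<le> \<epsilon>) \<le> ?m" for a
    using prob_increment_concentration[of h h \<epsilon> a] h \<epsilon> by simp
  have m0: "0 \<le> ?m" using conc_const_nonneg \<epsilon> by simp
  let ?E1 = "{\<omega>\<in>space M. 1/8 \<le> \<bar>?U \<omega>\<bar> \<and> \<bar>?U \<omega> + ?V \<omega> + 1/2\<bar> \<le> \<epsilon>}"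
  let ?E2 = "{\<omega>\<in>space M. 1/8 \<le> \<bar>?V \<omega>\<bar> \<and> \<bar>?V \<omega> + ?U \<omega> + 1/2\<bar> \<le> \<epsilon>}"
  have "\<P>(\<omega> in M. \<bar>X t \<omega> - X 0 \<omega> + 1/2\<bar> < \<epsilon>) \<le> prob (?E1 \<union> ?E2)"
  proof (rule finite_measure_mono)
    show "{\<omega>\<in>space M. \<bar>X t \<omega> - X 0 \<omega> + 1/2\<bar> < \<epsilon>} \<subseteq> ?E1 \<union> ?E2"
    proof
      fix \<omega> assume \<omega>: "\<omega> \<in> {\<omega>\<in>space M. \<bar>X t \<omega> - X 0 \<omega> + 1/2\<bar> < \<epsilon>}"
      have eq: "?U \<omega> + ?V \<omega> = X t \<omega> - X 0 \<omega>" using h(3) by simp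
      have "\<bar>?U \<omega> + ?V \<omega> + 1/2\<bar> < \<epsilon>" using \<omega> unfolding eq by simp
      \<comment> \<open>As \<open>\<epsilon> \<le> 1/4\<close>, the total displacement exceeds 1/4,
        so one half contributes at least 1/8.\<close>
      moreover from this have "1/8 \<le> \<bar>?U \<omega>\<bar> \<or> 1/8 \<le> \<bar>?V \<omega>\<bar>" using \<epsilon> by linarith
      ultimately show "\<omega> \<in> ?E1 \<union> ?E2" using \<omega> by (auto simp: add.commute)
    qed
  qed measurable
  also have "\<dots> \<le> prob ?E1 + prob ?E2" by (intro measure_Un_le) measurable
  also have "prob ?E1 \<le> \<P>(\<omega> in M. 1/8 \<le> \<bar>?U \<omega>\<bar>) * ?m" by (rule indep_var_small_ball[OF UV mV])
  also have "\<P>(\<omega> in M. 1/8 \<le> \<bar>?U \<omega>\<bar>) \<le> tail_const * h * (1/8) powr (- \<alpha>)"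
    using prob_increment_tail[of 0 h "1/8"] h by simp
  also have "prob ?E2 \<le> \<P>(\<omega> in M. 1/8 \<le> \<bar>?V \<omega>\<bar>) * ?m" by (rule indep_var_small_ball[OF indep_var_commute[OF UV] mU])
  also have "\<P>(\<omega> in M. 1/8 \<le> \<bar>?V \<omega>\<bar>) \<le> tail_const * h * (1/8) powr (- \<alpha>)"
    using prob_increment_tail[of h h "1/8"] h by simp
  finally have "\<P>(\<omega> in M. \<bar>X t \<omega> - X 0 \<omega> + 1/2\<bar> < \<epsilon>) \<le>
      tail_const * h * (1/8) powr (- \<alpha>) * ?m + tail_const * h * (1/8) powr (- \<alpha>) * ?m"
    using m0 by (simp add: mult_right_mono)
  also have "\<dots> = tail_const * (h + h) * (1/8) powr (- \<alpha>) * ?m" by (simp add: algebra_simps)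
  finally show ?thesis using h(3) by (simp add: h_def)
qed

context stable_family
begin

lemmas displaced_small_ball = stable_process.prob_displaced_small_ball[OF coord_stable_process]
lemmas coord_tail = stable_process.prob_increment_tail[OF coord_stable_process]
lemmas coord_concentration = stable_process.prob_increment_concentration[OF coord_stable_process]

end

section \<open>Positivity at the displaced starting point\<close>

context stable_family3
begin

text \<open>Two phases of length \<open>T\<close>: in the first the second coordinate goes from 1/2
  to near 0 while the others barely move, in the second the first coordinate jumps into the box. No
  rate in \<epsilon> is asked for, so \<open>T\<close> may depend on \<epsilon> in any way.\<close>

lemma exit_prob_pos:
  assumes \<epsilon>: "0 < \<epsilon>" "\<epsilon> \<le> 1/2" and w: "w = vector [0, 1/2, 0]"
  shows "0 < exit_prob P W (ball 0 1) (E_box \<epsilon>) w"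
proof -
  have wc: "w $ 1 = 0" "w $ 2 = 1/2" "w $ 3 = 0" by (simp_all add: w vector_3)
  have wn: "norm w < 1" by (simp add: norm_vec3_less_1 wc power2_eq_square)
  from steps_jump_landing[of w 1] obtain b1 \<delta>1 where b1: "0 < b1" "0 < \<delta>1"
    and land: "\<forall>t d n. 0 \<le> t \<longrightarrow> 0 \<le> d \<longrightarrow> 0 < real n * d \<longrightarrow> real n * d < \<delta>1 \<longrightarrow>
    b1 * (real n * d) \<le> P.prob w {\<omega> \<in> space (P w). \<exists>k<n. (\<forall>i\<le>k. \<bar>steps t d 1 i \<omega>\<bar> < 1/10) \<and>
      22/10 \<le> steps t d 1 (Suc k) \<omega> \<and> steps t d 1 (Suc k) \<omega> \<le> 38/10}"
    by (elim exE conjE) (rule that)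
  have "0 < \<epsilon>/8" "\<epsilon>/8 \<le> 1/10" using \<epsilon> by auto
  from steps_reaches_interval[OF this, of w 2] obtain b2 \<delta>2 where b2: "0 < b2" "0 < \<delta>2"
    and reach: "\<forall>t d n. 0 \<le> t \<longrightarrow> 0 \<le> d \<longrightarrow> 0 < real n * d \<longrightarrow> real n * d < \<delta>2 \<longrightarrow>
    b2 * (real n * d) \<le> P.prob w {\<omega> \<in> space (P w). \<bar>steps t d 2 n \<omega> + 1/2\<bar> \<le> \<epsilon>/8 \<and>
      (\<forall>i\<le>n. \<bar>steps t d 2 i \<omega> + 1/2\<bar> < 9/10)}"
    by (elim exE conjE) (rule that)
  \<comment> \<open>\<open>c * T \<le> 1\<close> makes the maximal inequality yield probability at
    least 1/2 of staying within 1/10 and of staying within \<open>\<epsilon> / 4\<close>.\<close>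
  define c where "c = 4 * tail_const * ((1/20) powr (- \<alpha>) + (\<epsilon>/8) powr (- \<alpha>))"
  have c: "0 < c" using tail_const_pos \<epsilon> by (simp add: c_def add_pos_pos)
  obtain m where m: "0 < m" "m \<le> \<delta>1" "m \<le> \<delta>2" "m \<le> 1 / c"
    using that[of "min (min \<delta>1 \<delta>2) (1 / c)"] b1(2) b2(2) c by simp
  define T where "T = m / 2"
  have T: "0 < T" "T < m" using m(1) by (auto simp: T_def)
  then have T: "0 < T" "T < \<delta>1" "T < \<delta>2" "T < 1 / c" using m by auto
  have "c * T \<le> 1" using T(4) c by (simp add: field_simps)
  then have cT: "4 * (tail_const * T * (1/20) powr (- \<alpha>)) + 4 * (tail_const * T * (\<epsilon>/8) powr (- \<alpha>)) \<le> 1"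
    by (simp add: c_def algebra_simps)
  have nn: "0 \<le> tail_const * T * (1/20) powr (- \<alpha>)" "0 \<le> tail_const * T * (\<epsilon>/8) powr (- \<alpha>)"
    using tail_const_pos T by auto
  \<comment> \<open>Grouped by coordinate, first phase times second: stay and jump; reach 0 and
    stay; stay and stay.\<close>
  define p where "p = 1/2 * (b1 * T) * (b2 * T * (1/2) * (1/2 * (1/2)))"
  have p: "0 < p" using b1 b2 T by (simp add: p_def)
  have "p \<le> P.prob w {\<omega> \<in> space (P w). grid_exit_at (2 * n) (2 * T) (inner_box \<epsilon>) (\<lambda>s. w + (W s \<omega> - W 0 \<omega>))}"
    if n: "0 < n" for n :: nat
  proof -
    define d where "d = T / real n"
    have d: "0 \<le> d" "real n * d = T" using T n by (auto simp: d_def)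
    \<comment> \<open>\<open>2 * n\<close> steps over \<open>2 * T\<close> have the mesh of
      \<open>n\<close> steps over \<open>T\<close>, so each phase takes \<open>n\<close>
      steps.\<close>
    have jd: "real j * (2 * T) / real (2 * n) = real j * d" for j by (simp add: d_def)
    have jT: "real j * d \<in> {0..T}" if "j \<le> n" for j
      using that d mult_right_mono[of "real j" "real n" d] by simp
    define A where "A = (\<lambda>i::3. \<lambda>f. if i = 1 then \<forall>j\<le>n. \<bar>f (real j * d) + 0\<bar> < 1/10
      else if i = 2 then \<bar>f (real n * d) + 1/2\<bar> \<le> \<epsilon>/8 \<and> (\<forall>j\<le>n. \<bar>f (real j * d) + 1/2\<bar> < 9/10)
      else \<forall>j\<le>n. \<bar>f (real j * d) + 0\<bar> < \<epsilon>/4)"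
    define B where "B = (\<lambda>i::3. \<lambda>f. if i = 1 then
        (\<exists>k<n. (\<forall>i\<le>k. \<bar>f (real i * d)\<bar> < 1/10) \<and> 22/10 \<le> f (real (Suc k) * d) \<and> f (real (Suc k) * d) \<le> 38/10)
      else (\<forall>j\<le>n. \<bar>f (real j * d) + 0\<bar> < \<epsilon>/4))"
    have An: "Measurable.pred (PiM {0..T} (\<lambda>_. borel)) (\<lambda>f. \<bar>f (real n * d) + 1/2\<bar> \<le> \<epsilon>/8)"
    proof -
      have [measurable]: "(\<lambda>f. f (real n * d)) \<in> borel_measurable (PiM {0..T} (\<lambda>_. borel :: real measure))"
        by (rule measurable_component_singleton[OF jT]) simp
      show ?thesis by measurable
    qed
    have A: "Measurable.pred (PiM {0..T} (\<lambda>_. borel)) (A i)" for i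
    proof -
      note stay = pred_steps_stay[OF jT, of n]
      consider "i = 1" | "i = 2" | "i \<noteq> 1" "i \<noteq> 2" by blast
      then show ?thesis
      proof cases
        case 1
        then show ?thesis unfolding A_def by (simp only: if_True simp_thms) (rule stay)
      next
        case 2
        then have "A i = (\<lambda>f. \<bar>f (real n * d) + 1/2\<bar> \<le> \<epsilon>/8 \<and> (\<forall>j\<le>n. \<bar>f (real j * d) + 1/2\<bar> < 9/10))"
          by (simp add: A_def)
        then show ?thesis using pred_intros_logic(3)[OF An stay] by (simp only:)
      next
        case 3
        then have "A i = (\<lambda>f. \<forall>j\<le>n. \<bar>f (real j * d) + 0\<bar> < \<epsilon>/4)" by (simp add: A_def)
        then show ?thesis using stay by (simp only:)
      qed
    qed
    have B: "Measurable.pred (PiM {0..} (\<lambda>_. borel)) (B i)" for i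
      unfolding B_def using d(1) by (cases "i = 1") (auto intro!: pred_steps_jump pred_steps_stay)
    have s: "coord_path T (i, True) \<omega> (real j * d) = steps T d i j \<omega>" for i j \<omega>
      using d(1) by (simp add: coord_path_True steps_def)
    have s': "coord_path T (i, False) \<omega> (real j * d) = steps 0 d i j \<omega>" if "j \<le> n" for i j \<omega>
      using jT[OF that] by (simp add: coord_path_False steps_def)
    have T0: "0 \<le> T" using T by simp
    have stay: "1/2 \<le> P.prob w {\<omega> \<in> space (P w). \<forall>j\<le>n. \<bar>steps t d i j \<omega>\<bar> < \<epsilon>/4}" if "0 \<le> t" for t i
      using steps_stay[OF that d(1) \<open>0 < \<epsilon>/8\<close>, of n w i] cT nn by (simp add: d(2))
    have A1: "1/2 \<le> P.prob w {\<omega> \<in> space (P w). A 1 (coord_path T (1, False) \<omega>)}"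
    proof -
      have "{\<omega> \<in> space (P w). A 1 (coord_path T (1, False) \<omega>)} = {\<omega> \<in> space (P w). \<forall>j\<le>n. \<bar>steps 0 d 1 j \<omega>\<bar> < 2 * (1/20)}"
        by (simp add: A_def s')
      then show ?thesis using steps_stay[OF order_refl d(1), of "1/20" n w 1] cT nn by (simp add: d(2))
    qed
    have A2: "b2 * T \<le> P.prob w {\<omega> \<in> space (P w). A 2 (coord_path T (2, False) \<omega>)}"
    proof -
      have "{\<omega> \<in> space (P w). A 2 (coord_path T (2, False) \<omega>)} =
          {\<omega> \<in> space (P w). \<bar>steps 0 d 2 n \<omega> + 1/2\<bar> \<le> \<epsilon>/8 \<and> (\<forall>i\<le>n. \<bar>steps 0 d 2 i \<omega> + 1/2\<bar> < 9/10)}"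
        by (simp add: A_def s')
      then show ?thesis using reach[rule_format, of 0 d n] d T by simp
    qed
    have A3: "1/2 \<le> P.prob w {\<omega> \<in> space (P w). A 3 (coord_path T (3, False) \<omega>)}"
    proof -
      have "{\<omega> \<in> space (P w). A 3 (coord_path T (3, False) \<omega>)} = {\<omega> \<in> space (P w). \<forall>j\<le>n. \<bar>steps 0 d 3 j \<omega>\<bar> < \<epsilon>/4}"
        by (simp add: A_def s')
      then show ?thesis using stay[OF order_refl] by (simp only:)
    qed
    have B1: "b1 * T \<le> P.prob w {\<omega> \<in> space (P w). B 1 (coord_path T (1, True) \<omega>)}"
      using land[rule_format, of T d n] d T unfolding B_def s by simp
    have B23: "1/2 \<le> P.prob w {\<omega> \<in> space (P w). B i (coord_path T (i, True) \<omega>)}" if "i \<noteq> 1" for i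
      using stay[OF T0, of i] that unfolding B_def s by simp
    have "p \<le> P.prob w {\<omega> \<in> space (P w). A 1 (coord_path T (1, False) \<omega>)} * P.prob w {\<omega> \<in> space (P w). B 1 (coord_path T (1, True) \<omega>)} *
       (P.prob w {\<omega> \<in> space (P w). A 2 (coord_path T (2, False) \<omega>)} * P.prob w {\<omega> \<in> space (P w). B 2 (coord_path T (2, True) \<omega>)} *
       (P.prob w {\<omega> \<in> space (P w). A 3 (coord_path T (3, False) \<omega>)} * P.prob w {\<omega> \<in> space (P w). B 3 (coord_path T (3, True) \<omega>)}))"
      unfolding p_def by (intro mult_mono A1 A2 A3 B1 B23) (use b1 b2 T in auto)
    also have "\<dots> = (\<Prod>i\<in>UNIV. P.prob w {\<omega> \<in> space (P w). A i (coord_path T (i, False) \<omega>)} *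
      P.prob w {\<omega> \<in> space (P w). B i (coord_path T (i, True) \<omega>)})"
      unfolding UNIV_3 by simp
    also have "\<dots> = P.prob w {\<omega> \<in> space (P w). \<forall>i. A i (coord_path T (i, False) \<omega>) \<and> B i (coord_path T (i, True) \<omega>)}"
      by (rule prob_past_future[OF T0 A B, symmetric])
    also have "\<dots> \<le> P.prob w {\<omega> \<in> space (P w). grid_exit_at (2 * n) (2 * T) (inner_box \<epsilon>) (\<lambda>s. w + (W s \<omega> - W 0 \<omega>))}"
    proof (rule P.finite_measure_mono)
      show "{\<omega> \<in> space (P w). \<forall>i. A i (coord_path T (i, False) \<omega>) \<and> B i (coord_path T (i, True) \<omega>)} \<subseteq>
          {\<omega> \<in> space (P w). grid_exit_at (2 * n) (2 * T) (inner_box \<epsilon>) (\<lambda>s. w + (W s \<omega> - W 0 \<omega>))}"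
      proof (clarify)
        fix \<omega> assume all: "\<forall>i. A i (coord_path T (i, False) \<omega>) \<and> B i (coord_path T (i, True) \<omega>)"
        have a1: "\<bar>steps 0 d 1 j \<omega>\<bar> < 1/10" if "j \<le> n" for j
          using all[rule_format, of 1] that by (simp add: A_def s')
        have a2: "\<bar>steps 0 d 2 n \<omega> + 1/2\<bar> \<le> \<epsilon>/8"
          using all[rule_format, of 2] by (simp add: A_def s')
        have a2': "\<bar>steps 0 d 2 j \<omega> + 1/2\<bar> < 9/10" if "j \<le> n" for j
          using all[rule_format, of 2] that by (simp add: A_def s')
        have a3: "\<bar>steps 0 d 3 j \<omega>\<bar> < \<epsilon>/4" if "j \<le> n" for j
          using all[rule_format, of 3] that by (simp add: A_def s')
        from all[rule_format, of 1] obtain k where k: "k < n" "\<And>i. i \<le> k \<Longrightarrow> \<bar>steps T d 1 i \<omega>\<bar> < 1/10"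
          "22/10 \<le> steps T d 1 (Suc k) \<omega>" "steps T d 1 (Suc k) \<omega> \<le> 38/10" unfolding B_def s by auto
        have yz: "\<bar>steps T d i j \<omega>\<bar> < \<epsilon>/4" if "i \<noteq> 1" "j \<le> n" for i j
          using all[rule_format, of i] that unfolding B_def s by simp
        define x where "x j = w + (W (real j * (2 * T) / real (2 * n)) \<omega> - W 0 \<omega>)" for j
        have x1: "x j $ 1 = steps 0 d 1 j \<omega>" "x j $ 2 = steps 0 d 2 j \<omega> + 1/2" "x j $ 3 = steps 0 d 3 j \<omega>" for j
          unfolding x_def jd by (simp_all add: steps_def wc)
        have split: "steps 0 d i (n + j) \<omega> = steps 0 d i n \<omega> + steps T d i j \<omega>" for i j
          using d(2) by (simp add: steps_def distrib_right)
        have sq: "a\<^sup>2 \<le> b\<^sup>2" if "\<bar>a\<bar> \<le> b" for a b :: real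
          using that by (metis abs_ge_zero power2_abs power_mono)
        have inside: "norm (x j) < 1" if j: "j \<le> n + k" for j
        proof (cases "j \<le> n")
          case True
          have "(x j $ 1)\<^sup>2 \<le> (1/10)\<^sup>2" "(x j $ 2)\<^sup>2 \<le> (9/10)\<^sup>2" "(x j $ 3)\<^sup>2 \<le> (1/8)\<^sup>2"
            unfolding x1 by (intro sq; use a1[OF True] a2'[OF True] a3[OF True] \<epsilon> in linarith)+
          then show ?thesis unfolding norm_vec3_less_1 by (simp add: power2_eq_square)
        next
          case False
          then obtain i where i: "j = n + i" "i \<le> k" using j by (metis le_iff_add nat_add_left_cancel_le nat_le_linear)
          have i': "i \<le> n" using i(2) k(1) by simp
          have yzi: "\<bar>steps T d 2 i \<omega>\<bar> < \<epsilon>/4" "\<bar>steps T d 3 i \<omega>\<bar> < \<epsilon>/4" using yz[of _ i] i' by simp_all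
          have n1: "\<bar>steps 0 d 1 n \<omega> + steps T d 1 i \<omega>\<bar> \<le> 1/5"
            using a1[OF order_refl] k(2)[OF i(2)] by linarith
          have n2: "\<bar>steps 0 d 2 n \<omega> + steps T d 2 i \<omega> + 1/2\<bar> \<le> 1/4" using a2 yzi(1) \<epsilon> by linarith
          have n3: "\<bar>steps 0 d 3 n \<omega> + steps T d 3 i \<omega>\<bar> \<le> 1/4"
            using a3[OF order_refl] yzi(2) \<epsilon> by linarith
          have "(x j $ 1)\<^sup>2 \<le> (1/5)\<^sup>2" "(x j $ 2)\<^sup>2 \<le> (1/4)\<^sup>2" "(x j $ 3)\<^sup>2 \<le> (1/4)\<^sup>2"
            unfolding x1 i(1) split by (rule sq, fact)+
          then show ?thesis unfolding norm_vec3_less_1 by (simp add: power2_eq_square)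
        qed
        \<comment> \<open>The first phase moves the first coordinate by less than 1/10, which turns
          \<open>[22/10, 38/10]\<close> into the range of \<open>inner_box\<close>.\<close>
        have land: "x (Suc (n + k)) \<in> inner_box \<epsilon>"
          unfolding inner_box_def mem_Collect_eq x1 add_Suc_right[symmetric] split
        proof (intro conjI)
          have yzk: "\<bar>steps T d 2 (Suc k) \<omega>\<bar> < \<epsilon>/4" "\<bar>steps T d 3 (Suc k) \<omega>\<bar> < \<epsilon>/4"
            using yz[of _ "Suc k"] k(1) by simp_all
          show "21/10 \<le> steps 0 d 1 n \<omega> + steps T d 1 (Suc k) \<omega>" "steps 0 d 1 n \<omega> + steps T d 1 (Suc k) \<omega> \<le> 39/10"
            using a1[OF order_refl] k(3,4) by linarith+
          show "\<bar>steps 0 d 2 n \<omega> + steps T d 2 (Suc k) \<omega> + 1/2\<bar> \<le> \<epsilon>/2" using a2 yzk(1) \<epsilon> by linarith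
          show "\<bar>steps 0 d 3 n \<omega> + steps T d 3 (Suc k) \<omega>\<bar> \<le> \<epsilon>/2" using a3[OF order_refl] yzk(2) \<epsilon> by linarith
        qed
        show "grid_exit_at (2 * n) (2 * T) (inner_box \<epsilon>) (\<lambda>s. w + (W s \<omega> - W 0 \<omega>))"
          unfolding grid_exit_at_def using inside land k(1)
          by (intro exI[of _ "n + k"]) (simp add: x_def)
      qed
      show "{\<omega> \<in> space (P w). grid_exit_at (2 * n) (2 * T) (inner_box \<epsilon>) (\<lambda>s. w + (W s \<omega> - W 0 \<omega>))} \<in> P.events w"
        by (rule grid_exit_at_event) (use T closed_inner_box in auto)
    qed
    finally show ?thesis .
  qed
  then have "p \<le> exit_prob P W (ball 0 1) (E_box \<epsilon>) w"
    using T(1) \<epsilon> wn by (intro exit_prob_ge_grid[OF _ open_E_box E_box_disjoint closed_inner_box inner_box_subset, where c=2 and T="2 * T"]) auto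
  with p show ?thesis by simp
qed

end

section \<open>Upper bound at the displaced starting point\<close>

context stable_family3
begin

text \<open>Each grid cell contributes a product over coordinates: a big increment within the cell,
  of probability of the order of its length, times the two small-ball probabilities at its end.
  Their sum is bounded by \<open>riemann_sum_bound\<close>, uniformly in the mesh.\<close>

lemma exit_prob_upper_bound:
  assumes w: "w = vector [0, 1/2, 0]"
  shows "\<exists>C>0. \<exists>\<gamma>>0. \<forall>\<epsilon>. 0 < \<epsilon> \<longrightarrow> \<epsilon> \<le> 1/4 \<longrightarrow> exit_prob P W (ball 0 1) (E_box \<epsilon>) w \<le> C * \<epsilon> powr (\<alpha> + \<gamma>)"
proof -
  have wc: "w $ 1 = 0" "w $ 2 = 1/2" "w $ 3 = 0" by (simp_all add: w vector_3)
  have wn: "norm w < 1" by (simp add: norm_vec3_less_1 wc power2_eq_square)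
  \<comment> \<open>\<open>\<gamma> \<le> (2 - \<alpha>) / 2\<close> keeps the exponent
    \<open>e\<close> at most 2, as the interpolation needs, and
    \<open>\<gamma> \<le> \<alpha> / 2\<close> gives \<open>r \<le> 1/2\<close>, as
    \<open>riemann_sum_bound\<close> needs.\<close>
  define \<gamma> where "\<gamma> = min \<alpha> (2 - \<alpha>) / 2"
  define r where "r = \<gamma> / \<alpha>"
  define e where "e = \<alpha> + \<gamma>"
  have \<gamma>: "0 < \<gamma>" "\<gamma> \<le> \<alpha> / 2" "e \<le> 2" using \<alpha> by (auto simp: \<gamma>_def e_def min_def field_simps)
  have r: "0 < r" "r \<le> 1/2" using \<gamma> \<alpha> by (auto simp: r_def field_simps)
  have e: "0 < e" "e / \<alpha> = 1 + r" using \<gamma> \<alpha> by (auto simp: e_def r_def add_divide_distrib)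
  define c1 where "c1 = (conc_const * (1/2) powr (- 1 / \<alpha>)) powr e"
  define K1 where "K1 = max 1 (tail_const * (1/8) powr (- \<alpha>))"
  define C where "C = 1 + tail_const * K1 * c1 * (2 + 1 / r)"
  have K1: "1 \<le> K1" "tail_const * (1/8) powr (- \<alpha>) \<le> K1" by (auto simp: K1_def)
  have c1: "0 \<le> c1" by (simp add: c1_def)
  have C: "0 < C"
    using tail_const_pos K1 c1 r by (auto simp: C_def intro!: add_pos_nonneg mult_nonneg_nonneg)
  have "exit_prob P W (ball 0 1) (E_box \<epsilon>) w \<le> C * \<epsilon> powr e" if \<epsilon>: "0 < \<epsilon>" "\<epsilon> \<le> 1/4" for \<epsilon>
  proof -
    \<comment> \<open>A necessary condition for an exit seen in cell \<open>k\<close>: the first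
      coordinate goes from modulus below 1 to above 2. That the path was in the ball before is
      dropped, which leaves a product over coordinates. The shift by 1/2 is the starting value of
      the second coordinate.\<close>
    define V where "V d k = {\<omega> \<in> space (P w). 1 \<le> \<bar>W (real (Suc k) * d) \<omega> $ 1 - W (real k * d) \<omega> $ 1\<bar> \<and>
      \<bar>W (real (Suc k) * d) \<omega> $ 2 - W 0 \<omega> $ 2 + 1/2\<bar> < \<epsilon> \<and> \<bar>W (real (Suc k) * d) \<omega> $ 3 - W 0 \<omega> $ 3\<bar> < \<epsilon>}" for d k
    have V_sets: "V d k \<in> P.events w" if "0 < d" for d k
    proof -
      have [measurable]: "(\<lambda>\<omega>. W (real j * d) \<omega> $ i) \<in> borel_measurable (P w)" "(\<lambda>\<omega>. W 0 \<omega> $ i) \<in> borel_measurable (P w)" for i j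
        using that by (intro coord_measurable; simp)+
      show ?thesis unfolding V_def by measurable
    qed
    have V_prob: "P.prob w (V d k) \<le> tail_const * K1 * c1 * \<epsilon> powr e * (d * (min 1 (real (Suc k) * d) * (real (Suc k) * d) powr (- 1 - r)))"
      if d: "0 < d" for d k
    proof -
      define t where "t = real (Suc k) * d"
      define s where "s = real k * d"
      have t: "0 < t" "0 \<le> s" "s + d = t" using d by (simp_all add: t_def s_def distrib_right add_pos_nonneg)
      define m where "m = min 1 (conc_const * \<epsilon> * (t/2) powr (- 1 / \<alpha>))"
      have m: "0 \<le> m" "m \<le> 1" using conc_const_nonneg \<epsilon> by (auto simp: m_def)
      define B where "B = (\<lambda>i::3. \<lambda>f. if i = 1 then 1 \<le> \<bar>f t - f s\<bar> else if i = 2 then \<bar>f t + 1/2\<bar> < \<epsilon> else \<bar>f t\<bar> < \<epsilon>)"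
      have B: "Measurable.pred (PiM {0..} (\<lambda>_. borel)) (B i)" for i
      proof -
        have [measurable]: "(\<lambda>f. f u) \<in> borel_measurable (PiM {0..} (\<lambda>_. borel :: real measure))" if "0 \<le> u" for u
          using that by (intro measurable_component_singleton) simp
        note [measurable] = this[of t] this[of s]
        show ?thesis unfolding B_def using t by (cases "i = 1"; cases "i = 2") (simp_all, measurable)
      qed
      have Vs: "V d k = {\<omega> \<in> space (P w). \<forall>i. B i (coord_path 0 (i, True) \<omega>)}"
        using t by (simp add: V_def B_def forall_3 coord_path_True t_def[symmetric] s_def[symmetric] del: of_nat_Suc)
      have p1: "P.prob w {\<omega> \<in> space (P w). B 1 (coord_path 0 (1, True) \<omega>)} \<le> tail_const * d"
        using coord_tail[of s d 1 w 1] t d by (simp add: B_def coord_path_True)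
      have p2: "P.prob w {\<omega> \<in> space (P w). B 2 (coord_path 0 (2, True) \<omega>)} \<le> tail_const * t * (1/8) powr (- \<alpha>) * m"
        using displaced_small_ball[OF t(1) \<epsilon>, of w 2] t by (simp add: B_def coord_path_True m_def)
      have half: "t powr (- 1 / \<alpha>) \<le> (t/2) powr (- 1 / \<alpha>)"
        using t \<alpha> by (intro powr_mono2') auto
      have conc: "P.prob w {\<omega> \<in> space (P w). \<bar>W t \<omega> $ i - W 0 \<omega> $ i + a\<bar> < \<epsilon>} \<le> m" for i a
      proof -
        have [measurable]: "(\<lambda>\<omega>. W t \<omega> $ i) \<in> borel_measurable (P w)" "(\<lambda>\<omega>. W 0 \<omega> $ i) \<in> borel_measurable (P w)"
          using t by (intro coord_measurable; simp)+
        have "P.prob w {\<omega> \<in> space (P w). \<bar>W t \<omega> $ i - W 0 \<omega> $ i + a\<bar> < \<epsilon>} \<le>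
            P.prob w {\<omega> \<in> space (P w). \<bar>W t \<omega> $ i - W 0 \<omega> $ i - (- a)\<bar> \<le> \<epsilon>}"
          by (intro P.finite_measure_mono) auto
        also have "\<dots> \<le> conc_const * \<epsilon> * t powr (- 1 / \<alpha>)"
          using coord_concentration[of 0 t \<epsilon> w i "- a"] t \<epsilon> by simp
        also have "\<dots> \<le> conc_const * \<epsilon> * (t/2) powr (- 1 / \<alpha>)"
          using half conc_const_nonneg \<epsilon> by (intro mult_left_mono) auto
        finally show ?thesis by (simp add: m_def)
      qed
      have p2': "P.prob w {\<omega> \<in> space (P w). B 2 (coord_path 0 (2, True) \<omega>)} \<le> m"
        using conc[of 2 "1/2"] t by (simp add: B_def coord_path_True)
      have p3: "P.prob w {\<omega> \<in> space (P w). B 3 (coord_path 0 (3, True) \<omega>)} \<le> m"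
        using conc[of 3 0] t by (simp add: B_def coord_path_True)
      \<comment> \<open>The displacement gains a factor \<open>t\<close>, which helps only for
        \<open>t \<le> 1\<close>; later the plain small-ball bound is taken.\<close>
      have p2'': "P.prob w {\<omega> \<in> space (P w). B 2 (coord_path 0 (2, True) \<omega>)} \<le> K1 * min 1 t * m"
      proof (cases "t \<le> 1")
        case True
        have "tail_const * t * (1/8) powr (- \<alpha>) * m = tail_const * (1/8) powr (- \<alpha>) * t * m" by simp
        also have "\<dots> \<le> K1 * t * m" using K1 t m by (intro mult_right_mono) auto
        finally show ?thesis using p2 True by simp
      next
        case False
        have "1 * m \<le> K1 * m" using K1 m by (intro mult_right_mono) auto
        then show ?thesis using p2' False by simp
      qed
      have mm: "m * m \<le> c1 * \<epsilon> powr e * t powr (- 1 - r)"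
      proof (cases "m = 0")
        case True
        then show ?thesis using c1 by simp
      next
        case False
        then have m0: "0 < m" using m by simp
        have "m * m = m powr 2" using m0 by (simp add: powr_numeral power2_eq_square)
        \<comment> \<open>The interpolation, by \<open>m \<le> 1\<close> and
          \<open>e \<le> 2\<close>: it gives up part of the decay in \<epsilon> for integrability in
          time near 0.\<close>
        also have "\<dots> \<le> m powr e" using m m0 \<gamma>(3) by (intro powr_mono') auto
        also have "\<dots> \<le> (conc_const * \<epsilon> * (t/2) powr (- 1 / \<alpha>)) powr e"
          using m0 e by (intro powr_mono2) (auto simp: m_def)
        also have "conc_const * \<epsilon> * (t/2) powr (- 1 / \<alpha>) = (conc_const * (1/2) powr (- 1 / \<alpha>)) * \<epsilon> * t powr (- 1 / \<alpha>)"
          using t powr_mult[of t "1/2" "- 1 / \<alpha>"] by simp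
        also have "\<dots> powr e = c1 * \<epsilon> powr e * (t powr (- 1 / \<alpha>)) powr e"
          using conc_const_nonneg \<epsilon> t by (simp add: powr_mult c1_def)
        also have "(t powr (- 1 / \<alpha>)) powr e = t powr (- (e / \<alpha>))" by (simp add: powr_powr)
        also have "- (e / \<alpha>) = - 1 - r" using e(2) by simp
        finally show ?thesis .
      qed
      have "P.prob w (V d k) = (\<Prod>i\<in>UNIV. P.prob w {\<omega> \<in> space (P w). B i (coord_path 0 (i, True) \<omega>)})"
        unfolding Vs by (rule prob_coords[OF B])
      also have "\<dots> = P.prob w {\<omega> \<in> space (P w). B 1 (coord_path 0 (1, True) \<omega>)} *
          (P.prob w {\<omega> \<in> space (P w). B 2 (coord_path 0 (2, True) \<omega>)} *
           P.prob w {\<omega> \<in> space (P w). B 3 (coord_path 0 (3, True) \<omega>)})"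
        unfolding UNIV_3 by simp
      also have "\<dots> \<le> tail_const * d * ((K1 * min 1 t * m) * m)"
        using p1 p2'' p3 m K1 t tail_const_pos d by (intro mult_mono) auto
      also have "\<dots> = tail_const * d * (K1 * min 1 t) * (m * m)" by simp
      also have "\<dots> \<le> tail_const * d * (K1 * min 1 t) * (c1 * \<epsilon> powr e * t powr (- 1 - r))"
        using mm K1 t tail_const_pos d by (intro mult_left_mono) auto
      finally show ?thesis by (simp add: t_def mult_ac)
    qed
    \<comment> \<open>All cells of the half-line at once, so no time horizon appears.\<close>
    define U where "U n = (\<Union>k. V (1 / real (Suc n)) k)" for n
    have U_sets: "U n \<in> P.events w" for n unfolding U_def using V_sets by auto
    have U_prob: "P.prob w (U n) \<le> tail_const * K1 * c1 * \<epsilon> powr e * (2 + 1 / r)" for n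
    proof -
      let ?d = "1 / real (Suc n)"
      let ?q = "\<lambda>k. tail_const * K1 * c1 * \<epsilon> powr e * (?d * (min 1 (real (Suc k) * ?d) * (real (Suc k) * ?d) powr (- 1 - r)))"
      have d: "0 < ?d" by simp
      have part: "(\<Sum>k<j. P.prob w (V ?d k)) \<le> tail_const * K1 * c1 * \<epsilon> powr e * (2 + 1 / r)" for j
      proof -
        have "(\<Sum>k<j. P.prob w (V ?d k)) \<le> (\<Sum>k<j. ?q k)" by (intro sum_mono V_prob d)
        also have "\<dots> = tail_const * K1 * c1 * \<epsilon> powr e * (\<Sum>k<j. ?d * (min 1 (real (Suc k) * ?d) * (real (Suc k) * ?d) powr (- 1 - r)))"
          by (simp only: sum_distrib_left)
        also have "\<dots> \<le> tail_const * K1 * c1 * \<epsilon> powr e * (2 + 1 / r)"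
          using tail_const_pos K1 c1 by (intro mult_left_mono riemann_sum_bound[OF r d]) auto
        finally show ?thesis .
      qed
      have sm: "summable (\<lambda>k. P.prob w (V ?d k))"
        by (rule summableI_nonneg_bounded[OF measure_nonneg part])
      have "P.prob w (U n) \<le> (\<Sum>k. P.prob w (V ?d k))"
        unfolding U_def using V_sets[OF d] sm by (intro P.finite_measure_subadditive_countably) auto
      also have "\<dots> \<le> tail_const * K1 * c1 * \<epsilon> powr e * (2 + 1 / r)"
        by (rule suminf_le_const[OF sm part])
      finally show ?thesis .
    qed
    have "exit_prob P W (ball 0 1) (E_box \<epsilon>) w = P.prob w {\<omega> \<in> space (P w). grid_exits_ever (E_box \<epsilon>) (\<lambda>t. W t \<omega>)}"
      by (rule exit_prob_eq_prob_grid[OF wn open_E_box E_box_disjoint])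
    \<comment> \<open>An exit into the open box is seen on every sufficiently fine grid, so it lies
      in the lower limit of the events \<open>U n\<close>, to which their uniform bound
      passes.\<close>
    also have "\<dots> \<le> P.prob w (\<Union>N. \<Inter>n\<in>{N..}. U n)"
    proof (rule P.finite_measure_mono_AE)
      show "AE \<omega> in P w. \<omega> \<in> {\<omega> \<in> space (P w). grid_exits_ever (E_box \<epsilon>) (\<lambda>t. W t \<omega>)} \<longrightarrow> \<omega> \<in> (\<Union>N. \<Inter>n\<in>{N..}. U n)"
        using AE_good_path[OF wn]
      proof eventually_elim
        case (elim \<omega>)
        let ?v = "\<lambda>t. W t \<omega>"
        have good: "good_path ?v" "W 0 \<omega> = w" and rc: "right_continuous ?v" using elim by (auto simp: good_path_def)
        show ?case
        proof
          assume \<omega>: "\<omega> \<in> {\<omega> \<in> space (P w). grid_exits_ever (E_box \<epsilon>) (\<lambda>t. W t \<omega>)}"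
          then have sp: "\<omega> \<in> space (P w)" and "exits_into (E_box \<epsilon>) ?v"
            using exits_into_iff_grid_exits_ever[OF good(1) open_E_box E_box_disjoint] by auto
          then obtain \<tau> where \<tau>: "0 \<le> \<tau>" "W \<tau> \<omega> \<in> E_box \<epsilon>" and before: "\<forall>s. 0 \<le> s \<longrightarrow> s < \<tau> \<longrightarrow> W s \<omega> \<in> ball 0 1"
            by (cases rule: path_exit_time_cases[OF rc open_ball[of 0 1]]) (auto simp: exits_into_def)
          have "0 < \<tau>" using \<tau> wn good(2) E_box_disjoint[of \<epsilon>] by (cases "\<tau> = 0") auto
          obtain b where b: "0 < b" "\<And>s. \<tau> \<le> s \<Longrightarrow> s < \<tau> + b \<Longrightarrow> W s \<omega> \<in> E_box \<epsilon>"
            using right_continuousD[OF rc \<tau>(1) open_E_box \<tau>(2)] by blast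
          obtain N where N: "\<And>n. N \<le> n \<Longrightarrow> 1 / real n < b" using eventually_mesh_small[OF b(1), of 1] by auto
          have "\<omega> \<in> U n" if n: "N \<le> n" for n
          proof -
            define d where "d = 1 / real (Suc n)"
            have d: "0 < d" "d < b" using N[of "Suc n"] n by (auto simp: d_def)
            define c where "c = nat \<lceil>\<tau> * real (Suc n) / 1\<rceil>"
            have c: "\<tau> \<le> real c * d" "real c * d < \<tau> + d"
              using grid_point[of 1 "Suc n" \<tau>] \<tau>(1) by (simp_all add: c_def d_def)
            have "c \<noteq> 0" using c(1) \<open>0 < \<tau>\<close> by (intro notI) simp
            then obtain k where k: "c = Suc k" by (cases c) auto
            have after: "W (real (Suc k) * d) \<omega> \<in> E_box \<epsilon>" using b(2)[of "real c * d"] c d by (simp add: k)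
            have "real k * d < \<tau>" using c(2) by (simp add: k algebra_simps)
            then have "W (real k * d) \<omega> \<in> ball 0 1" using before d by simp
            then have "\<bar>W (real k * d) \<omega> $ 1\<bar> < 1"
              using component_le_norm_cart[of "W (real k * d) \<omega>" 1] by simp
            then have "\<omega> \<in> V d k"
              using after sp good(2) wc by (auto simp: V_def E_box_def abs_less_iff)
            then show ?thesis by (auto simp: U_def d_def)
          qed
          then show "\<omega> \<in> (\<Union>N. \<Inter>n\<in>{N..}. U n)" by auto
        qed
      qed
      show "(\<Union>N. \<Inter>n\<in>{N..}. U n) \<in> P.events w" using U_sets by (intro sets.countable_UN sets.countable_INT) auto
    qed
    also have "\<dots> \<le> tail_const * K1 * c1 * \<epsilon> powr e * (2 + 1 / r)"
      by (rule P.prob_le_liminf[OF U_sets U_prob])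
    also have "\<dots> = (C - 1) * \<epsilon> powr e" by (simp add: C_def)
    also have "\<dots> \<le> C * \<epsilon> powr e" by (intro mult_right_mono) auto
    finally show ?thesis .
  qed
  then show ?thesis using C \<gamma>(1) unfolding e_def by blast
qed

end

section \<open>Divergence of the ratio and failure of the Harnack inequality\<close>

theorem mainTheorem2:
  fixes \<alpha> \<kappa> :: real
    and P :: "real^3 \<Rightarrow> 'w measure"
    and W :: "real \<Rightarrow> 'w \<Rightarrow> real^3"
    and w\<^sub>0 :: "real^3"
  assumes "0 < \<alpha>" and "\<alpha> < 2" and "0 < \<kappa>"
    and "indep_stable_family \<alpha> \<kappa> P W"
    and "w\<^sub>0 = vector [0, 1/2, 0]"
  shows "filterlim (\<lambda>\<epsilon>. exit_prob P W (ball 0 1) (E_box \<epsilon>) 0 / exit_prob P W (ball 0 1) (E_box \<epsilon>) w\<^sub>0)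
           at_top (at_right 0)
       \<and> \<not> (\<exists>c::real. \<forall>h::real^3 \<Rightarrow> real.
             (\<forall>w. 0 \<le> h w) \<longrightarrow> bounded (range h) \<longrightarrow> harmonic P W (ball 0 1) h \<longrightarrow>
             h 0 \<le> c * h w\<^sub>0)"
proof -
  interpret stable_family3 \<alpha> \<kappa> P W
    using assms(1-4) by (intro stable_family3.intro stable_family.intro)
  let ?h = "\<lambda>\<epsilon>. exit_prob P W (ball 0 1) (E_box \<epsilon>)"
  obtain c \<epsilon>0 where c: "0 < c" "0 < \<epsilon>0" and low: "\<And>\<epsilon>. 0 < \<epsilon> \<Longrightarrow> \<epsilon> < \<epsilon>0 \<Longrightarrow> c * \<epsilon> powr \<alpha> \<le> ?h \<epsilon> 0"
    using exit_prob_lower_bound by auto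
  obtain C \<gamma> where C: "0 < C" "0 < \<gamma>" and up: "\<And>\<epsilon>. 0 < \<epsilon> \<Longrightarrow> \<epsilon> \<le> 1/4 \<Longrightarrow> ?h \<epsilon> w\<^sub>0 \<le> C * \<epsilon> powr (\<alpha> + \<gamma>)"
    using exit_prob_upper_bound[OF assms(5)] by auto
  have pos: "0 < ?h \<epsilon> w\<^sub>0" if "0 < \<epsilon>" "\<epsilon> \<le> 1/4" for \<epsilon>
    using that by (intro exit_prob_pos[OF _ _ assms(5)]) auto
  have small: "eventually (\<lambda>\<epsilon>. 0 < \<epsilon> \<and> \<epsilon> < \<epsilon>0 \<and> \<epsilon> \<le> 1/4) (at_right 0)"
    unfolding eventually_at_right_field using c(2) by (intro exI[of _ "min \<epsilon>0 (1/4)"]) auto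
  have lim: "filterlim (\<lambda>\<epsilon>. ?h \<epsilon> 0 / ?h \<epsilon> w\<^sub>0) at_top (at_right 0)"
  proof (rule filterlim_at_top_mono)
    have "((\<lambda>\<epsilon>. \<epsilon> powr \<gamma>) \<longlongrightarrow> 0) (at_right (0::real))"
      using C(2) by (intro tendsto_zero_powrI[where b=\<gamma>] tendsto_ident_at tendsto_const eventually_at_right_less[THEN eventually_mono]) auto
    then have "filterlim (\<lambda>\<epsilon>::real. \<epsilon> powr (- \<gamma>)) at_top (at_right 0)"
      unfolding powr_minus by (rule filterlim_inverse_at_top) (auto intro: eventually_at_right_less[THEN eventually_mono])
    then show "filterlim (\<lambda>\<epsilon>. c / C * \<epsilon> powr (- \<gamma>)) at_top (at_right 0)"
      using c C by (intro filterlim_tendsto_pos_mult_at_top[OF tendsto_const]) auto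
    show "eventually (\<lambda>\<epsilon>. c / C * \<epsilon> powr (- \<gamma>) \<le> ?h \<epsilon> 0 / ?h \<epsilon> w\<^sub>0) (at_right 0)"
      using small
    proof eventually_elim
      case (elim \<epsilon>)
      have "c / C * \<epsilon> powr (- \<gamma>) = (c * \<epsilon> powr \<alpha>) / (C * \<epsilon> powr (\<alpha> + \<gamma>))"
        using elim c C by (simp add: powr_add powr_minus field_simps)
      also have "\<dots> \<le> ?h \<epsilon> 0 / ?h \<epsilon> w\<^sub>0"
        using elim c low[of \<epsilon>] up[of \<epsilon>] pos[of \<epsilon>] exit_prob_bounds(1) by (intro frac_le) auto
      finally show ?case .
    qed
  qed
  \<comment> \<open>For each \<open>K\<close> an \<epsilon> with ratio above \<open>K\<close> gives
    the counterexample; positivity at \<open>w\<^sub>0\<close> allows the division to be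
    cleared.\<close>
  have "\<exists>h::real^3 \<Rightarrow> real. (\<forall>w. 0 \<le> h w) \<and> bounded (range h) \<and> harmonic P W (ball 0 1) h \<and> K * h w\<^sub>0 < h 0" for K
  proof -
    have "eventually (\<lambda>\<epsilon>. K < ?h \<epsilon> 0 / ?h \<epsilon> w\<^sub>0) (at_right 0)"
      using lim unfolding filterlim_at_top_dense by blast
    then obtain \<epsilon> where \<epsilon>: "K < ?h \<epsilon> 0 / ?h \<epsilon> w\<^sub>0" "0 < \<epsilon>" "\<epsilon> \<le> 1/4"
      using eventually_happens[OF eventually_conj[OF _ small]] by auto
    have "bounded (range (?h \<epsilon>))"
      by (rule boundedI[of _ 1]) (use exit_prob_bounds in auto)
    moreover have "K * ?h \<epsilon> w\<^sub>0 < ?h \<epsilon> 0" using \<epsilon>(1) pos[OF \<epsilon>(2,3)] by (simp add: field_simps)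
    ultimately show ?thesis
      using harmonic_exit_prob[OF open_E_box E_box_disjoint] exit_prob_bounds by blast
  qed
  then show ?thesis using lim by (meson not_le)
qed

end
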